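(* For $n\in\{1,2\}$ and every partition $\lambda$ with at most $n$ positive parts, the poset $\mathcal B_\lambda^n$ is a lattice. Now suppose $n\geq 3$ and let $\lambda$ be a partition with at most $n$ positive parts. Then $\mathcal B_\lambda^n$ is a lattice if and only if at least one of the following holds: (1) $\lambda=(1^m)$ for some $0\leq m\leq n$; (2) $\lambda=(2,1^m)$ for some $1\leq m\leq n-1$; (3) $\lambda=(2^{n-m},1^m)$ for some $1\leq m\leq n-1$; (4) $\lambda=(k)$ for some $k\geq 1$; (5) $\lambda=(k^n)$ for some $k\geq 1$; (6) $\lambda=(k,1)$ for some $k\geq 1$; (7) $\lambda=(k^{n-1},k-1)$ for some $k\geq 1$; (8) $\lambda=(3,2,1)$ and $n=3$.
   Context: Superscripts denote repeated parts of a partition, e.g. $(2^3,1)=(2,2,2,1)$. Fix $n\geq 1$ and a partition $\lambda=(\lambda_1\geq\cdots\geq\lambda_\ell>0)$ with $\ell\leq n$. Cell $(i,j)$ is in row $i$ (top to bottom) and column $j$ (left to right) of the Young diagram (English notation). $\mathcal B_\lambda^n$ is the set of semistandard Young tableaux of shape $\lambda$ (rows weakly increasing left to right, columns strictly increasing top to bottom) with entries in $\{1,\ldots,n+1\}$; it is the type $A_n$ crystal of highest weight $\lambda$. The reading word of a tableau is obtained by reading its rows from the bottom row to the top row, each row left to right. For $i\in\{1,\ldots,n\}$, the lowering operator $F_i$ acts on $T$ as follows: delete from the reading word all letters other than $i$ and $i+1$, replace each $i$ by ")" and each $i+1$ by "(", and match parentheses in the usual way; if there is no unmatched ")", then $F_i(T)=0$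 (undefined); otherwise $F_i(T)$ is obtained by changing the entry $i$ of $T$ corresponding to the rightmost unmatched ")" into $i+1$. The partial order on $\mathcal B_\lambda^n$ is the one whose cover relations are $T\lessdot F_i(T)$ for $F_i(T)\neq 0$ (i.e. $T\leq T'$ iff $T'$ is obtained from $T$ by a sequence of lowering operators). *)

theory Defs
  imports Main
begin

definition is_partition :: "nat list \<Rightarrow> bool" where
  "is_partition lam \<longleftrightarrow> sorted_wrt (\<ge>) lam \<and> (\<forall>x\<in>set lam. 0 < x)"

definition cells :: "nat list \<Rightarrow> (nat \<times> nat) set" where
  "cells lam = {(i,j). i < length lam \<and> j < lam ! i}"

(* Tableaux are functions row \<Rightarrow> column \<Rightarrow> entry, equal to 0 outside the shape. *)
type_synonym tableau = "nat \<Rightarrow> nat \<Rightarrow> nat"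

definition SSYT :: "nat list \<Rightarrow> nat \<Rightarrow> tableau set" where
  "SSYT lam n = {T.
     (\<forall>i j. (i,j) \<notin> cells lam \<longrightarrow> T i j = 0) \<and>
     (\<forall>(i,j)\<in>cells lam. 1 \<le> T i j \<and> T i j \<le> n + 1) \<and>
     (\<forall>i j. (i, Suc j) \<in> cells lam \<longrightarrow> T i j \<le> T i (Suc j)) \<and>
     (\<forall>i j. (Suc i, j) \<in> cells lam \<longrightarrow> T i j < T (Suc i) j)}"

definition reading_cells :: "nat list \<Rightarrow> (nat \<times> nat) list" where
  "reading_cells lam =
     concat (map (\<lambda>i. map (\<lambda>j. (i,j)) [0..<lam ! i]) (rev [0..<length lam]))"

definition reading_word :: "nat list \<Rightarrow> tableau \<Rightarrow> nat list" where
  "reading_word lam T = map (\<lambda>(i,j). T i j) (reading_cells lam)"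

(* Positions (in the word) of unmatched ")" = letters i, where i+1 is "(" ;
   scan left to right keeping the number k of currently unmatched "(". *)
fun unmatched_close :: "nat \<Rightarrow> nat list \<Rightarrow> nat \<Rightarrow> nat \<Rightarrow> nat list" where
  "unmatched_close i [] p k = []"
| "unmatched_close i (x # xs) p k =
     (if x = i + 1 then unmatched_close i xs (Suc p) (Suc k)
      else if x = i then
        (if 0 < k then unmatched_close i xs (Suc p) (k - 1)
         else p # unmatched_close i xs (Suc p) k)
      else unmatched_close i xs (Suc p) k)"

(* Lowering operator F_i; None encodes F_i(T) = 0. *)
definition lower :: "nat list \<Rightarrow> nat \<Rightarrow> tableau \<Rightarrow> tableau option" where
  "lower lam i T =
     (let u = unmatched_close i (reading_word lam T) 0 0 in
      if u = [] then None
      else (case reading_cells lam ! last u of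
              (r, c) \<Rightarrow> Some (T(r := (T r)(c := i + 1)))))"

definition crystal_le :: "nat list \<Rightarrow> nat \<Rightarrow> tableau \<Rightarrow> tableau \<Rightarrow> bool" where
  "crystal_le lam n T T' \<longleftrightarrow>
     (T, T') \<in> {(S, S'). S \<in> SSYT lam n \<and> (\<exists>i\<in>{1..n}. lower lam i S = Some S')}\<^sup>*"

definition is_lattice_on :: "'a set \<Rightarrow> ('a \<Rightarrow> 'a \<Rightarrow> bool) \<Rightarrow> bool" where
  "is_lattice_on A le \<longleftrightarrow>
     (\<forall>x\<in>A. \<forall>y\<in>A.
        (\<exists>z\<in>A. le x z \<and> le y z \<and> (\<forall>w\<in>A. le x w \<and> le y w \<longrightarrow> le z w)) \<and>
        (\<exists>z\<in>A. le z x \<and> le z y \<and> (\<forall>w\<in>A. le w x \<and> le w y \<longrightarrow> le w z)))"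

definition crystal_is_lattice :: "nat list \<Rightarrow> nat \<Rightarrow> bool" where
  "crystal_is_lattice lam n \<longleftrightarrow> is_lattice_on (SSYT lam n) (crystal_le lam n)"

end

theory Submission
  imports Defs
begin

text \<open>A tableau is recorded by the list of its columns, each column being a set.  On this list the operator
  \<open>F\<^sub>i\<close> raises \<open>i\<close> in the column where the prefix sums of \<open>[i \<in> C] - [i + 1 \<in> C]\<close> first reach their maximum,
  and complementing all columns while reversing the list reverses the order.  Putting highest columns
  \<open>{1..h}\<close> in front and lowest columns behind embeds the poset of a shorter list of column heights as a convex
  subset.  Hence an obstruction, that is, two elements below two others with no element in
  between, found for some consecutive column heights excludes every shape containing these heights.  Together with duality,
  the obstructions for the heights \<open>(a, b)\<close> with \<open>2 \<le> b \<le> a < n\<close>, for \<open>(a, b, 1)\<close> with \<open>b + 2 \<le> a \<le> n\<close>, and for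
  \<open>(3, 2, 1, 1)\<close> when \<open>n = 3\<close> leave only the listed shapes.  For these, up to duality and convex embedding, the
  order is described by explicit inequalities from which joins can be read off; the shape \<open>(3, 2, 1)\<close> is a
  finite computation.\<close>

section \<open>Signatures and crystal operators on lists of columns\<close>

text \<open>In a column read from bottom to top, \<open>i + 1\<close> precedes \<open>i\<close>, so
  a column containing both letters contributes nothing; this gives \<open>sig\<close>. The given
  reading word goes by rows, and its agreement with the column reading needs proof: cells read at
  different times in the two readings carry, by semistandardness, letters whose signs do no harm.
  The order is only generated by steps, so the obstacle is to show that elements are incomparable.
  The tool is dominance: each step moves one column strictly down in dominance, which confines an
  element between given ones to a few candidates, and these fail because a step they need is blocked
  by other columns. For the positive cases, each model consists of inequalities saying that certain
  entries only move one way or never cross back, plus a condition on what must hold at a crossing.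
  They are found by asking what a path forces at a critical step; that they suffice is shown by
  exhibiting one admissible first step towards the target.\<close>

definition sig :: "nat \<Rightarrow> nat set \<Rightarrow> int" where
  "sig i C = (if i \<in> C then 1 else 0) - (if Suc i \<in> C then 1 else 0)"

definition raise :: "nat \<Rightarrow> nat set \<Rightarrow> nat set" where
  "raise i C = insert (Suc i) (C - {i})"

abbreviation wsum :: "('a \<Rightarrow> int) \<Rightarrow> 'a list \<Rightarrow> int" where
  "wsum f xs \<equiv> sum_list (map f xs)"

text \<open>The list in front of the raised column has this property and the list behind it has
  \<open>prefixes_nonpos\<close>. With weight 1 of the column itself, this says that the prefix sum
  ending there exceeds all earlier ones and is not exceeded later, so the column holds the rightmost
  unmatched closing bracket.\<close>

definition suffixes_nonneg :: "('a \<Rightarrow> int) \<Rightarrow> 'a list \<Rightarrow> bool" where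
  "suffixes_nonneg f A \<longleftrightarrow> (\<forall>A1 A2. A = A1 @ A2 \<longrightarrow> 0 \<le> wsum f A2)"

definition prefixes_nonpos :: "('a \<Rightarrow> int) \<Rightarrow> 'a list \<Rightarrow> bool" where
  "prefixes_nonpos f B \<longleftrightarrow> (\<forall>B1 B2. B = B1 @ B2 \<longrightarrow> wsum f B1 \<le> 0)"

lemma suffixes_nonneg_Nil [simp]: "suffixes_nonneg f []"
  by (simp add: suffixes_nonneg_def)

lemma prefixes_nonpos_Nil [simp]: "prefixes_nonpos f []"
  by (simp add: prefixes_nonpos_def)

lemma Cons_eq_append: "x # A = B1 @ B2 \<longleftrightarrow> B1 = [] \<and> B2 = x # A \<or> (\<exists>B3. B1 = x # B3 \<and> A = B3 @ B2)"
  by (auto simp: Cons_eq_append_conv)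

lemma snoc_eq_append: "A @ [x] = B1 @ B2 \<longleftrightarrow> B1 = A @ [x] \<and> B2 = [] \<or> (\<exists>B3. A = B1 @ B3 \<and> B2 = B3 @ [x])"
proof (cases B2 rule: rev_cases)
  case (snoc B3 y)
  then show ?thesis by (auto simp flip: append_assoc)
qed auto

lemma suffixes_nonneg_Cons:
  "suffixes_nonneg f (x # A) \<longleftrightarrow> 0 \<le> f x + wsum f A \<and> suffixes_nonneg f A"
proof -
  have "suffixes_nonneg f (x # A) \<longleftrightarrow> 0 \<le> wsum f (x # A) \<and> suffixes_nonneg f A"
    unfolding suffixes_nonneg_def Cons_eq_append by blast
  then show ?thesis by simp
qed

lemma prefixes_nonpos_snoc:
  "prefixes_nonpos f (B @ [x]) \<longleftrightarrow> prefixes_nonpos f B \<and> wsum f B + f x \<le> 0"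
proof -
  have "prefixes_nonpos f (B @ [x]) \<longleftrightarrow> prefixes_nonpos f B \<and> wsum f (B @ [x]) \<le> 0"
    unfolding prefixes_nonpos_def snoc_eq_append by blast
  then show ?thesis by simp
qed

lemma suffixes_nonneg_append:
  "suffixes_nonneg f A \<Longrightarrow> suffixes_nonneg f B \<Longrightarrow> suffixes_nonneg f (A @ B)"
proof (induction A)
  case (Cons x A)
  have "0 \<le> wsum f B" using Cons.prems(2) by (auto simp: suffixes_nonneg_def)
  then show ?case using Cons by (auto simp: suffixes_nonneg_Cons)
qed simp

lemma suffixes_nonneg_appendD: "suffixes_nonneg f (A @ B) \<Longrightarrow> suffixes_nonneg f B"
  by (induction A) (auto simp: suffixes_nonneg_Cons)

lemma suffixes_nonneg_wsum: "suffixes_nonneg f A \<Longrightarrow> 0 \<le> wsum f A"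
  by (auto simp: suffixes_nonneg_def)

lemma prefixes_nonpos_wsum: "prefixes_nonpos f A \<Longrightarrow> wsum f A \<le> 0"
  by (auto simp: prefixes_nonpos_def)

lemma prefixes_nonpos_rev: "prefixes_nonpos f (rev A) \<longleftrightarrow> suffixes_nonneg (\<lambda>x. - f x) A"
proof -
  have neg: "wsum (\<lambda>x. - f x) B = - wsum f B" for B
    by (induction B) auto
  have r: "wsum f (rev B) = wsum f B" for B
    by (induction B) auto
  have "prefixes_nonpos f (rev A) \<longleftrightarrow> (\<forall>A1 A2. A = A1 @ A2 \<longrightarrow> wsum f A2 \<le> 0)"
    unfolding prefixes_nonpos_def by (metis r rev_append rev_rev_ident)
  then show ?thesis by (simp add: suffixes_nonneg_def neg)
qed

lemma prefixes_nonpos_append: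
  assumes "prefixes_nonpos f A" "prefixes_nonpos f B"
  shows "prefixes_nonpos f (A @ B)"
proof -
  have "suffixes_nonneg (\<lambda>x. - f x) (rev B @ rev A)"
    using assms by (intro suffixes_nonneg_append) (simp_all add: prefixes_nonpos_rev[symmetric])
  then have "prefixes_nonpos f (rev (rev B @ rev A))" by (simp only: prefixes_nonpos_rev)
  then show ?thesis by simp
qed

lemma prefixes_nonpos_appendD: "prefixes_nonpos f (A @ B) \<Longrightarrow> prefixes_nonpos f A"
  unfolding prefixes_nonpos_def by (metis append_assoc)

lemma suffixes_nonnegI: "(\<And>x. x \<in> set A \<Longrightarrow> 0 \<le> f x) \<Longrightarrow> suffixes_nonneg f A"
  unfolding suffixes_nonneg_def by (auto intro!: sum_list_nonneg)

lemma prefixes_nonposI: "(\<And>x. x \<in> set A \<Longrightarrow> f x \<le> 0) \<Longrightarrow> prefixes_nonpos f A"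
  unfolding prefixes_nonpos_def by (auto intro!: sum_list_nonpos)

text \<open>Prepending a nonnegative weight cannot spoil the sum, so only suffixes that start with a
  negative weight are critical. In a reading word such a suffix starts with the letter
  \<open>i + 1\<close>, and the comparison of cells uses this known letter.\<close>

lemma suffixes_nonneg_if_neg_heads:
  assumes "\<And>A1 x A2. A = A1 @ x # A2 \<Longrightarrow> f x < 0 \<Longrightarrow> 0 \<le> wsum f (x # A2)"
  shows "suffixes_nonneg f A"
  using assms
proof (induction A)
  case (Cons x A)
  have "suffixes_nonneg f A"
  proof (rule Cons.IH)
    fix A1 y A2 assume "A = A1 @ y # A2" "f y < 0"
    then show "0 \<le> wsum f (y # A2)" using Cons.prems[of "x # A1" y A2] by simp
  qed
  moreover have "0 \<le> f x + wsum f A"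
    using Cons.prems[of "[]" x A] suffixes_nonneg_wsum[OF calculation] by fastforce
  ultimately show ?case by (simp add: suffixes_nonneg_Cons)
qed simp

text \<open>The mirror image: the critical prefixes of a reading word end with the letter
  \<open>i\<close>.\<close>

lemma prefixes_nonpos_if_pos_lasts:
  assumes "\<And>A1 x A2. A = A1 @ x # A2 \<Longrightarrow> 0 < f x \<Longrightarrow> wsum f (A1 @ [x]) \<le> 0"
  shows "prefixes_nonpos f A"
  using assms
proof (induction A rule: rev_induct)
  case (snoc x A)
  have "prefixes_nonpos f A"
  proof (rule snoc.IH)
    fix A1 y A2 assume "A = A1 @ y # A2" "0 < f y"
    then show "wsum f (A1 @ [y]) \<le> 0" using snoc.prems[of A1 y "A2 @ [x]"] by simp
  qed
  moreover have "wsum f A + f x \<le> 0"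
    using snoc.prems[of A x "[]"] prefixes_nonpos_wsum[OF calculation] by fastforce
  ultimately show ?case by (simp add: prefixes_nonpos_snoc)
qed simp

text \<open>The split point is the shortest prefix of maximal weight.\<close>

lemma signature_split_exists:
  fixes f :: "'a \<Rightarrow> int"
  assumes pos: "\<not> prefixes_nonpos f X" and le1: "\<And>x. x \<in> set X \<Longrightarrow> f x \<le> 1"
  shows "\<exists>A C B. X = A @ C # B \<and> f C = 1 \<and> suffixes_nonneg f A \<and> prefixes_nonpos f B"
proof -
  define h where "h l = wsum f (take l X)" for l
  define m where "m = Max (h ` {..length X})"
  have hm: "h l \<le> m" if "l \<le> length X" for l
    using that by (auto simp: m_def)
  have "m \<in> h ` {..length X}" unfolding m_def by (intro Max_in) auto
  then have ex: "\<exists>l. l \<le> length X \<and> h l = m" by auto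
  define l where "l = (LEAST l. l \<le> length X \<and> h l = m)"
  have l: "l \<le> length X" "h l = m"
    using LeastI_ex[OF ex] by (simp_all add: l_def)
  have less: "h l' < m" if "l' < l" for l'
    using not_less_Least[OF that[unfolded l_def]] hm[of l'] that l(1) by (simp add: order_less_le)
  obtain B1 B2 where "X = B1 @ B2" "0 < wsum f B1"
    using pos by (auto simp: prefixes_nonpos_def not_le)
  then have "0 < m" using hm[of "length B1"] by (simp add: h_def)
  then have "l \<noteq> 0" using l(2) by (intro notI) (simp add: h_def)
  then obtain k where k: "l = Suc k" by (cases l) auto
  have X: "X = take k X @ X ! k # drop l X"
    using l(1) k by (simp add: id_take_nth_drop)
  have hl: "h l = h k + f (X ! k)" using l(1) k by (simp add: h_def take_Suc_conv_app_nth)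
  have "f (X ! k) \<le> 1" using le1 l(1) k by simp
  with hl less[of k] l(2) k have C: "f (X ! k) = 1" by simp
  have A: "suffixes_nonneg f (take k X)"
    unfolding suffixes_nonneg_def
  proof (intro allI impI)
    fix A1 A2 assume e: "take k X = A1 @ A2"
    have "length A1 \<le> k" using e by (metis length_append length_take le_add1 min.bounded_iff order_trans)
    then have "h (length A1) < m" using less k by simp
    moreover have "take (length A1) X = A1"
      using e \<open>length A1 \<le> k\<close> by (metis append_eq_conv_conj min.absorb2 min.commute take_take)
    moreover have "h k = wsum f A1 + wsum f A2" by (simp add: h_def e)
    ultimately show "0 \<le> wsum f A2" using hl C l(2) by (simp add: h_def)
  qed
  have B: "prefixes_nonpos f (drop l X)"
    unfolding prefixes_nonpos_def
  proof (intro allI impI)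
    fix B1 B2 assume e: "drop l X = B1 @ B2"
    have "X = take l X @ B1 @ B2" by (metis append_take_drop_id e)
    then have t: "take (l + length B1) X = take l X @ B1"
      using l(1) by (metis append_assoc append_eq_conv_conj e take_add)
    have "length (take l X @ B1) \<le> length X"
      using t by (metis length_take min.cobounded1)
    then have "h (l + length B1) \<le> m" using l(1) by (intro hm) simp
    then show "wsum f B1 \<le> 0" using l(2) t by (simp add: h_def)
  qed
  show ?thesis using X C A B by blast
qed

definition colstep :: "nat \<Rightarrow> nat set list \<Rightarrow> nat set list \<Rightarrow> bool" where
  "colstep i X Y \<longleftrightarrow> (\<exists>A C B. X = A @ C # B \<and> Y = A @ raise i C # B \<and> i \<in> C \<and> Suc i \<notin> C \<and>
     suffixes_nonneg (sig i) A \<and> prefixes_nonpos (sig i) B)"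

lemma sig_eq_1: "sig i C = 1 \<longleftrightarrow> i \<in> C \<and> Suc i \<notin> C"
  by (simp add: sig_def)

lemma sig_bounds: "sig i C \<le> 1" "-1 \<le> sig i C"
  by (simp_all add: sig_def)

lemma colstepI:
  "i \<in> C \<Longrightarrow> Suc i \<notin> C \<Longrightarrow> suffixes_nonneg (sig i) A \<Longrightarrow> prefixes_nonpos (sig i) B \<Longrightarrow>
   colstep i (A @ C # B) (A @ raise i C # B)"
  by (auto simp: colstep_def)

text \<open>If one split lay to the left of the other, the segment \<open>M\<close> between the two
  chosen columns would end the list in front of the second, so its sum would be nonnegative; but
  \<open>M\<close> followed by the second column starts the list behind the first, so that sum plus
  1 would be at most 0.\<close>

lemma signature_split_unique:
  fixes f :: "'a \<Rightarrow> int"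
  assumes "A @ C # B = A' @ C' # B'" "f C = 1" "f C' = 1"
    "suffixes_nonneg f A" "prefixes_nonpos f B" "suffixes_nonneg f A'" "prefixes_nonpos f B'"
  shows "A = A' \<and> C = C' \<and> B = B'"
proof -
  have no: False if asm: "A @ C # B = A' @ C' # B'" "f C = 1" "f C' = 1"
    "suffixes_nonneg f A'" "prefixes_nonpos f B" "length A < length A'" for A A' C C' B B'
  proof -
    obtain M where M: "A' = A @ C # M"
    proof -
      obtain us where "A = A' @ us \<or> A @ us = A' \<and> C # B = us @ C' # B'"
        using asm(1) by (auto simp: append_eq_append_conv2)
      with asm(6) have us: "A @ us = A'" "C # B = us @ C' # B'" "us \<noteq> []" by auto
      then obtain M where "us = C # M" by (cases us) auto
      with us(1) have "A' = A @ C # M" by simp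
      then show thesis by (rule that)
    qed
    have "B = M @ C' # B'" using asm(1) M by simp
    then have "prefixes_nonpos f (M @ [C'])" using asm(5) prefixes_nonpos_appendD[of f "M @ [C']" B'] by simp
    then have "wsum f M + f C' \<le> 0" by (simp add: prefixes_nonpos_snoc)
    moreover have "suffixes_nonneg f M" using asm(4) suffixes_nonneg_appendD[of f "A @ [C]" M] M by simp
    ultimately show False using asm(3) suffixes_nonneg_wsum[of f M] by simp
  qed
  have "\<not> length A < length A'" "\<not> length A' < length A"
    using no[OF assms(1) assms(2,3,6,5)] no[OF assms(1)[symmetric] assms(3,2,4,7)] by auto
  then have "length A = length A'" by simp
  then show ?thesis using assms(1) by simp
qed

lemma colstep_unique:
  assumes "colstep i X Y" "colstep i X Z"
  shows "Y = Z"
proof -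
  obtain A C B where 1: "X = A @ C # B" "Y = A @ raise i C # B" "sig i C = 1"
    "suffixes_nonneg (sig i) A" "prefixes_nonpos (sig i) B"
    using assms(1) by (auto simp: colstep_def sig_eq_1)
  obtain A' C' B' where 2: "X = A' @ C' # B'" "Z = A' @ raise i C' # B'" "sig i C' = 1"
    "suffixes_nonneg (sig i) A'" "prefixes_nonpos (sig i) B'"
    using assms(2) by (auto simp: colstep_def sig_eq_1)
  show ?thesis
    using signature_split_unique[of A C B A' C' B' "sig i"] 1 2 by simp
qed

lemma colstep_exists:
  assumes "\<not> prefixes_nonpos (sig i) X"
  shows "\<exists>Y. colstep i X Y"
  using signature_split_exists[OF assms sig_bounds(1)] by (auto simp: colstep_def sig_eq_1)

lemma colstep_not_prefixes_nonpos:
  assumes "colstep i X Y"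
  shows "\<not> prefixes_nonpos (sig i) X"
proof
  assume p: "prefixes_nonpos (sig i) X"
  obtain A C B where 1: "X = A @ C # B" "sig i C = 1" "suffixes_nonneg (sig i) A"
    using assms by (auto simp: colstep_def sig_eq_1)
  have "prefixes_nonpos (sig i) (A @ [C])" using p 1 prefixes_nonpos_appendD[of _ "A @ [C]" B] by simp
  then show False using 1 suffixes_nonneg_wsum[of "sig i" A] by (simp add: prefixes_nonpos_snoc)
qed

text \<open>For finite sets this is the condition on neighbouring columns of a semistandard tableau:
  the \<open>k\<close>-th smallest entry of \<open>C\<close> is at most that of \<open>D\<close>,
  for every \<open>k\<close> up to the size of \<open>D\<close>. Counting below thresholds avoids
  sorting, and a raise changes a single count.\<close>

definition dominates :: "nat set \<Rightarrow> nat set \<Rightarrow> bool" where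
  "dominates C D \<longleftrightarrow> (\<forall>t. card (D \<inter> {..t}) \<le> card (C \<inter> {..t}))"

definition columns :: "nat list \<Rightarrow> nat \<Rightarrow> nat set list set" where
  "columns mu n = {X. list_all2 (\<lambda>C h. C \<subseteq> {1..Suc n} \<and> card C = h) X mu \<and> sorted_wrt dominates X}"

definition column_le :: "nat \<Rightarrow> nat set list \<Rightarrow> nat set list \<Rightarrow> bool" where
  "column_le n = (\<lambda>X Y. \<exists>i\<in>{1..n}. colstep i X Y)\<^sup>*\<^sup>*"

definition column_lattice :: "nat list \<Rightarrow> nat \<Rightarrow> bool" where
  "column_lattice mu n \<longleftrightarrow> is_lattice_on (columns mu n) (column_le n)"

definition highest :: "nat list \<Rightarrow> nat set list" where
  "highest mu = map (\<lambda>h. {1..h}) mu"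

section \<open>Dominance of columns and its behaviour under raises\<close>

lemma dominates_refl [simp]: "dominates C C"
  by (simp add: dominates_def)

lemma dominates_trans: "dominates C D \<Longrightarrow> dominates D E \<Longrightarrow> dominates C E"
  unfolding dominates_def by (meson order_trans)

lemma card_atMost_eq_iff:
  assumes "0 \<notin> C"
  shows "t \<le> card (C \<inter> {..t}) \<longleftrightarrow> {1..t} \<subseteq> C"
proof
  assume le: "t \<le> card (C \<inter> {..t})"
  have "C \<inter> {..t} \<subseteq> {1..t}" using assms by (auto simp: Suc_le_eq intro: gr0I)
  then have "C \<inter> {..t} = {1..t}" using le by (intro card_seteq) auto
  then show "{1..t} \<subseteq> C" by auto
next
  assume "{1..t} \<subseteq> C"
  then have "card {1..t} \<le> card (C \<inter> {..t})" by (intro card_mono) auto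
  then show "t \<le> card (C \<inter> {..t})" by simp
qed

lemma card_Int_atMost_Suc:
  "card (C \<inter> {..Suc t}) = card (C \<inter> {..t}) + (if Suc t \<in> C then 1 else 0)"
proof -
  have "C \<inter> {..Suc t} = (if Suc t \<in> C then insert (Suc t) (C \<inter> {..t}) else C \<inter> {..t})"
    by (auto simp: le_Suc_eq)
  then show ?thesis by simp
qed

lemma card_raise_atMost:
  assumes "i \<in> C" "Suc i \<notin> C"
  shows "card (C \<inter> {..t}) = card (raise i C \<inter> {..t}) + (if t = i then 1 else 0)"
proof -
  consider "t < i" | "t = i" | "i < t" by linarith
  then show ?thesis
  proof cases
    case 1
    then have "raise i C \<inter> {..t} = C \<inter> {..t}" by (auto simp: raise_def)
    with 1 show ?thesis by simp
  next
    case 2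
    then have "C \<inter> {..t} = insert i (raise i C \<inter> {..t})" "i \<notin> raise i C"
      using assms by (auto simp: raise_def)
    with 2 show ?thesis by simp
  next
    case 3
    then have "C \<inter> {..t} = insert i (C \<inter> {..t} - {i})"
      "raise i C \<inter> {..t} = insert (Suc i) (C \<inter> {..t} - {i})" using assms by (auto simp: raise_def)
    moreover have "card (insert i (C \<inter> {..t} - {i})) = Suc (card (C \<inter> {..t} - {i}))"
      by (rule card_insert_disjoint) auto
    moreover have "card (insert (Suc i) (C \<inter> {..t} - {i})) = Suc (card (C \<inter> {..t} - {i}))"
      using assms by (intro card_insert_disjoint) auto
    ultimately show ?thesis using 3 by simp
  qed
qed

lemma dominates_raise:
  assumes "i \<in> C" "Suc i \<notin> C"
  shows "dominates C (raise i C)"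
  by (simp add: dominates_def card_raise_atMost[OF assms])

lemma not_dominates_raise:
  assumes "i \<in> C" "Suc i \<notin> C"
  shows "\<not> dominates (raise i C) C"
  using card_raise_atMost[OF assms, of i] by (auto simp: dominates_def intro!: exI[of _ i])

lemma card_raise: "i \<in> C \<Longrightarrow> Suc i \<notin> C \<Longrightarrow> finite C \<Longrightarrow> card (raise i C) = card C"
  using card_Suc_Diff1[of C i] by (simp add: raise_def)

lemma dominates_antisym:
  assumes "dominates C D" "dominates D C" "0 \<notin> C" "0 \<notin> D"
  shows "C = D"
proof -
  have e: "card (C \<inter> {..t}) = card (D \<inter> {..t})" for t
    using assms by (simp add: dominates_def le_antisym)
  have "x \<in> C \<longleftrightarrow> x \<in> D" for x
  proof (cases x)
    case (Suc t)
    then show ?thesis using e[of t] e[of "Suc t"] by (auto simp: card_Int_atMost_Suc split: if_splits)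
  qed (use assms in simp)
  then show ?thesis by blast
qed

text \<open>At the threshold \<open>i\<close> the column \<open>raise i C\<close> has lost one
  element, while \<open>raise k C\<close> has lost one only if \<open>k = i\<close>.\<close>

lemma raise_inj:
  assumes "i \<in> C" "Suc i \<notin> C" "k \<in> C" "Suc k \<notin> C" "dominates (raise i C) (raise k C)"
  shows "i = k"
  using card_raise_atMost[OF assms(1,2), of i] card_raise_atMost[OF assms(3,4), of i] assms(5)
  by (fastforce simp: dominates_def split: if_splits dest: spec[of _ i])

text \<open>The counts of \<open>C\<close> and \<open>raise k C\<close> differ at one threshold
  only, and there by one, so nothing lies strictly between. This leaves two candidates for a column
  of a hypothetical intermediate element.\<close>

lemma dominates_between_raise:
  assumes "dominates C K" "dominates K (raise k C)" "k \<in> C" "Suc k \<notin> C" "0 \<notin> C" "0 \<notin> K"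
  shows "K = C \<or> K = raise k C"
proof (rule disjCI)
  assume ne: "K \<noteq> raise k C"
  have "0 \<notin> raise k C" using assms by (simp add: raise_def)
  then obtain t where t: "card (raise k C \<inter> {..t}) < card (K \<inter> {..t})"
  proof -
    have "\<not> dominates (raise k C) K" using ne assms(2,6) \<open>0 \<notin> raise k C\<close> dominates_antisym by blast
    then show thesis using that by (auto simp: dominates_def not_le)
  qed
  have le: "card (K \<inter> {..u}) \<le> card (C \<inter> {..u})" "card (raise k C \<inter> {..u}) \<le> card (K \<inter> {..u})" for u
    using assms(1,2) by (auto simp: dominates_def)
  have "dominates K C"
    unfolding dominates_def
  proof
    fix u
    show "card (C \<inter> {..u}) \<le> card (K \<inter> {..u})"
      using card_raise_atMost[OF assms(3,4), of t] card_raise_atMost[OF assms(3,4), of u] t le[of t] le[of u]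
      by (auto split: if_splits)
  qed
  with assms show "K = C" by (intro dominates_antisym)
qed

lemma dominates_between_two_raises:
  assumes "dominates C K" "dominates K (raise k C)" "dominates K (raise l C)" "k \<noteq> l" "0 \<notin> C" "0 \<notin> K"
    "k \<in> C" "Suc k \<notin> C" "l \<in> C" "Suc l \<notin> C"
  shows "K = C"
  using dominates_between_raise[of C K k] raise_inj[of k C l] assms by auto

lemma columns_length: "X \<in> columns mu n \<Longrightarrow> length X = length mu"
  by (auto simp: columns_def dest: list_all2_lengthD)

lemma columns_subset: "X \<in> columns mu n \<Longrightarrow> C \<in> set X \<Longrightarrow> C \<subseteq> {1..Suc n}"
  by (auto simp: columns_def list_all2_conv_all_nth in_set_conv_nth)

lemma finite_columns: "finite (columns mu n)"
proof (rule finite_subset)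
  show "columns mu n \<subseteq> {X. set X \<subseteq> Pow {1..Suc n} \<and> length X = length mu}"
    using columns_subset columns_length by fastforce
  show "finite {X. set X \<subseteq> Pow {1..Suc n} \<and> length X = length mu}"
    by (intro finite_lists_length_eq) simp
qed

text \<open>Only the count at threshold \<open>i\<close> drops, so it has to be strictly larger for
  \<open>C\<close> beforehand. If it were equal to that of \<open>D\<close>, the inequalities at
  \<open>i - 1\<close> and \<open>i + 1\<close> would force \<open>i\<close> into \<open>D\<close>
  and \<open>i + 1\<close> out of \<open>D\<close>, giving \<open>D\<close> signature 1.\<close>

lemma raise_dominates:
  assumes "dominates C D" "i \<in> C" "Suc i \<notin> C" "sig i D \<le> 0" "0 < i"
  shows "dominates (raise i C) D"
  unfolding dominates_def
proof
  fix t
  have le: "card (D \<inter> {..u}) \<le> card (C \<inter> {..u})" for u using assms(1) by (simp add: dominates_def)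
  obtain j where j: "i = Suc j" using assms(5) by (cases i) auto
  have "card (D \<inter> {..i}) < card (C \<inter> {..i})"
  proof (rule ccontr)
    assume "\<not> ?thesis"
    then have e: "card (D \<inter> {..i}) = card (C \<inter> {..i})" using le[of i] by simp
    then have "i \<in> D" using le[of j] assms(2) j by (auto simp: card_Int_atMost_Suc split: if_splits)
    moreover have "Suc i \<notin> D" using e le[of "Suc i"] assms(3) by (auto simp: card_Int_atMost_Suc split: if_splits)
    ultimately show False using assms(4) by (simp add: sig_def)
  qed
  then show "card (D \<inter> {..t}) \<le> card (raise i C \<inter> {..t})"
    using card_raise_atMost[OF assms(2,3), of t] le[of t] by (auto split: if_splits)
qed

lemma colstep_columns:
  assumes "colstep i X Y" "X \<in> columns mu n" "i \<in> {1..n}"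
  shows "Y \<in> columns mu n"
proof -
  obtain A C B where 1: "X = A @ C # B" "Y = A @ raise i C # B" "i \<in> C" "Suc i \<notin> C"
    "prefixes_nonpos (sig i) B"
    using assms(1) by (auto simp: colstep_def)
  have s: "sorted_wrt dominates (A @ C # B)" using assms(2) 1 by (simp add: columns_def)
  have C: "C \<subseteq> {1..Suc n}" using assms(2) 1 columns_subset by auto
  then have fin: "finite C" by (rule finite_subset) simp
  have "dominates (raise i C) D" if "D \<in> set B" for D
  proof (cases B)
    case (Cons E B')
    \<comment> \<open>The right neighbour of the raised column is by itself a prefix of
      \<open>B\<close>, so its signature is nonpositive; the columns further right follow by
      transitivity.\<close>
    have "prefixes_nonpos (sig i) [E]" using 1(5) Cons prefixes_nonpos_appendD[of _ "[E]" B'] by simp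
    then have "sig i E \<le> 0" using prefixes_nonpos_wsum by fastforce
    moreover have "dominates C E" using s Cons by (simp add: sorted_wrt_append)
    ultimately have "dominates (raise i C) E" using raise_dominates 1 assms(3) by simp
    moreover have "dominates E D" using s Cons that by (auto simp: sorted_wrt_append)
    ultimately show ?thesis using dominates_trans by blast
  qed (use that in simp)
  moreover have "dominates D (raise i C)" if "D \<in> set A" for D
    using s that dominates_trans[of D C "raise i C"] dominates_raise[OF 1(3,4)] by (simp add: sorted_wrt_append)
  ultimately have "sorted_wrt dominates Y" using s by (auto simp: 1(2) sorted_wrt_append)
  moreover have "list_all2 (\<lambda>C h. C \<subseteq> {1..Suc n} \<and> card C = h) Y mu"
  proof -
    obtain m1 h m2 where mu: "mu = m1 @ h # m2" "length m1 = length A"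
      "list_all2 (\<lambda>C h. C \<subseteq> {1..Suc n} \<and> card C = h) A m1" "card C = h"
      "list_all2 (\<lambda>C h. C \<subseteq> {1..Suc n} \<and> card C = h) B m2"
      using assms(2) 1(1) by (auto simp: columns_def list_all2_append1 list_all2_Cons1)
    moreover have "raise i C \<subseteq> {1..Suc n}" using C assms(3) by (auto simp: raise_def)
    ultimately show ?thesis using card_raise[OF 1(3,4) fin] by (simp add: 1(2) list_all2_append)
  qed
  ultimately show ?thesis by (simp add: columns_def)
qed

lemma column_le_refl [simp]: "column_le n X X"
  by (simp add: column_le_def)

lemma column_le_trans: "column_le n X Y \<Longrightarrow> column_le n Y Z \<Longrightarrow> column_le n X Z"
  by (simp add: column_le_def)

lemma colstep_le: "colstep i X Y \<Longrightarrow> i \<in> {1..n} \<Longrightarrow> column_le n X Y"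
  unfolding column_le_def by blast

lemma column_le_columns:
  assumes "column_le n X Y" "X \<in> columns mu n"
  shows "Y \<in> columns mu n"
  using assms(1) unfolding column_le_def
  by (induction rule: rtranclp_induct) (use assms(2) colstep_columns in blast)+

lemma colstep_dominates: "colstep i X Y \<Longrightarrow> list_all2 dominates X Y"
  by (auto simp: colstep_def list_all2_append list_all2_refl dominates_raise)

text \<open>A necessary condition for the order. With antisymmetry of dominance it freezes, for all
  elements between \<open>X\<close> and \<open>Y\<close>, every column in which \<open>X\<close> and
  \<open>Y\<close> agree.\<close>

lemma column_le_dominates: "column_le n X Y \<Longrightarrow> list_all2 dominates X Y"
  unfolding column_le_def
proof (induction rule: rtranclp_induct)
  case (step Y Z)
  then show ?case using colstep_dominates list_all2_trans[of dominates dominates dominates X Y Z] dominates_trans by blast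
qed (simp add: list_all2_refl)

lemma columns_no_0: "X \<in> columns mu n \<Longrightarrow> C \<in> set X \<Longrightarrow> 0 \<notin> C"
  using columns_subset by fastforce

text \<open>Every step adds one to the sum of all entries, so this grades the poset; it is the
  measure for inductions along paths in both directions.\<close>

definition rank :: "nat set list \<Rightarrow> nat" where
  "rank X = sum_list (map \<Sum> X)"

lemma colstep_rank:
  assumes "colstep i X Y" "X \<in> columns mu n"
  shows "rank Y = Suc (rank X)"
proof -
  obtain A C B where 1: "X = A @ C # B" "Y = A @ raise i C # B" "i \<in> C" "Suc i \<notin> C"
    using assms(1) by (auto simp: colstep_def)
  have "C \<subseteq> {1..Suc n}" using assms(2) 1 columns_subset by auto
  then have fin: "finite C" by (rule finite_subset) simp
  have "\<Sum>(raise i C) = Suc i + \<Sum>(C - {i})" using fin 1 by (simp add: raise_def)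
  also have "\<dots> = Suc (\<Sum>C)" using fin 1 by (simp add: sum.remove[of C i])
  finally show ?thesis by (simp add: rank_def 1)
qed

lemma rank_le:
  assumes "X \<in> columns mu n"
  shows "rank X \<le> length mu * \<Sum>{1..Suc n}"
proof -
  have "\<Sum>C \<le> \<Sum>{1..Suc n}" if "C \<in> set X" for C
    using columns_subset[OF assms that] by (intro sum_mono2) auto
  then have "rank X \<le> sum_list (map (\<lambda>_. \<Sum>{1..Suc n}) X)"
    unfolding rank_def by (intro sum_list_mono) auto
  then show ?thesis using columns_length[OF assms] by (simp add: sum_list_replicate map_replicate_const)
qed

lemma is_lattice_on_join:
  assumes "is_lattice_on A le" "x \<in> A" "y \<in> A"
  obtains z where "z \<in> A" "le x z" "le y z" "\<And>w. w \<in> A \<Longrightarrow> le x w \<Longrightarrow> le y w \<Longrightarrow> le z w"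
proof -
  have "\<exists>z\<in>A. le x z \<and> le y z \<and> (\<forall>w\<in>A. le x w \<and> le y w \<longrightarrow> le z w)"
    using assms by (simp add: is_lattice_on_def)
  then obtain z where "z \<in> A" and z: "le x z \<and> le y z \<and> (\<forall>w\<in>A. le x w \<and> le y w \<longrightarrow> le z w)"
    by (elim bexE)
  then show thesis using that[of z] by simp
qed

lemma is_lattice_on_meet:
  assumes "is_lattice_on A le" "x \<in> A" "y \<in> A"
  obtains z where "z \<in> A" "le z x" "le z y" "\<And>w. w \<in> A \<Longrightarrow> le w x \<Longrightarrow> le w y \<Longrightarrow> le w z"
proof -
  have "\<exists>z\<in>A. le z x \<and> le z y \<and> (\<forall>w\<in>A. le w x \<and> le w y \<longrightarrow> le w z)"
    using assms by (simp add: is_lattice_on_def)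
  then obtain z where "z \<in> A" and z: "le z x \<and> le z y \<and> (\<forall>w\<in>A. le w x \<and> le w y \<longrightarrow> le w z)"
    by (elim bexE)
  then show thesis using that[of z] by simp
qed

section \<open>Duality\<close>

text \<open>This is the passage to the dual crystal: it exchanges raising and lowering operators and
  keeps the index \<open>i\<close>.\<close>

definition dual :: "nat \<Rightarrow> nat set list \<Rightarrow> nat set list" where
  "dual n X = rev (map (\<lambda>C. {1..Suc n} - C) X)"

definition dual_heights :: "nat \<Rightarrow> nat list \<Rightarrow> nat list" where
  "dual_heights n mu = rev (map (\<lambda>h. Suc n - h) mu)"

lemma dual_dual: "X \<in> columns mu n \<Longrightarrow> dual n (dual n X) = X"
  using columns_subset by (fastforce simp: dual_def rev_map o_def intro!: map_idI)

lemma dual_heights_dual_heights: "\<forall>h\<in>set mu. h \<le> Suc n \<Longrightarrow> dual_heights n (dual_heights n mu) = mu"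
  by (auto simp: dual_heights_def rev_map o_def intro!: map_idI)

lemma sig_complement:
  "i \<in> {1..n} \<Longrightarrow> sig i ({1..Suc n} - C) = - sig i C"
  by (auto simp: sig_def)

text \<open>The lists \<open>A\<close> and \<open>B\<close> around the raised column are untouched
  by the step. Complementation negates their sums and reversal turns suffixes into prefixes, so they
  exchange roles; and raising \<open>i\<close> in the complement of \<open>raise i C\<close> returns
  the complement of \<open>C\<close>.\<close>

lemma colstep_dual:
  assumes "colstep i X Y" "i \<in> {1..n}"
  shows "colstep i (dual n Y) (dual n X)"
proof -
  obtain A C B where 1: "X = A @ C # B" "Y = A @ raise i C # B" "i \<in> C" "Suc i \<notin> C"
    "suffixes_nonneg (sig i) A" "prefixes_nonpos (sig i) B"
    using assms(1) by (auto simp: colstep_def)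
  have m: "wsum (\<lambda>C. sig i ({1..Suc n} - C)) Z = - wsum (sig i) Z" for Z
    using assms(2) by (induction Z) (auto simp: sig_complement simp del: atLeastAtMost_iff One_nat_def)
  have neg: "wsum (\<lambda>x. - sig i x) Z = - wsum (sig i) Z" for Z
    by (induction Z) auto
  have B: "suffixes_nonneg (sig i) (dual n B)"
  proof -
    have "suffixes_nonneg (\<lambda>C. - sig i C) (rev B)"
      using 1(6) prefixes_nonpos_rev[of "sig i" "rev B"] by simp
    then show ?thesis
      unfolding suffixes_nonneg_def dual_def rev_map
      by (auto simp: map_eq_append_conv o_def m neg simp del: One_nat_def)
  qed
  have A: "prefixes_nonpos (sig i) (dual n A)"
  proof -
    have "prefixes_nonpos (\<lambda>C. - sig i C) (rev A)"
      using 1(5) by (simp add: prefixes_nonpos_rev)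
    then show ?thesis
      unfolding prefixes_nonpos_def dual_def rev_map
      by (auto simp: map_eq_append_conv o_def m neg simp del: One_nat_def)
  qed
  have C: "raise i ({1..Suc n} - raise i C) = {1..Suc n} - C"
    using 1(3,4) assms(2) by (auto simp: raise_def)
  have "i \<in> {1..Suc n} - raise i C" "Suc i \<notin> {1..Suc n} - raise i C"
    using assms(2) by (auto simp: raise_def)
  from colstepI[OF this B A] show ?thesis
    by (simp add: 1 dual_def C del: One_nat_def)
qed

lemma card_complement_atMost:
  assumes "C \<subseteq> {1..Suc n}"
  shows "card (({1..Suc n} - C) \<inter> {..t}) = card ({1..Suc n} \<inter> {..t}) - card (C \<inter> {..t})"
proof -
  have "({1..Suc n} - C) \<inter> {..t} = {1..Suc n} \<inter> {..t} - C \<inter> {..t}" by auto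
  moreover have "finite (C \<inter> {..t})" by simp
  moreover have "C \<inter> {..t} \<subseteq> {1..Suc n} \<inter> {..t}" using assms by auto
  ultimately show ?thesis by (simp only: card_Diff_subset)
qed

lemma dual_columns:
  assumes "X \<in> columns mu n"
  shows "dual n X \<in> columns (dual_heights n mu) n"
proof -
  have "list_all2 (\<lambda>C h. C \<subseteq> {1..Suc n} \<and> card C = h) X mu" using assms by (simp add: columns_def)
  then have "list_all2 (\<lambda>C h. C \<subseteq> {1..Suc n} \<and> card C = h) (map (\<lambda>C. {1..Suc n} - C) X) (map (\<lambda>h. Suc n - h) mu)"
    unfolding list_all2_map1 list_all2_map2
    by (rule list_all2_mono) (auto simp: card_Diff_subset finite_subset[of _ "{1..Suc n}"])
  moreover have "sorted_wrt dominates (dual n X)"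
  proof -
    have "sorted_wrt dominates X" using assms by (simp add: columns_def)
    then show ?thesis
      unfolding dual_def sorted_wrt_rev sorted_wrt_map
    proof (rule sorted_wrt_mono_rel[rotated])
      fix C D assume "C \<in> set X" "D \<in> set X" "dominates C D"
      then show "dominates ({1..Suc n} - D) ({1..Suc n} - C)"
        using columns_subset[OF assms] by (simp add: dominates_def card_complement_atMost diff_le_mono2 del: One_nat_def)
    qed
  qed
  ultimately show ?thesis by (simp add: columns_def dual_def dual_heights_def)
qed

lemma column_le_dual:
  assumes "column_le n X Y"
  shows "column_le n (dual n Y) (dual n X)"
  using assms unfolding column_le_def
proof (induction rule: rtranclp_induct)
  case (step Y Z)
  then obtain i where "i \<in> {1..n}" "colstep i (dual n Z) (dual n Y)" using colstep_dual by blast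
  then show ?case using step.IH by (blast intro: converse_rtranclp_into_rtranclp)
qed simp

lemma column_lattice_dual:
  assumes "\<forall>h\<in>set mu. h \<le> Suc n" "column_lattice (dual_heights n mu) n"
  shows "column_lattice mu n"
  unfolding column_lattice_def is_lattice_on_def
proof (intro ballI conjI)
  fix X Y assume X: "X \<in> columns mu n" and Y: "Y \<in> columns mu n"
  let ?D = "columns (dual_heights n mu) n"
  have dX: "dual n X \<in> ?D" "dual n Y \<in> ?D" using X Y by (simp_all add: dual_columns)
  have dual_in: "dual n Z \<in> columns mu n" if "Z \<in> ?D" for Z
    using dual_columns[OF that] assms(1) by (simp add: dual_heights_dual_heights)
  have flip1: "column_le n (dual n Z) U" if "column_le n (dual n U) Z" "U \<in> columns mu n" for Z U
    using column_le_dual[OF that(1)] dual_dual[OF that(2)] by simp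
  have flip2: "column_le n U (dual n Z)" if "column_le n Z (dual n U)" "U \<in> columns mu n" for Z U
    using column_le_dual[OF that(1)] dual_dual[OF that(2)] by simp
  obtain Z where Z: "Z \<in> ?D" "column_le n Z (dual n X)" "column_le n Z (dual n Y)"
    "\<And>W. W \<in> ?D \<Longrightarrow> column_le n W (dual n X) \<Longrightarrow> column_le n W (dual n Y) \<Longrightarrow> column_le n W Z"
    using is_lattice_on_meet[OF assms(2)[unfolded column_lattice_def] dX] by auto
  show "\<exists>z\<in>columns mu n. column_le n X z \<and> column_le n Y z \<and>
      (\<forall>w\<in>columns mu n. column_le n X w \<and> column_le n Y w \<longrightarrow> column_le n z w)"
  proof (intro bexI[of _ "dual n Z"] conjI ballI impI)
    fix W assume W: "W \<in> columns mu n" "column_le n X W \<and> column_le n Y W"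
    then have "column_le n (dual n W) Z" using Z(4) dual_columns column_le_dual by simp
    then show "column_le n (dual n Z) W" using flip1 W(1) by blast
  qed (use Z dual_in flip2 X Y in auto)
  obtain Z where Z: "Z \<in> ?D" "column_le n (dual n X) Z" "column_le n (dual n Y) Z"
    "\<And>W. W \<in> ?D \<Longrightarrow> column_le n (dual n X) W \<Longrightarrow> column_le n (dual n Y) W \<Longrightarrow> column_le n Z W"
    using is_lattice_on_join[OF assms(2)[unfolded column_lattice_def] dX] by auto
  show "\<exists>z\<in>columns mu n. column_le n z X \<and> column_le n z Y \<and>
      (\<forall>w\<in>columns mu n. column_le n w X \<and> column_le n w Y \<longrightarrow> column_le n w z)"
  proof (intro bexI[of _ "dual n Z"] conjI ballI impI)
    fix W assume W: "W \<in> columns mu n" "column_le n W X \<and> column_le n W Y"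
    then have "column_le n Z (dual n W)" using Z(4) dual_columns column_le_dual by simp
    then show "column_le n W (dual n Z)" using flip2 W(1) by blast
  qed (use Z dual_in flip1 X Y in auto)
qed

section \<open>Highest and lowest elements\<close>

lemma down_closed_eq_interval:
  assumes "finite C" "0 \<notin> C" "\<And>i. 1 \<le> i \<Longrightarrow> Suc i \<in> C \<Longrightarrow> i \<in> C"
  shows "C = {1..card C}"
proof (cases "C = {}")
  case False
  have "{1..m} \<subseteq> C" if "m \<in> C" for m
    using that
  proof (induction m)
    case (Suc m)
    show ?case
    proof (cases "m = 0")
      case False
      then have "m \<in> C" using assms(3)[of m] Suc.prems by simp
      then show ?thesis using Suc by (simp add: atLeastAtMostSuc_conv)
    qed (use Suc.prems in simp)
  qed simp
  then have "{1..Max C} \<subseteq> C" using assms(1) False by simp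
  moreover have "C \<subseteq> {1..Max C}"
  proof
    fix x assume "x \<in> C"
    moreover from this have "x \<noteq> 0" using assms(2) by metis
    ultimately show "x \<in> {1..Max C}" using assms(1) by simp
  qed
  ultimately have e: "C = {1..Max C}" by blast
  have "card C = Max C" by (subst e) simp
  then show ?thesis using e by simp
qed simp

text \<open>Uniqueness of the highest weight element. By induction the columns to the right are
  already intervals. If the current column contained \<open>i + 1\<close> without \<open>i\<close>,
  some later column would have signature 1 and hence be \<open>{1..i}\<close>; dominance would then
  put all of \<open>{1..i}\<close> into the current column.\<close>

lemma highest_if_suffixes_nonneg:
  assumes "X \<in> columns mu n" "\<And>i. i \<in> {1..n} \<Longrightarrow> suffixes_nonneg (sig i) X"
  shows "X = highest mu"
  using assms
proof (induction X arbitrary: mu)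
  case Nil
  then show ?case by (auto simp: columns_def highest_def)
next
  case (Cons C X)
  then obtain h nu where mu: "mu = h # nu" by (auto simp: columns_def list_all2_Cons1)
  have X: "X \<in> columns nu n" and C: "C \<subseteq> {1..Suc n}" "card C = h" "\<And>D. D \<in> set X \<Longrightarrow> dominates C D"
    using Cons.prems(1) by (auto simp: columns_def mu)
  have eq: "X = highest nu"
    using X Cons.prems(2) by (intro Cons.IH) (auto simp: suffixes_nonneg_Cons)
  have "C = {1..card C}"
  proof (rule down_closed_eq_interval)
    show "finite C" using C(1) by (rule finite_subset) simp
    show "0 \<notin> C" using C(1) by auto
    fix i assume i: "1 \<le> i" "Suc i \<in> C"
    show "i \<in> C"
    proof (rule ccontr)
      assume n: "i \<notin> C"
      have "i \<in> {1..n}" using i C(1) by auto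
      then have "0 \<le> sig i C + wsum (sig i) X" using Cons.prems(2) by (simp add: suffixes_nonneg_Cons)
      then have "0 < wsum (sig i) X" using i n by (simp add: sig_def)
      then have "\<not> (\<forall>D\<in>set X. sig i D \<le> 0)"
        using sum_list_nonpos[of "map (sig i) X"] by auto
      then obtain D where D: "D \<in> set X" "0 < sig i D" by (auto simp: not_le)
      obtain k where "D = {1..k}" using D(1) eq by (auto simp: highest_def)
      then have "D = {1..i}" using D(2) i(1) by (auto simp: sig_def split: if_splits)
      then have "i \<le> card (C \<inter> {..i})"
        using C(3)[OF D(1)] by (auto simp: dominates_def Int_absorb2 dest!: spec[of _ i])
      then show False using card_atMost_eq_iff[of C i] \<open>0 \<notin> C\<close> n i(1) by auto
    qed
  qed
  then show ?case using C(2) eq by (simp add: mu highest_def)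
qed

text \<open>Raising operators are not defined separately: a predecessor is found by applying
  \<open>colstep\<close> to the dual list and dualizing the result.\<close>

lemma column_raise_exists:
  assumes "X \<in> columns mu n" "X \<noteq> highest mu" "\<forall>h\<in>set mu. h \<le> Suc n"
  shows "\<exists>i\<in>{1..n}. \<exists>Y\<in>columns mu n. colstep i Y X"
proof -
  obtain i where i: "i \<in> {1..n}" "\<not> suffixes_nonneg (sig i) X"
    using highest_if_suffixes_nonneg assms(1,2) by blast
  have "\<not> prefixes_nonpos (sig i) (dual n X)"
  proof
    assume "prefixes_nonpos (sig i) (dual n X)"
    then have "suffixes_nonneg (\<lambda>C. - sig i C) (map (\<lambda>C. {1..Suc n} - C) X)"
      by (simp add: dual_def prefixes_nonpos_rev)
    then have "suffixes_nonneg (sig i) X"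
      unfolding suffixes_nonneg_def
    proof (intro allI impI)
      fix A1 A2 assume X: "X = A1 @ A2" and
        *: "\<forall>B1 B2. map (\<lambda>C. {1..Suc n} - C) X = B1 @ B2 \<longrightarrow> 0 \<le> wsum (\<lambda>C. - sig i C) B2"
      have "map (\<lambda>C. {1..Suc n} - C) X = map (\<lambda>C. {1..Suc n} - C) A1 @ map (\<lambda>C. {1..Suc n} - C) A2"
        by (simp add: X)
      then have "0 \<le> wsum (\<lambda>C. - sig i C) (map (\<lambda>C. {1..Suc n} - C) A2)" using * by blast
      also have "\<dots> = wsum (sig i) A2"
        using i(1) by (induction A2) (simp_all add: sig_complement del: One_nat_def)
      finally show "0 \<le> wsum (sig i) A2" .
    qed
    with i show False by simp
  qed
  then obtain Z where Z: "colstep i (dual n X) Z" using colstep_exists by blast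
  then have "Z \<in> columns (dual_heights n mu) n"
    using colstep_columns[OF _ dual_columns[OF assms(1)]] i by blast
  then have "dual n Z \<in> columns mu n"
    using dual_columns[of Z "dual_heights n mu" n] assms(3) by (simp add: dual_heights_dual_heights)
  moreover have "colstep i (dual n Z) X" using colstep_dual[OF Z i(1)] assms(1) by (simp add: dual_dual)
  ultimately show ?thesis using i by blast
qed

lemma highest_le:
  assumes "X \<in> columns mu n" "\<forall>h\<in>set mu. h \<le> Suc n"
  shows "column_le n (highest mu) X"
  using assms(1)
proof (induction "rank X" arbitrary: X rule: less_induct)
  case less
  show ?case
  proof (cases "X = highest mu")
    case False
    obtain i Y where Y: "i \<in> {1..n}" "Y \<in> columns mu n" "colstep i Y X"
      using column_raise_exists[OF less.prems False assms(2)] by blast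
    then have "column_le n (highest mu) Y" using colstep_rank by (intro less.hyps) auto
    then show ?thesis using Y column_le_trans colstep_le by blast
  qed simp
qed

lemma dominates_intervals: "k \<le> h \<Longrightarrow> dominates {1..h} {1..k}"
  by (auto simp: dominates_def intro!: card_mono)

lemma highest_columns:
  assumes "sorted_wrt (\<ge>) mu" "\<forall>h\<in>set mu. h \<le> Suc n"
  shows "highest mu \<in> columns mu n"
proof -
  have "sorted_wrt (\<lambda>h k. dominates {1..h} {1..k}) mu"
    using assms(1) by (rule sorted_wrt_mono_rel[rotated]) (rule dominates_intervals)
  moreover have "list_all2 (\<lambda>C h. C \<subseteq> {1..Suc n} \<and> card C = h) (map (\<lambda>h. {1..h}) mu) mu"
    using assms(2) by (auto simp: list_all2_map1 intro!: list_all2_refl simp: list_all2_same)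
  ultimately show ?thesis by (simp add: columns_def highest_def sorted_wrt_map)
qed

definition lowest :: "nat list \<Rightarrow> nat \<Rightarrow> nat set list" where
  "lowest mu n = map (\<lambda>h. {Suc (Suc n) - h..Suc n}) mu"

lemma dual_highest: "\<forall>h\<in>set mu. h \<le> Suc n \<Longrightarrow> dual n (highest (dual_heights n mu)) = lowest mu n"
proof -
  have "{1..Suc n} - {1..Suc n - h} = {Suc (Suc n) - h..Suc n}" if "h \<le> Suc n" for h
    using that by auto
  moreover assume "\<forall>h\<in>set mu. h \<le> Suc n"
  ultimately show ?thesis
    by (simp add: dual_def highest_def dual_heights_def lowest_def rev_map del: One_nat_def)
qed

lemma dual_heights_props:
  assumes "sorted_wrt (\<ge>) mu" "\<forall>h\<in>set mu. h \<le> Suc n"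
  shows "sorted_wrt (\<ge>) (dual_heights n mu)" "\<forall>h\<in>set (dual_heights n mu). h \<le> Suc n"
proof -
  have "sorted_wrt (\<lambda>h k. Suc n - h \<le> Suc n - k) mu"
    using assms(1) by (rule sorted_wrt_mono_rel[rotated]) simp
  then show "sorted_wrt (\<ge>) (dual_heights n mu)"
    unfolding dual_heights_def sorted_wrt_rev sorted_wrt_map by simp
qed (auto simp: dual_heights_def)

lemma le_lowest:
  assumes "X \<in> columns mu n" "\<forall>h\<in>set mu. h \<le> Suc n"
  shows "column_le n X (lowest mu n)"
proof -
  have "column_le n (highest (dual_heights n mu)) (dual n X)"
    using dual_columns[OF assms(1)] by (rule highest_le) (auto simp: dual_heights_def)
  from column_le_dual[OF this] show ?thesis using assms by (simp add: dual_highest dual_dual)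
qed

lemma lowest_columns:
  assumes "sorted_wrt (\<ge>) mu" "\<forall>h\<in>set mu. h \<le> Suc n"
  shows "lowest mu n \<in> columns mu n"
  using dual_columns[OF highest_columns[OF dual_heights_props[OF assms]]] assms(2)
  by (simp add: dual_highest dual_heights_dual_heights)

text \<open>The meet of two elements is the join of the finitely many common lower bounds; the
  bottom element is the join of the empty set that starts the induction.\<close>

lemma is_lattice_onI_joins_bottom:
  assumes fin: "finite A" and refl: "\<And>x. x \<in> A \<Longrightarrow> le x x"
    and trans: "\<And>x y z. le x y \<Longrightarrow> le y z \<Longrightarrow> le x z"
    and bot: "b \<in> A" "\<And>x. x \<in> A \<Longrightarrow> le b x"
    and join: "\<And>x y. x \<in> A \<Longrightarrow> y \<in> A \<Longrightarrow> \<exists>z\<in>A. le x z \<and> le y z \<and> (\<forall>w\<in>A. le x w \<and> le y w \<longrightarrow> le z w)"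
  shows "is_lattice_on A le"
proof -
  have Lub: "\<exists>z\<in>A. (\<forall>x\<in>F. le x z) \<and> (\<forall>w\<in>A. (\<forall>x\<in>F. le x w) \<longrightarrow> le z w)" if "finite F" "F \<subseteq> A" for F
    using that
  proof (induction F rule: finite_induct)
    case empty
    then show ?case using bot by blast
  next
    case (insert x F)
    then obtain z where z: "z \<in> A" "\<forall>x\<in>F. le x z" "\<forall>w\<in>A. (\<forall>x\<in>F. le x w) \<longrightarrow> le z w" by auto
    obtain u where u: "u \<in> A" "le x u" "le z u" "\<forall>w\<in>A. le x w \<and> le z w \<longrightarrow> le u w"
      using join[of x z] insert.prems z(1) by auto
    have "\<forall>y\<in>insert x F. le y u" using u z(2) trans by blast
    moreover have "\<forall>w\<in>A. (\<forall>y\<in>insert x F. le y w) \<longrightarrow> le u w" using u(4) z(3) by simp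
    ultimately show ?case using u(1) by blast
  qed
  show ?thesis
    unfolding is_lattice_on_def
  proof (intro ballI conjI)
    fix x y assume xy: "x \<in> A" "y \<in> A"
    show "\<exists>z\<in>A. le x z \<and> le y z \<and> (\<forall>w\<in>A. le x w \<and> le y w \<longrightarrow> le z w)" using join xy by blast
    define F where "F = {w \<in> A. le w x \<and> le w y}"
    have "finite F" "F \<subseteq> A" using fin by (auto simp: F_def)
    from Lub[OF this] obtain z where z: "z \<in> A" "\<forall>w\<in>F. le w z" "\<forall>w\<in>A. (\<forall>x\<in>F. le x w) \<longrightarrow> le z w" by auto
    have "le z x" "le z y" using z(3) xy by (auto simp: F_def)
    then show "\<exists>z\<in>A. le z x \<and> le z y \<and> (\<forall>w\<in>A. le w x \<and> le w y \<longrightarrow> le w z)"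
      using z(1,2) by (intro bexI[of _ z]) (auto simp: F_def)
  qed
qed

lemma column_latticeI_joins:
  assumes "sorted_wrt (\<ge>) mu" "\<forall>h\<in>set mu. h \<le> Suc n"
    and "\<And>X Y. X \<in> columns mu n \<Longrightarrow> Y \<in> columns mu n \<Longrightarrow> \<exists>Z\<in>columns mu n. column_le n X Z \<and> column_le n Y Z \<and>
      (\<forall>W\<in>columns mu n. column_le n X W \<and> column_le n Y W \<longrightarrow> column_le n Z W)"
  shows "column_lattice mu n"
  unfolding column_lattice_def
proof (rule is_lattice_onI_joins_bottom[where b = "highest mu"])
  show "highest mu \<in> columns mu n" using assms by (intro highest_columns)
  show "\<And>X. X \<in> columns mu n \<Longrightarrow> column_le n (highest mu) X" using assms by (intro highest_le)
  show "\<And>x y z. column_le n x y \<Longrightarrow> column_le n y z \<Longrightarrow> column_le n x z" by (rule column_le_trans)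
qed (use assms(3) finite_columns in simp_all)

section \<open>Windows of consecutive columns\<close>

lemma sig_highest_nonneg: "1 \<le> i \<Longrightarrow> C \<in> set (highest p) \<Longrightarrow> 0 \<le> sig i C"
  by (auto simp: highest_def sig_def)

lemma sig_lowest_nonpos: "i \<le> n \<Longrightarrow> C \<in> set (lowest q n) \<Longrightarrow> sig i C \<le> 0"
  by (auto simp: lowest_def sig_def)

text \<open>For \<open>1 \<le> i \<le> n\<close>, highest columns have nonnegative and lowest
  columns nonpositive signature, so a split of the list in the window remains a split after
  padding.\<close>

lemma colstep_window:
  assumes "i \<in> {1..n}" "colstep i X Y"
  shows "colstep i (highest p @ X @ lowest q n) (highest p @ Y @ lowest q n)"
proof -
  obtain A C B where 1: "X = A @ C # B" "Y = A @ raise i C # B" "i \<in> C" "Suc i \<notin> C"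
    "suffixes_nonneg (sig i) A" "prefixes_nonpos (sig i) B"
    using assms(2) by (auto simp: colstep_def)
  have "suffixes_nonneg (sig i) (highest p @ A)"
    using assms(1) sig_highest_nonneg[of i _ p] 1(5)
    by (intro suffixes_nonneg_append suffixes_nonnegI[of "highest p"]) auto
  moreover have "prefixes_nonpos (sig i) (B @ lowest q n)"
    using assms(1) sig_lowest_nonpos[of i n _ q] 1(6)
    by (intro prefixes_nonpos_append prefixes_nonposI[of "lowest q n"]) auto
  ultimately show ?thesis using colstepI[OF 1(3,4), of "highest p @ A" "B @ lowest q n"] by (simp add: 1)
qed

lemma column_le_window:
  "column_le n X Y \<Longrightarrow> column_le n (highest p @ X @ lowest q n) (highest p @ Y @ lowest q n)"
  unfolding column_le_def
proof (induction rule: rtranclp_induct)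
  case (step Y Z)
  then show ?case using colstep_window[of _ n Y Z p q] by (blast intro: rtranclp.rtrancl_into_rtrancl)
qed simp

text \<open>A step of the padded list might act on the padding. Behind the window this is
  impossible, since a lowest column can be raised only at \<open>n + 1\<close>. In front of it, the
  raised column would no longer dominate the highest column that the bound prescribes at this
  place.\<close>

lemma colstep_windowD:
  assumes "i \<in> {1..n}" "colstep i (highest p @ X @ lowest q n) Z"
    "list_all2 dominates Z (highest p @ Y @ lowest q n)" "length Y = length X"
  shows "\<exists>X'. Z = highest p @ X' @ lowest q n \<and> colstep i X X'"
proof -
  obtain A C B where 1: "highest p @ X @ lowest q n = A @ C # B" "Z = A @ raise i C # B" "i \<in> C" "Suc i \<notin> C"
    "suffixes_nonneg (sig i) A" "prefixes_nonpos (sig i) B"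
    using assms(2) by (auto simp: colstep_def)
  have d: "dominates (raise i C) ((highest p @ Y @ lowest q n) ! length A)"
    using assms(3) 1(2) by (auto simp: list_all2_conv_all_nth nth_append dest: spec[of _ "length A"])
  have C: "C = (highest p @ X @ lowest q n) ! length A" by (simp add: 1(1))
  have len: "length A < length (highest p @ X @ lowest q n)" by (simp add: 1(1))
  have "\<not> length A < length p"
  proof
    assume "length A < length p"
    then have "dominates (raise i C) C" using d C by (simp add: nth_append highest_def)
    then show False using not_dominates_raise 1 by blast
  qed
  moreover have "length A < length p + length X"
  proof (rule ccontr)
    assume "\<not> ?thesis"
    then have "C \<in> set (lowest q n)"
      using C len by (auto simp: nth_append highest_def lowest_def)
    then have "i = Suc n" using 1(3,4) assms(1) by (auto simp: lowest_def)
    then show False using assms(1) by simp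
  qed
  ultimately obtain A' B' where AB: "A = highest p @ A'" "B = B' @ lowest q n" "X = A' @ C # B'"
  proof -
    assume a: "\<not> length A < length p" "length A < length p + length X"
      and t: "\<And>A' B'. A = highest p @ A' \<Longrightarrow> B = B' @ lowest q n \<Longrightarrow> X = A' @ C # B' \<Longrightarrow> thesis"
    obtain A' where A': "A = highest p @ A'"
    proof -
      obtain us where "highest p = A @ us \<and> us @ X @ lowest q n = C # B \<or> highest p @ us = A"
        using 1(1) by (auto simp: append_eq_append_conv2)
      moreover from this have "us = []" if "highest p = A @ us"
        using a(1) arg_cong[OF that, of length] by (simp add: highest_def)
      ultimately show ?thesis using that by auto
    qed
    then have X: "X @ lowest q n = A' @ C # B" using 1(1) by simp
    have "length A' < length X" using a(2) A' by (simp add: highest_def)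
    then obtain us where us: "X = A' @ us" "C # B = us @ lowest q n"
      using X by (auto simp: append_eq_append_conv2)
    then obtain B' where "us = C # B'" using \<open>length A' < length X\<close> by (cases us) auto
    then show thesis using t A' us by simp
  qed
  have "suffixes_nonneg (sig i) A'" using 1(5) AB(1) suffixes_nonneg_appendD by blast
  moreover have "prefixes_nonpos (sig i) B'" using 1(6) AB(2) prefixes_nonpos_appendD by blast
  ultimately have "colstep i X (A' @ raise i C # B')" using colstepI[OF 1(3,4)] AB(3) by blast
  then show ?thesis using 1(2) AB by (intro exI[of _ "A' @ raise i C # B'"]) simp
qed

lemma colstep_length: "colstep i X Y \<Longrightarrow> length Y = length X"
  by (auto simp: colstep_def)

text \<open>Convexity of the embedding: every element on a path to an upper bound with the same
  padding still lies below this bound, so \<open>colstep_windowD\<close> applies to each step of the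
  path.\<close>

lemma column_le_window_cases:
  assumes "column_le n (highest p @ X @ lowest q n) Z" "column_le n Z (highest p @ Y @ lowest q n)"
    "length Y = length X"
  shows "\<exists>Z'. Z = highest p @ Z' @ lowest q n \<and> column_le n X Z' \<and> length Z' = length X"
  using assms(1,2) unfolding column_le_def
proof (induction rule: rtranclp_induct)
  case base
  then show ?case by blast
next
  case (step U V)
  obtain i where i: "i \<in> {1..n}" "colstep i U V" using step.hyps by blast
  have "(\<lambda>X Y. \<exists>i\<in>{1..n}. colstep i X Y)\<^sup>*\<^sup>* U (highest p @ Y @ lowest q n)"
    using step.hyps(2) step.prems by (rule converse_rtranclp_into_rtranclp)
  then obtain U' where U: "U = highest p @ U' @ lowest q n" "column_le n X U'" "length U' = length X"
    using step.IH by (auto simp: column_le_def)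
  obtain V' where V: "V = highest p @ V' @ lowest q n" "colstep i U' V'"
    using colstep_windowD[OF i(1), of p U' q V Y] i U assms(3) column_le_dominates[of n V] step.prems
    by (auto simp: column_le_def)
  have "column_le n X V'" using U(2) V(2) i(1) column_le_trans colstep_le by blast
  then show ?case using V U(3) colstep_length by (auto simp: column_le_def)
qed

lemma column_le_window_iff:
  assumes "length X = length Y"
  shows "column_le n (highest p @ X @ lowest q n) (highest p @ Y @ lowest q n) \<longleftrightarrow> column_le n X Y"
  using column_le_window column_le_window_cases[of n p X q "highest p @ Y @ lowest q n" Y] assms by auto

text \<open>Instead of checking dominance across the seams, the padded list is reached from the
  highest element by steps, first in the part \<open>q\<close> and then in the window;
  \<open>columns\<close> is closed under steps.\<close>

lemma window_columns:
  assumes "sorted_wrt (\<ge>) (p @ w @ q)" "\<forall>h\<in>set (p @ w @ q). h \<le> Suc n" "X \<in> columns w n"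
  shows "highest p @ X @ lowest q n \<in> columns (p @ w @ q) n"
proof -
  have w: "sorted_wrt (\<ge>) w" "\<forall>h\<in>set w. h \<le> Suc n" using assms by (auto simp: sorted_wrt_append)
  have 1: "highest p @ highest w @ highest q \<in> columns (p @ w @ q) n"
    using highest_columns[OF assms(1,2)] by (simp add: highest_def)
  have 2: "column_le n (highest q) (lowest q n)"
    using assms by (intro le_lowest highest_columns) (auto simp: sorted_wrt_append)
  have s: "column_le n (U @ V) (U @ W)" if "column_le n V W" "U = highest u" for U V W u
    using column_le_window[OF that(1), of u "[]"] that(2) by (simp add: lowest_def)
  have "column_le n (highest p @ highest w @ highest q) (highest p @ highest w @ lowest q n)"
    using s[OF 2, of "highest (p @ w)" "p @ w"] by (simp add: highest_def)
  moreover have "column_le n (highest p @ highest w @ lowest q n) (highest p @ X @ lowest q n)"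
    using highest_le[OF assms(3) w(2)] by (rule column_le_window)
  ultimately show ?thesis using 1 column_le_trans column_le_columns by blast
qed

lemma column_lattice_window:
  assumes "sorted_wrt (\<ge>) (p @ w @ q)" "\<forall>h\<in>set (p @ w @ q). h \<le> Suc n" "column_lattice (p @ w @ q) n"
  shows "column_lattice w n"
proof (rule column_latticeI_joins)
  show w: "sorted_wrt (\<ge>) w" "\<forall>h\<in>set w. h \<le> Suc n" using assms(1,2) by (auto simp: sorted_wrt_append)
  let ?e = "\<lambda>X. highest p @ X @ lowest q n"
  fix X Y assume X: "X \<in> columns w n" and Y: "Y \<in> columns w n"
  have e: "?e U \<in> columns (p @ w @ q) n" if "U \<in> columns w n" for U
    using window_columns[OF assms(1,2)] that by blast
  obtain Z where Z: "Z \<in> columns (p @ w @ q) n" "column_le n (?e X) Z" "column_le n (?e Y) Z"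
    "\<And>W. W \<in> columns (p @ w @ q) n \<Longrightarrow> column_le n (?e X) W \<Longrightarrow> column_le n (?e Y) W \<Longrightarrow> column_le n Z W"
    using is_lattice_on_join[OF assms(3)[unfolded column_lattice_def] e[OF X] e[OF Y]] by auto
  have low: "lowest w n \<in> columns w n" using w by (rule lowest_columns)
  \<comment> \<open>The image of the lowest element of the window is a common upper bound, so the
    join taken in the large poset lies below it, and convexity brings it back into the
    window.\<close>
  have "column_le n Z (?e (lowest w n))"
    using X Y w low e by (intro Z(4) column_le_window le_lowest) auto
  then obtain Z' where Z': "Z = ?e Z'" "column_le n X Z'"
    using column_le_window_cases[OF Z(2), of "lowest w n"] X low by (auto simp: columns_length)
  have Z'c: "Z' \<in> columns w n" using Z'(2) X column_le_columns by blast
  show "\<exists>Z\<in>columns w n. column_le n X Z \<and> column_le n Y Z \<and>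
      (\<forall>W\<in>columns w n. column_le n X W \<and> column_le n Y W \<longrightarrow> column_le n Z W)"
  proof (intro bexI[of _ Z'] conjI ballI impI)
    show "column_le n Y Z'" using Z(3) Z'(1) Z'c Y by (simp add: column_le_window_iff columns_length)
    fix W assume W: "W \<in> columns w n" "column_le n X W \<and> column_le n Y W"
    then have "column_le n Z (?e W)" using e by (intro Z(4)) (simp_all add: column_le_window)
    then show "column_le n Z' W" using Z'(1) Z'c W(1) by (simp add: column_le_window_iff columns_length)
  qed (use Z' Z'c in simp_all)
qed

section \<open>Tableaux as lists of columns\<close>

definition letter_sig :: "nat \<Rightarrow> nat \<Rightarrow> int" where
  "letter_sig i x = (if x = i then 1 else 0) - (if x = Suc i then 1 else 0)"

definition width :: "nat list \<Rightarrow> nat" where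
  "width lam = (case lam of [] \<Rightarrow> 0 | x # _ \<Rightarrow> x)"

definition height :: "nat list \<Rightarrow> nat \<Rightarrow> nat" where
  "height lam j = length (filter (\<lambda>x. j < x) lam)"

definition conjugate :: "nat list \<Rightarrow> nat list" where
  "conjugate lam = map (height lam) [0..<width lam]"

definition colset :: "nat list \<Rightarrow> tableau \<Rightarrow> nat \<Rightarrow> nat set" where
  "colset lam T j = (\<lambda>i. T i j) ` {..<height lam j}"

definition cols :: "nat list \<Rightarrow> tableau \<Rightarrow> nat set list" where
  "cols lam T = map (colset lam T) [0..<width lam]"

lemma less_height_iff:
  assumes "sorted_wrt (\<ge>) lam"
  shows "i < height lam j \<longleftrightarrow> (i, j) \<in> cells lam"
  using assms unfolding height_def cells_def
proof (induction lam arbitrary: i)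
  case (Cons x xs)
  show ?case
  proof (cases "j < x")
    case True
    then show ?thesis using Cons by (cases i) auto
  next
    case False
    then have "\<forall>y\<in>set (x # xs). \<not> j < y" using Cons.prems by auto
    then have 1: "filter ((<) j) (x # xs) = []" and 2: "\<not> j < (x # xs) ! i" if "i < length (x # xs)" for i
      using nth_mem[of i "x # xs"] that unfolding filter_empty_conv by blast+
    have "filter ((<) j) (x # xs) = []" using 1[of 0] by simp
    then show ?thesis using 2[of i] by auto
  qed
qed simp

lemma cells_width:
  assumes "sorted_wrt (\<ge>) lam" "(i, j) \<in> cells lam"
  shows "j < width lam"
proof (cases lam)
  case (Cons x xs)
  then have "lam ! i \<le> x" using assms by (cases i) (auto simp: cells_def)
  then show ?thesis using assms Cons by (auto simp: cells_def width_def)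
qed (use assms in \<open>simp add: cells_def\<close>)

lemma cells_down:
  assumes "sorted_wrt (\<ge>) lam" "(i, j) \<in> cells lam" "i' \<le> i" "j' \<le> j"
  shows "(i', j') \<in> cells lam"
proof (cases "i' = i")
  case False
  then have "lam ! i \<le> lam ! i'" using assms by (auto simp: cells_def sorted_wrt_iff_nth_less)
  then show ?thesis using assms by (auto simp: cells_def)
qed (use assms in \<open>auto simp: cells_def\<close>)

lemma cells_eq_Sigma:
  assumes "sorted_wrt (\<ge>) lam"
  shows "cells lam = prod.swap ` Sigma {..<width lam} (\<lambda>j. {..<height lam j})"
  using less_height_iff[OF assms] cells_width[OF assms] by (auto simp: image_iff)

lemma finite_cells: "sorted_wrt (\<ge>) lam \<Longrightarrow> finite (cells lam)"
  by (simp add: cells_eq_Sigma)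

text \<open>Column sets determine a tableau already under this weaker condition, without control of
  the rows. It can therefore be applied to a tableau obtained by changing one entry, before that
  tableau is known to be semistandard.\<close>

definition column_strict :: "nat list \<Rightarrow> tableau \<Rightarrow> bool" where
  "column_strict lam T \<longleftrightarrow> (\<forall>i j. (i, j) \<notin> cells lam \<longrightarrow> T i j = 0) \<and>
     (\<forall>i i' j. i < i' \<longrightarrow> (i', j) \<in> cells lam \<longrightarrow> T i j < T i' j)"

lemma SSYT_column_strict:
  assumes "T \<in> SSYT lam n" "sorted_wrt (\<ge>) lam"
  shows "column_strict lam T"
proof -
  have "T i j < T i' j" if "i < i'" "(i', j) \<in> cells lam" for i i' j
    using that
  proof (induction i')
    case (Suc i')
    have "T i' j < T (Suc i') j" using assms(1) Suc.prems(2) by (auto simp: SSYT_def)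
    moreover have "T i j < T i' j" if "i \<noteq> i'"
      using that Suc cells_down[OF assms(2) Suc.prems(2), of i' j] by simp
    ultimately show ?case by (cases "i = i'") auto
  qed simp
  then show ?thesis using assms(1) by (auto simp: column_strict_def SSYT_def)
qed

lemma SSYT_rows:
  assumes "T \<in> SSYT lam n" "sorted_wrt (\<ge>) lam" "(i, j') \<in> cells lam" "j \<le> j'"
  shows "T i j \<le> T i j'"
  using assms(4,3)
proof (induction rule: dec_induct)
  case (step m)
  have "T i m \<le> T i (Suc m)" using assms(1) step.prems by (auto simp: SSYT_def)
  moreover have "(i, m) \<in> cells lam" using cells_down[OF assms(2) step.prems] by simp
  ultimately show ?case using step.IH by simp
qed simp

lemma SSYT_mono:
  assumes "T \<in> SSYT lam n" "sorted_wrt (\<ge>) lam" "(p', q') \<in> cells lam" "p \<le> p'" "q \<le> q'"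
  shows "T p q \<le> T p' q'" "p < p' \<Longrightarrow> T p q < T p' q'"
proof -
  have "(p, q') \<in> cells lam" using cells_down[OF assms(2,3)] assms(4) by simp
  then have 1: "T p q \<le> T p q'" using SSYT_rows[OF assms(1,2)] assms(5) by blast
  show 2: "T p q < T p' q'" if "p < p'"
    using SSYT_column_strict[OF assms(1,2)] that assms(3) 1 by (force simp: column_strict_def)
  show "T p q \<le> T p' q'" using 1 2 assms(4) by (cases "p = p'") auto
qed

lemma column_strict_inj:
  assumes "column_strict lam T" "sorted_wrt (\<ge>) lam"
  shows "inj_on (\<lambda>i. T i j) {..<height lam j}"
proof (rule inj_onI)
  fix i i' assume "i \<in> {..<height lam j}" "i' \<in> {..<height lam j}" "T i j = T i' j"
  then show "i = i'"
    using assms(1) less_height_iff[OF assms(2)]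
    by (metis column_strict_def lessThan_iff linorder_neqE_nat nat_neq_iff)
qed

lemma sorted_list_of_colset:
  assumes "column_strict lam T" "sorted_wrt (\<ge>) lam"
  shows "sorted_list_of_set (colset lam T j) = map (\<lambda>i. T i j) [0..<height lam j]"
proof (rule sorted_distinct_set_unique)
  have "sorted_wrt (<) (map (\<lambda>i. T i j) [0..<height lam j])"
    unfolding sorted_wrt_iff_nth_less
  proof (intro allI impI)
    fix i k assume ik: "i < k" "k < length (map (\<lambda>i. T i j) [0..<height lam j])"
    then have "(k, j) \<in> cells lam" using less_height_iff[OF assms(2)] by simp
    then show "map (\<lambda>i. T i j) [0..<height lam j] ! i < map (\<lambda>i. T i j) [0..<height lam j] ! k"
      using assms(1) ik by (simp add: column_strict_def)
  qed
  then show "sorted (map (\<lambda>i. T i j) [0..<height lam j])" "distinct (map (\<lambda>i. T i j) [0..<height lam j])"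
    by (simp_all add: strict_sorted_iff)
qed (auto simp: colset_def)

lemma cols_inj:
  assumes "column_strict lam T" "column_strict lam T'" "sorted_wrt (\<ge>) lam" "cols lam T = cols lam T'"
  shows "T = T'"
proof (intro ext)
  fix i j
  show "T i j = T' i j"
  proof (cases "(i, j) \<in> cells lam")
    case True
    then have "j < width lam" "i < height lam j" using assms(3) cells_width less_height_iff by blast+
    then have "colset lam T j = colset lam T' j" using assms(4) by (auto simp: cols_def)
    then have "map (\<lambda>i. T i j) [0..<height lam j] = map (\<lambda>i. T' i j) [0..<height lam j]"
      using sorted_list_of_colset assms by metis
    then show ?thesis using \<open>i < height lam j\<close> by simp
  qed (use assms in \<open>auto simp: column_strict_def\<close>)
qed

lemma sig_colset:
  assumes "column_strict lam T" "sorted_wrt (\<ge>) lam"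
  shows "sig i (colset lam T j) = (\<Sum>p<height lam j. letter_sig i (T p j))"
proof -
  have "(\<Sum>p<height lam j. letter_sig i (T p j)) = (\<Sum>x\<in>colset lam T j. letter_sig i x)"
    unfolding colset_def using column_strict_inj[OF assms] by (simp add: sum.reindex)
  also have "\<dots> = sig i (colset lam T j)"
    by (simp add: letter_sig_def sig_def sum_subtractf colset_def sum.delta)
  finally show ?thesis by simp
qed

lemma sum_sig_cols:
  assumes "column_strict lam T" "sorted_wrt (\<ge>) lam" "J \<subseteq> {..<width lam}"
  shows "(\<Sum>j\<in>J. sig i (colset lam T j)) = (\<Sum>(p, q)\<in>{(p, q) \<in> cells lam. q \<in> J}. letter_sig i (T p q))"
proof -
  have "(\<Sum>j\<in>J. sig i (colset lam T j)) = (\<Sum>(q, p)\<in>Sigma J (\<lambda>j. {..<height lam j}). letter_sig i (T p q))"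
    using assms(3) by (simp add: sig_colset[OF assms(1,2)] sum.Sigma finite_subset)
  also have "\<dots> = (\<Sum>(p, q)\<in>prod.swap ` Sigma J (\<lambda>j. {..<height lam j}). letter_sig i (T p q))"
    by (subst sum.reindex) (auto simp: case_prod_beta inj_on_def)
  also have "prod.swap ` Sigma J (\<lambda>j. {..<height lam j}) = {(p, q) \<in> cells lam. q \<in> J}"
    using less_height_iff[OF assms(2)] by (auto simp: image_iff)
  finally show ?thesis .
qed

section \<open>The row reading word and its unmatched brackets\<close>

definition before :: "nat \<times> nat \<Rightarrow> nat \<times> nat \<Rightarrow> bool" where
  "before x y \<longleftrightarrow> fst y < fst x \<or> fst x = fst y \<and> snd x < snd y"

lemma sorted_wrt_concat:
  "sorted_wrt (\<lambda>xs ys. \<forall>x\<in>set xs. \<forall>y\<in>set ys. P x y) xss \<Longrightarrow> \<forall>xs\<in>set xss. sorted_wrt P xs \<Longrightarrow>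
   sorted_wrt P (concat xss)"
  by (induction xss) (auto simp: sorted_wrt_append)

lemma reading_cells_sorted: "sorted_wrt before (reading_cells lam)"
  unfolding reading_cells_def
proof (rule sorted_wrt_concat)
  have "sorted_wrt (\<lambda>a b. b < a) (rev [0..<length lam])" by (simp add: sorted_wrt_rev)
  then show "sorted_wrt (\<lambda>xs ys. \<forall>x\<in>set xs. \<forall>y\<in>set ys. before x y)
     (map (\<lambda>i. map (Pair i) [0..<lam ! i]) (rev [0..<length lam]))"
    unfolding sorted_wrt_map by (rule sorted_wrt_mono_rel[rotated]) (auto simp: before_def)
  show "\<forall>xs\<in>set (map (\<lambda>i. map (Pair i) [0..<lam ! i]) (rev [0..<length lam])). sorted_wrt before xs"
    by (auto simp: sorted_wrt_map before_def)
qed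

lemma set_reading_cells: "set (reading_cells lam) = cells lam"
  by (auto simp: reading_cells_def cells_def)

lemma sorted_before_distinct: "sorted_wrt before L \<Longrightarrow> distinct L"
  by (induction L) (auto simp: before_def)

text \<open>Used to compare the cells of a segment of the reading word with the cells of a range of
  columns: the common cells cancel, so only the signs on the two differences matter.\<close>

lemma sum_le_if_differences:
  fixes f :: "'a \<Rightarrow> int"
  assumes "finite S" "finite S'" "\<And>x. x \<in> S' - S \<Longrightarrow> f x \<le> 0" "\<And>x. x \<in> S - S' \<Longrightarrow> 0 \<le> f x"
  shows "sum f S' \<le> sum f S"
proof -
  have "sum f S' = sum f (S' - S) + sum f (S \<inter> S')"
    by (metis Int_commute add.commute assms(2) sum.Int_Diff)
  moreover have "sum f S = sum f (S - S') + sum f (S \<inter> S')"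
    by (metis add.commute assms(1) sum.Int_Diff)
  moreover have "sum f (S' - S) \<le> 0" "0 \<le> sum f (S - S')"
    using assms(3,4) by (auto intro: sum_nonpos sum_nonneg)
  ultimately show ?thesis by linarith
qed

lemma reading_segment_sum:
  assumes "L1 @ S @ L2 = reading_cells lam"
  shows "wsum f S = sum f (set S)"
proof -
  have "distinct (L1 @ S @ L2)" using assms reading_cells_sorted sorted_before_distinct by metis
  then show ?thesis by (simp add: sum_list_distinct_conv_sum_set)
qed

lemma letter_sig_simps [simp]:
  "letter_sig i i = 1" "letter_sig i (Suc i) = -1" "x \<noteq> i \<Longrightarrow> x \<noteq> Suc i \<Longrightarrow> letter_sig i x = 0"
  by (simp_all add: letter_sig_def)

text \<open>Here \<open>k\<close> opening brackets are pending, so the first unmatched closing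
  bracket is the place where the sum of the letters read exceeds \<open>k\<close>.\<close>

lemma unmatched_close_Nil_iff:
  "unmatched_close i w p k = [] \<longleftrightarrow> (\<forall>w1 w2. w = w1 @ w2 \<longrightarrow> wsum (letter_sig i) w1 \<le> int k)"
proof (induction w arbitrary: p k)
  case (Cons x xs)
  have *: "(\<forall>w1 w2. x # xs = w1 @ w2 \<longrightarrow> wsum (letter_sig i) w1 \<le> int k) \<longleftrightarrow>
      (\<forall>w1 w2. xs = w1 @ w2 \<longrightarrow> letter_sig i x + wsum (letter_sig i) w1 \<le> int k)"
  proof (intro iffI allI impI)
    fix w1 w2 assume H: "\<forall>w1 w2. x # xs = w1 @ w2 \<longrightarrow> wsum (letter_sig i) w1 \<le> int k" and "xs = w1 @ w2"
    then show "letter_sig i x + wsum (letter_sig i) w1 \<le> int k"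
      using H[rule_format, of "x # w1" w2] by simp
  next
    fix w1 w2 assume "\<forall>w1 w2. xs = w1 @ w2 \<longrightarrow> letter_sig i x + wsum (letter_sig i) w1 \<le> int k"
      and "x # xs = w1 @ w2"
    then show "wsum (letter_sig i) w1 \<le> int k" by (auto simp: Cons_eq_append)
  qed
  consider "x = i + 1" | "x = i" "0 < k" | "x = i" "k = 0" | "x \<noteq> i + 1" "x \<noteq> i" by blast
  then show ?case
  proof cases
    case 1
    then show ?thesis unfolding * by (auto simp: Cons.IH algebra_simps)
  next
    case 2
    then obtain m where "k = Suc m" by (cases k) auto
    with 2 show ?thesis unfolding * by (auto simp: Cons.IH algebra_simps)
  next
    case 3
    have "\<not> (\<forall>w1 w2. xs = w1 @ w2 \<longrightarrow> letter_sig i x + wsum (letter_sig i) w1 \<le> int k)"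
    proof
      assume H: "\<forall>w1 w2. xs = w1 @ w2 \<longrightarrow> letter_sig i x + wsum (letter_sig i) w1 \<le> int k"
      show False using H[rule_format, of "[]" xs] 3 by simp
    qed
    then show ?thesis unfolding * using 3 by simp
  next
    case 4
    then show ?thesis unfolding * by (auto simp: Cons.IH)
  qed
qed auto

text \<open>The bound on \<open>k\<close> together with the nonnegative suffixes makes
  \<open>A\<close> use up the \<open>k\<close> pending brackets and all brackets opened in
  \<open>A\<close>, so the marked \<open>i\<close> meets none. The letters of \<open>B\<close> never
  close more than they have opened, so nothing after it stays unmatched.\<close>

lemma last_unmatched_close:
  assumes "suffixes_nonneg (letter_sig i) A" "int k \<le> wsum (letter_sig i) A"
    "prefixes_nonpos (letter_sig i) B"
  shows "unmatched_close i (A @ i # B) p k \<noteq> [] \<and> last (unmatched_close i (A @ i # B) p k) = p + length A"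
  using assms(1,2)
proof (induction A arbitrary: p k)
  case Nil
  then have "unmatched_close i B (Suc p) 0 = []"
    using assms(3) by (simp add: unmatched_close_Nil_iff prefixes_nonpos_def)
  then show ?case using Nil by simp
next
  case (Cons x A)
  have A: "suffixes_nonneg (letter_sig i) A" and w: "0 \<le> wsum (letter_sig i) A"
    "int k \<le> letter_sig i x + wsum (letter_sig i) A"
    using Cons.prems suffixes_nonneg_wsum by (auto simp: suffixes_nonneg_Cons)
  consider "x = i + 1" | "x = i" "0 < k" | "x = i" "k = 0" | "x \<noteq> i + 1" "x \<noteq> i" by blast
  then show ?case
  proof cases
    case 1
    then show ?thesis using Cons.IH[OF A, of "Suc k" "Suc p"] w by simp
  next
    case 2
    then obtain m where "k = Suc m" by (cases k) auto
    then show ?thesis using Cons.IH[OF A, of m "Suc p"] w 2 by simp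
  next
    case 3
    then show ?thesis using Cons.IH[OF A, of 0 "Suc p"] w by simp
  next
    case 4
    then show ?thesis using Cons.IH[OF A, of k "Suc p"] w by simp
  qed
qed

lemma map_upt_append: "a \<le> b \<Longrightarrow> b \<le> c \<Longrightarrow> map g [a..<b] @ map g [b..<c] = map g [a..<c]"
  by (metis le_add_diff_inverse map_append upt_add_eq_append)

lemma wsum_map_upt: "wsum f (map g [a..<b]) = (\<Sum>j=a..<b. f (g j))"
  by (simp add: sum_list_distinct_conv_sum_set)

section \<open>The bijection between tableaux and lists of columns\<close>

lemma cols_columns:
  assumes "T \<in> SSYT lam n" "sorted_wrt (\<ge>) lam"
  shows "cols lam T \<in> columns (conjugate lam) n"
proof -
  note cs = SSYT_column_strict[OF assms]
  have sub: "colset lam T j \<subseteq> {1..Suc n}" for j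
    using assms(1) less_height_iff[OF assms(2)] by (force simp: colset_def SSYT_def)
  have card: "card (colset lam T j) = height lam j" for j
    using card_image[OF column_strict_inj[OF cs assms(2)]] by (simp add: colset_def)
  have dominates: "dominates (colset lam T j) (colset lam T j')" if "j \<le> j'" for j j'
    unfolding dominates_def
  proof
    fix t
    have h: "height lam j' \<le> height lam j"
      using less_height_iff[OF assms(2)] cells_down[OF assms(2) _ order_refl that] by (meson not_le order_refl leI)
    have "colset lam T j' \<inter> {..t} = (\<lambda>i. T i j') ` {i. i < height lam j' \<and> T i j' \<le> t}"
      by (auto simp: colset_def)
    then have "card (colset lam T j' \<inter> {..t}) = card {i. i < height lam j' \<and> T i j' \<le> t}"
      using inj_on_subset[OF column_strict_inj[OF cs assms(2), of j']] by (simp add: card_image subset_iff)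
    also have "\<dots> \<le> card {i. i < height lam j \<and> T i j \<le> t}"
    proof (intro card_mono subsetI)
      fix i assume i: "i \<in> {i. i < height lam j' \<and> T i j' \<le> t}"
      then have "T i j \<le> T i j'"
        using SSYT_rows[OF assms _ that] less_height_iff[OF assms(2)] by simp
      then show "i \<in> {i. i < height lam j \<and> T i j \<le> t}" using i h by simp
    qed simp
    also have "\<dots> = card (colset lam T j \<inter> {..t})"
    proof -
      have "colset lam T j \<inter> {..t} = (\<lambda>i. T i j) ` {i. i < height lam j \<and> T i j \<le> t}"
        by (auto simp: colset_def)
      then show ?thesis
        using inj_on_subset[OF column_strict_inj[OF cs assms(2), of j]] by (simp add: card_image subset_iff)
    qed
    finally show "card (colset lam T j' \<inter> {..t}) \<le> card (colset lam T j \<inter> {..t})" .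
  qed
  have "sorted_wrt dominates (cols lam T)"
    unfolding cols_def sorted_wrt_map
    by (rule sorted_wrt_mono_rel[of _ "(<)"]) (use dominates in \<open>simp_all add: sorted_wrt_upt\<close>)
  then show ?thesis using sub card by (simp add: columns_def cols_def conjugate_def list_all2_conv_all_nth)
qed

text \<open>Otherwise take the threshold \<open>t\<close> equal to entry \<open>i\<close> of
  \<open>D\<close>, counting from 0: then \<open>D\<close> has at least \<open>i + 1\<close>
  elements up to \<open>t\<close>, whereas \<open>C\<close> has at most \<open>i\<close>.\<close>

lemma dominates_nth_le:
  assumes "finite C" "finite D" "dominates C D" "i < card C" "i < card D"
  shows "sorted_list_of_set C ! i \<le> sorted_list_of_set D ! i"
proof (rule ccontr)
  let ?c = "\<lambda>k. sorted_list_of_set C ! k" and ?d = "\<lambda>k. sorted_list_of_set D ! k"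
  define t where "t = ?d i"
  assume "\<not> ?c i \<le> ?d i"
  then have t: "t < ?c i" by (simp add: t_def)
  have "?d ` {..i} \<subseteq> D \<inter> {..t}"
  proof
    fix x assume "x \<in> ?d ` {..i}"
    then obtain k where k: "k \<le> i" "x = ?d k" by auto
    then have "x \<in> D" using assms(2,5) nth_mem[of k "sorted_list_of_set D"] by simp
    moreover have "x \<le> t" unfolding k(2) t_def using k(1) assms by (intro sorted_nth_mono) auto
    ultimately show "x \<in> D \<inter> {..t}" by simp
  qed
  moreover have "inj_on ?d {..i}" using assms(5) by (auto intro!: inj_onI simp: nth_eq_iff_index_eq)
  ultimately have "Suc i \<le> card (D \<inter> {..t})"
    using card_mono[of "D \<inter> {..t}" "?d ` {..i}"] by (simp add: card_image)
  moreover have "C \<inter> {..t} \<subseteq> ?c ` {..<i}"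
  proof
    fix x assume x: "x \<in> C \<inter> {..t}"
    then have "x \<in> set (sorted_list_of_set C)" using assms(1) by simp
    then obtain k where k: "k < card C" "x = ?c k" by (auto simp: in_set_conv_nth)
    have "k < i"
    proof (rule ccontr)
      assume "\<not> k < i"
      then have "?c i \<le> ?c k" using k(1) by (intro sorted_nth_mono) auto
      then show False using x k(2) t by simp
    qed
    then show "x \<in> ?c ` {..<i}" using k(2) by auto
  qed
  then have "card (C \<inter> {..t}) \<le> i"
    using card_mono[of "?c ` {..<i}" "C \<inter> {..t}"] card_image_le[of "{..<i}" ?c] by simp
  ultimately show False using assms(3) by (auto simp: dominates_def dest: spec[of _ t])
qed

lemma cols_surj:
  assumes "X \<in> columns (conjugate lam) n" "sorted_wrt (\<ge>) lam"
  shows "\<exists>T\<in>SSYT lam n. cols lam T = X"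
proof -
  define T where "T i j = (if (i, j) \<in> cells lam then sorted_list_of_set (X ! j) ! i else 0)" for i j
  have len: "length X = width lam" using columns_length[OF assms(1)] by (simp add: conjugate_def)
  have X: "X ! j \<subseteq> {1..Suc n}" "card (X ! j) = height lam j" if "j < width lam" for j
    using assms(1) that by (auto simp: columns_def list_all2_conv_all_nth conjugate_def)
  have fin: "finite (X ! j)" if "j < width lam" for j
    using X(1)[OF that] by (rule finite_subset) simp
  have cell: "j < width lam" "i < height lam j" "i < card (X ! j)" if "(i, j) \<in> cells lam" for i j
    using that less_height_iff[OF assms(2)] cells_width[OF assms(2)] X(2) by auto
  have "T \<in> SSYT lam n"
    unfolding SSYT_def mem_Collect_eq
  proof (intro conjI allI impI ballI)
    show "(i, j) \<notin> cells lam \<Longrightarrow> T i j = 0" for i j by (simp add: T_def)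
    fix x assume x: "x \<in> cells lam"
    obtain i j where ij: "x = (i, j)" by fastforce
    have "T i j \<in> X ! j"
      using x ij cell[of i j] fin nth_mem[of i "sorted_list_of_set (X ! j)"] by (simp add: T_def)
    then show "case x of (i, j) \<Rightarrow> 1 \<le> T i j \<and> T i j \<le> n + 1"
      using X(1)[OF cell(1)] x ij by fastforce
  next
    fix i j assume c: "(i, Suc j) \<in> cells lam"
    then have c': "(i, j) \<in> cells lam" using cells_down[OF assms(2)] by force
    have "dominates (X ! j) (X ! Suc j)"
      using assms(1) cell[OF c] len by (simp add: columns_def sorted_wrt_iff_nth_less)
    then show "T i j \<le> T i (Suc j)"
      using c c' cell[OF c] cell[OF c'] fin by (simp add: T_def dominates_nth_le)
  next
    fix i j assume c: "(Suc i, j) \<in> cells lam"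
    then have c': "(i, j) \<in> cells lam" using cells_down[OF assms(2)] by force
    have "sorted_wrt (<) (sorted_list_of_set (X ! j))" by (rule strict_sorted_list_of_set)
    then show "T i j < T (Suc i) j"
      using c c' cell[OF c] by (simp add: T_def sorted_wrt_iff_nth_less)
  qed
  moreover have "cols lam T = X"
  proof (rule nth_equalityI)
    fix j assume "j < length (cols lam T)"
    then have j: "j < width lam" by (simp add: cols_def)
    have "colset lam T j = (\<lambda>i. sorted_list_of_set (X ! j) ! i) ` {..<height lam j}"
      using less_height_iff[OF assms(2)] by (auto simp: colset_def T_def)
    also have "\<dots> = set (sorted_list_of_set (X ! j))"
      using X(2)[OF j] by (auto simp: set_conv_nth)
    also have "\<dots> = X ! j" using fin[OF j] by simp
    finally show "cols lam T ! j = X ! j" using j by (simp add: cols_def)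
  qed (simp add: cols_def len)
  ultimately show ?thesis by blast
qed

text \<open>The cells in a segment of the reading word and the cells in the matching range of columns differ only
  in cells whose signs all push the sum in the favourable direction.\<close>

context
  fixes lam :: "nat list" and n i :: nat and T :: tableau
  assumes part: "sorted_wrt (\<ge>) lam" and T: "T \<in> SSYT lam n"
begin

private abbreviation f where "f \<equiv> \<lambda>(p, q). letter_sig i (T p q)"

text \<open>A critical prefix of the word ends at a cell \<open>(r, c)\<close> with entry
  \<open>i\<close> and is compared with the columns up to \<open>c\<close>. Cells of later columns
  that are already read lie strictly below row \<open>r\<close> and exceed \<open>i\<close>; cells
  of these columns not yet read lie strictly above row \<open>r\<close> and are smaller than
  \<open>i\<close>. So the prefix sum is at most the column sum, which is at most 0.\<close>

lemma lower_eq_None: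
  assumes "prefixes_nonpos (sig i) (cols lam T)"
  shows "lower lam i T = None"
proof -
  have "prefixes_nonpos f (reading_cells lam)"
  proof (rule prefixes_nonpos_if_pos_lasts)
    fix A1 x A2 assume L: "reading_cells lam = A1 @ x # A2" and pos: "0 < f x"
    obtain r c where x: "x = (r, c)" by fastforce
    have Trc: "T r c = i" using pos x by (auto simp: letter_sig_def split: if_splits)
    have xc: "(r, c) \<in> cells lam" using L set_reading_cells[of lam] x by auto
    have sd: "sorted_wrt before (A1 @ x # A2)" using reading_cells_sorted[of lam] L by simp
    let ?J = "{..c}"
    have J: "?J \<subseteq> {..<width lam}" using cells_width[OF part xc] by auto
    have "prefixes_nonpos (sig i) (map (colset lam T) [0..<Suc c] @ map (colset lam T) [Suc c..<width lam])"
      using assms cells_width[OF part xc]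
      by (simp add: cols_def map_upt_append del: upt_Suc)
    then have "wsum (sig i) (map (colset lam T) [0..<Suc c]) \<le> 0"
      using prefixes_nonpos_appendD prefixes_nonpos_wsum by blast
    then have "(\<Sum>j\<in>?J. sig i (colset lam T j)) \<le> 0"
      by (simp add: sum_list_distinct_conv_sum_set atLeast0LessThan lessThan_Suc_atMost del: upt_Suc)
    then have le0: "sum f {(p, q) \<in> cells lam. q \<in> ?J} \<le> 0"
      using sum_sig_cols[OF SSYT_column_strict[OF T part] part J] by simp
    have "wsum f (A1 @ [x]) = sum f (set (A1 @ [x]))"
      using reading_segment_sum[of "[]" "A1 @ [x]" A2 lam f] L by simp
    also have "\<dots> \<le> sum f {(p, q) \<in> cells lam. q \<in> ?J}"
    proof (rule sum_le_if_differences)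
      show "finite {(p, q) \<in> cells lam. q \<in> ?J}"
        using finite_cells[OF part] by (rule finite_subset[rotated]) auto
      fix y assume y: "y \<in> set (A1 @ [x]) - {(p, q) \<in> cells lam. q \<in> ?J}"
      obtain p q where pq: "y = (p, q)" by fastforce
      have "y \<in> cells lam" using y L set_reading_cells[of lam] by auto
      then have "c < q" using y pq by auto
      moreover have "before y x" using y sd x pq \<open>c < q\<close> by (auto simp: sorted_wrt_append)
      ultimately have "r < p" using x pq by (auto simp: before_def)
      then have "i < T p q" using SSYT_mono(2)[OF T part, of p q r c] \<open>y \<in> cells lam\<close> pq \<open>c < q\<close> Trc by auto
      then show "f y \<le> 0" by (simp add: pq letter_sig_def)
    next
      fix y assume y: "y \<in> {(p, q) \<in> cells lam. q \<in> ?J} - set (A1 @ [x])"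
      obtain p q where pq: "y = (p, q)" by fastforce
      have "y \<in> set A2" using y L set_reading_cells[of lam] by auto
      then have "before x y" using sd by (auto simp: sorted_wrt_append)
      then have "p < r" using y pq x by (auto simp: before_def)
      then have "T p q < i" using SSYT_mono(2)[OF T part xc, of p q] y pq Trc by auto
      then show "0 \<le> f y" by (simp add: pq letter_sig_def)
    qed simp
    finally show "wsum f (A1 @ [x]) \<le> 0" using le0 by simp
  qed
  moreover have "wsum (letter_sig i) (map (\<lambda>(p, q). T p q) Z) = wsum f Z" for Z
    by (simp add: o_def case_prod_beta')
  ultimately have "unmatched_close i (reading_word lam T) 0 0 = []"
    unfolding unmatched_close_Nil_iff reading_word_def prefixes_nonpos_def
    by (auto simp: map_eq_append_conv)
  then show ?thesis by (simp add: lower_def)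
qed

lemma lower_eq_Some:
  assumes "colstep i (cols lam T) Y" "i \<in> {1..n}"
  shows "\<exists>T'\<in>SSYT lam n. lower lam i T = Some T' \<and> cols lam T' = Y"
proof -
  note cs = SSYT_column_strict[OF T part]
  obtain A C B where 1: "cols lam T = A @ C # B" "Y = A @ raise i C # B" "i \<in> C" "Suc i \<notin> C"
    "suffixes_nonneg (sig i) A" "prefixes_nonpos (sig i) B"
    using assms(1) by (auto simp: colstep_def)
  define c where "c = length A"
  have cw: "c < width lam" using arg_cong[OF 1(1), of length] by (simp add: c_def cols_def)
  have "A @ C # B = map (colset lam T) [0..<c] @ colset lam T c # map (colset lam T) [Suc c..<width lam]"
    using cw map_upt_append[of 0 c "width lam" "colset lam T"] 1(1) by (simp add: cols_def upt_conv_Cons)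
  then have ACB: "A = map (colset lam T) [0..<c]" "C = colset lam T c" "B = map (colset lam T) [Suc c..<width lam]"
    using cw by (simp_all add: append_eq_append_conv c_def)
  obtain r where r: "(r, c) \<in> cells lam" "T r c = i"
    using 1(3) ACB(2) less_height_iff[OF part] by (auto simp: colset_def)
  have noS: "T p c \<noteq> Suc i" if "(p, c) \<in> cells lam" for p
  proof -
    have "T p c \<in> colset lam T c" using that less_height_iff[OF part] by (simp add: colset_def)
    then show ?thesis using 1(4) ACB(2) by auto
  qed
  \<comment> \<open>Column \<open>c\<close> contains \<open>i\<close> but not \<open>i + 1\<close>,
    so the entry just below \<open>i\<close> skips \<open>i + 1\<close>, and so does every entry
    below row \<open>r\<close> and weakly to the right.\<close>
  have gtS: "Suc i < T p q" if "(p, q) \<in> cells lam" "r < p" "c \<le> q" for p q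
  proof -
    have cell: "(Suc r, c) \<in> cells lam" using cells_down[OF part that(1)] that by simp
    have "i < T (Suc r) c" using SSYT_mono(2)[OF T part cell, of r c] r(2) by simp
    then have "Suc i < T (Suc r) c" using noS[OF cell] by simp
    also have "\<dots> \<le> T p q" using SSYT_mono(1)[OF T part that(1), of "Suc r" c] that by simp
    finally show ?thesis .
  qed
  have colA: "0 \<le> (\<Sum>j=l..<c. sig i (colset lam T j))" for l
  proof (cases "l \<le> c")
    case True
    have "suffixes_nonneg (sig i) (map (colset lam T) [l..<c])"
      using 1(5) map_upt_append[of 0 l c "colset lam T"] True suffixes_nonneg_appendD by (metis ACB(1) le0)
    then show ?thesis using suffixes_nonneg_wsum wsum_map_upt by metis
  qed simp
  have colB: "(\<Sum>j=Suc c..<l. sig i (colset lam T j)) \<le> 0" if "l \<le> width lam" for l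
  proof (cases "Suc c \<le> l")
    case True
    have "prefixes_nonpos (sig i) (map (colset lam T) [Suc c..<l])"
      using 1(6) map_upt_append[of "Suc c" l "width lam" "colset lam T"] True that prefixes_nonpos_appendD by (metis ACB(3))
    then show ?thesis using prefixes_nonpos_wsum wsum_map_upt by metis
  qed simp
  have "(r, c) \<in> set (reading_cells lam)" using r set_reading_cells by simp
  then obtain L1 L2 where L: "reading_cells lam = L1 @ (r, c) # L2" by (meson split_list)
  have sd: "sorted_wrt before (L1 @ (r, c) # L2)" using reading_cells_sorted[of lam] L by simp
  have setL: "cells lam = insert (r, c) (set L1 \<union> set L2)" using set_reading_cells[of lam] L by simp
  have fin: "finite {(p, q) \<in> cells lam. q \<in> J}" for J
    using finite_cells[OF part] by (rule finite_subset[rotated]) auto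
  \<comment> \<open>A critical suffix of \<open>L1\<close> starts at an \<open>i + 1\<close> in a
    cell \<open>(r', c')\<close>. It is compared with the columns from \<open>c'\<close> to
    \<open>c - 1\<close>, whose sum is nonnegative by \<open>colA\<close>; for
    \<open>c \<le> c'\<close> this range is empty.\<close>
  have SL1: "suffixes_nonneg f L1"
  proof (rule suffixes_nonneg_if_neg_heads)
    fix A1 x A2 assume L1: "L1 = A1 @ x # A2" and neg: "f x < 0"
    obtain r' c' where x: "x = (r', c')" by fastforce
    have Tx: "T r' c' = Suc i" using neg x by (auto simp: letter_sig_def split: if_splits)
    have xc: "(r', c') \<in> cells lam" using setL L1 x by auto
    let ?J = "{c'..<c}"
    have "0 \<le> sum f {(p, q) \<in> cells lam. q \<in> ?J}"
      using colA[of c'] sum_sig_cols[OF cs part, of ?J i] cw by (simp add: subset_eq)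
    also have "\<dots> \<le> sum f (set (x # A2))"
    proof (rule sum_le_if_differences)
      fix y assume y: "y \<in> {(p, q) \<in> cells lam. q \<in> ?J} - set (x # A2)"
      obtain p q where pq: "y = (p, q)" by fastforce
      consider "y \<in> set A1" | "y \<in> set L2" using y pq setL L1 by auto
      then show "f y \<le> 0"
      proof cases
        case 1
        then have "before y x" using sd L1 by (auto simp: sorted_wrt_append)
        then have "r' < p" using y pq x by (auto simp: before_def)
        then have "Suc i < T p q" using SSYT_mono(2)[OF T part, of p q r' c'] y pq Tx by auto
        then show ?thesis by (simp add: pq)
      next
        case 2
        then have "before (r, c) y" using sd by (auto simp: sorted_wrt_append)
        then have "p < r" using y pq by (auto simp: before_def)
        then have "T p q < i" using SSYT_mono(2)[OF T part r(1), of p q] y pq r(2) by auto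
        then show ?thesis by (simp add: pq)
      qed
    next
      fix y assume y: "y \<in> set (x # A2) - {(p, q) \<in> cells lam. q \<in> ?J}"
      obtain p q where pq: "y = (p, q)" by fastforce
      have yc: "(p, q) \<in> cells lam" using y pq setL L1 by auto
      have bef: "y = x \<or> before x y" "before y (r, c)" using y sd L1 by (auto simp: sorted_wrt_append)
      show "0 \<le> f y"
      proof (cases "c \<le> q")
        case True
        then have "r < p" using bef(2) pq by (auto simp: before_def)
        then show ?thesis using gtS[OF yc] True by (simp add: pq)
      next
        case False
        then have "q < c'" using y yc pq by auto
        then have "p < r'" using bef(1) pq x by (auto simp: before_def)
        then have "T p q < Suc i" using SSYT_mono(2)[OF T part xc, of p q] \<open>q < c'\<close> Tx by simp
        then show ?thesis by (simp add: pq letter_sig_def)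
      qed
    qed (use fin[of ?J] in simp_all)
    also have "\<dots> = wsum f (x # A2)"
      using reading_segment_sum[of A1 "x # A2" "(r, c) # L2" lam f] L L1 by simp
    finally show "0 \<le> wsum f (x # A2)" .
  qed
  \<comment> \<open>A critical prefix of \<open>L2\<close> ends at an \<open>i\<close> in a cell
    \<open>(r', c')\<close> and is compared with the columns from \<open>c + 1\<close> to
    \<open>c'\<close>, whose sum is nonpositive by \<open>colB\<close>.\<close>
  have PL2: "prefixes_nonpos f L2"
  proof (rule prefixes_nonpos_if_pos_lasts)
    fix A1 x A2 assume L2: "L2 = A1 @ x # A2" and pos: "0 < f x"
    obtain r' c' where x: "x = (r', c')" by fastforce
    have Tx: "T r' c' = i" using pos x by (auto simp: letter_sig_def split: if_splits)
    have xc: "(r', c') \<in> cells lam" using setL L2 x by auto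
    let ?J = "{Suc c..<Suc c'}"
    have "wsum f (A1 @ [x]) = sum f (set (A1 @ [x]))"
      using reading_segment_sum[of "L1 @ [(r, c)]" "A1 @ [x]" A2 lam f] L L2 by simp
    also have "\<dots> \<le> sum f {(p, q) \<in> cells lam. q \<in> ?J}"
    proof (rule sum_le_if_differences)
      fix y assume y: "y \<in> set (A1 @ [x]) - {(p, q) \<in> cells lam. q \<in> ?J}"
      obtain p q where pq: "y = (p, q)" by fastforce
      have yc: "(p, q) \<in> cells lam" using y pq setL L2 by auto
      have bef: "y = x \<or> before y x" "before (r, c) y" using y sd L2 by (auto simp: sorted_wrt_append)
      show "f y \<le> 0"
      proof (cases "q \<le> c")
        case True
        then have "p < r" using bef(2) pq by (auto simp: before_def)
        then have "T p q < i" using SSYT_mono(2)[OF T part r(1), of p q] True r(2) by simp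
        then show ?thesis by (simp add: pq)
      next
        case False
        then have "c' < q" using y yc pq by auto
        then have "r' < p" using bef(1) pq x by (auto simp: before_def)
        then have "i < T p q" using SSYT_mono(2)[OF T part yc, of r' c'] \<open>c' < q\<close> Tx by simp
        then show ?thesis by (simp add: pq letter_sig_def)
      qed
    next
      fix y assume y: "y \<in> {(p, q) \<in> cells lam. q \<in> ?J} - set (A1 @ [x])"
      obtain p q where pq: "y = (p, q)" by fastforce
      consider "y \<in> set L1" | "y \<in> set A2" using y pq setL L2 by auto
      then show "0 \<le> f y"
      proof cases
        case 1
        then have "before y (r, c)" using sd by (auto simp: sorted_wrt_append)
        then have "r < p" using y pq by (auto simp: before_def)
        then show ?thesis using gtS[of p q] y pq by auto
      next
        case 2
        then have "before x y" using sd L2 by (auto simp: sorted_wrt_append)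
        then have "p < r'" using y pq x by (auto simp: before_def)
        then have "T p q < i" using SSYT_mono(2)[OF T part xc, of p q] y pq Tx by auto
        then show ?thesis by (simp add: pq)
      qed
    qed (use fin[of ?J] in simp_all)
    also have "\<dots> \<le> 0"
      using colB[of "Suc c'"] sum_sig_cols[OF cs part, of ?J i] cells_width[OF part xc]
      by (simp add: subset_eq del: sum.op_ivl_Suc)
    finally show "wsum f (A1 @ [x]) \<le> 0" .
  qed
  define T' where "T' = T(r := (T r)(c := i + 1))"
  have w: "wsum (letter_sig i) (map (\<lambda>(p, q). T p q) Z) = wsum f Z" for Z
    by (simp add: o_def case_prod_beta')
  let ?w = "\<lambda>Z. map (\<lambda>(p, q). T p q) Z"
  have "suffixes_nonneg (letter_sig i) (?w L1)"
    using SL1 by (auto simp: suffixes_nonneg_def map_eq_append_conv w simp del: map_map)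
  moreover have "prefixes_nonpos (letter_sig i) (?w L2)"
    using PL2 by (auto simp: prefixes_nonpos_def map_eq_append_conv w simp del: map_map)
  moreover have "reading_word lam T = ?w L1 @ i # ?w L2" by (simp add: reading_word_def L r(2))
  ultimately have "unmatched_close i (reading_word lam T) 0 0 \<noteq> []"
    "last (unmatched_close i (reading_word lam T) 0 0) = length L1"
    using last_unmatched_close[of i "?w L1" 0 "?w L2" 0] suffixes_nonneg_wsum[of "letter_sig i" "?w L1"]
    by (simp_all del: map_map)
  then have low: "lower lam i T = Some T'" by (simp add: lower_def L T'_def)
  have cs': "column_strict lam T'"
  proof -
    have "T' p q < T' p' q" if "p < p'" "(p', q) \<in> cells lam" for p p' q
    proof -
      have "T p q < T p' q" using cs that by (simp add: column_strict_def)
      moreover have "Suc i < T p' q" if "p = r" "q = c" using gtS that \<open>p < p'\<close> \<open>(p', q) \<in> cells lam\<close> by simp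
      ultimately show ?thesis using r(2) by (auto simp: T'_def)
    qed
    then show ?thesis using cs r(1) by (auto simp: column_strict_def T'_def)
  qed
  have rh: "r < height lam c" using r less_height_iff[OF part] by simp
  have "colset lam T' c = raise i (colset lam T c)"
  proof -
    have "colset lam T c = insert i ((\<lambda>p. T p c) ` ({..<height lam c} - {r}))"
      unfolding colset_def using rh r(2) by auto
    moreover have "colset lam T' c = insert (Suc i) ((\<lambda>p. T p c) ` ({..<height lam c} - {r}))"
    proof -
      have "{..<height lam c} = insert r ({..<height lam c} - {r})" using rh by auto
      then have "colset lam T' c = (\<lambda>p. T' p c) ` insert r ({..<height lam c} - {r})" by (simp add: colset_def)
      also have "\<dots> = insert (T' r c) ((\<lambda>p. T' p c) ` ({..<height lam c} - {r}))" by (rule image_insert)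
      finally show ?thesis by (simp add: T'_def image_def)
    qed
    moreover have "i \<notin> (\<lambda>p. T p c) ` ({..<height lam c} - {r})"
      using column_strict_inj[OF cs part, of c] rh r(2) by (auto simp: inj_on_def)
    ultimately show ?thesis by (auto simp: raise_def)
  qed
  moreover have "colset lam T' j = colset lam T j" if "j \<noteq> c" for j
    using that by (auto simp: colset_def T'_def image_def)
  ultimately have "cols lam T' = map (\<lambda>j. if j = c then raise i (colset lam T c) else colset lam T j) [0..<width lam]"
    by (simp add: cols_def)
  also have "\<dots> = Y"
  proof -
    have "[0..<width lam] = [0..<c] @ c # [Suc c..<width lam]"
      using cw map_upt_append[of 0 c "width lam" id] upt_conv_Cons[OF cw] by simp
    then show ?thesis by (simp add: 1(2) ACB)
  qed
  finally have Y: "cols lam T' = Y" .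
  \<comment> \<open>The rows of \<open>T'\<close> are not inspected: some semistandard tableau has
    the columns \<open>Y\<close>, and since both are column strict it is \<open>T'\<close>.\<close>
  have "Y \<in> columns (conjugate lam) n" using colstep_columns assms cols_columns[OF T part] by blast
  then obtain T'' where T'': "T'' \<in> SSYT lam n" "cols lam T'' = Y" using cols_surj part by blast
  then have "T'' = T'" using cols_inj[OF _ cs' part] SSYT_column_strict[OF _ part] Y by simp
  then show ?thesis using T'' low by auto
qed

lemma lower_cols:
  assumes "lower lam i T = Some T'" "i \<in> {1..n}"
  shows "T' \<in> SSYT lam n \<and> colstep i (cols lam T) (cols lam T')"
proof -
  have "\<not> prefixes_nonpos (sig i) (cols lam T)" using assms lower_eq_None by auto
  then obtain Y where Y: "colstep i (cols lam T) Y" using colstep_exists by blast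
  then show ?thesis using lower_eq_Some[OF Y assms(2)] assms(1) by auto
qed

end

section \<open>Transfer of the order and of the lattice property\<close>

lemma crystal_le_iff:
  assumes part: "sorted_wrt (\<ge>) lam" and T: "T \<in> SSYT lam n" "T' \<in> SSYT lam n"
  shows "crystal_le lam n T T' \<longleftrightarrow> column_le n (cols lam T) (cols lam T')"
proof
  assume "crystal_le lam n T T'"
  then have "(T, T') \<in> {(S, S'). S \<in> SSYT lam n \<and> (\<exists>i\<in>{1..n}. lower lam i S = Some S')}\<^sup>*"
    by (simp add: crystal_le_def)
  then have "T' \<in> SSYT lam n \<and> column_le n (cols lam T) (cols lam T')"
  proof (induction rule: rtrancl_induct)
    case (step U V)
    then obtain i where "i \<in> {1..n}" "lower lam i U = Some V" by auto
    then have "V \<in> SSYT lam n" "colstep i (cols lam U) (cols lam V)" using lower_cols[OF part] step.IH by auto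
    then show ?case using step.IH column_le_trans colstep_le \<open>i \<in> {1..n}\<close> by blast
  qed (simp add: T)
  then show "column_le n (cols lam T) (cols lam T')" by simp
next
  let ?R = "{(S, S'). S \<in> SSYT lam n \<and> (\<exists>i\<in>{1..n}. lower lam i S = Some S')}"
  have "\<exists>U\<in>SSYT lam n. cols lam U = Y \<and> (T, U) \<in> ?R\<^sup>*" if "column_le n (cols lam T) Y" for Y
    using that unfolding column_le_def
  proof (induction rule: rtranclp_induct)
    case base
    then show ?case using T by blast
  next
    case (step Y Z)
    then obtain U i where U: "U \<in> SSYT lam n" "cols lam U = Y" "(T, U) \<in> ?R\<^sup>*" "i \<in> {1..n}" "colstep i Y Z"
      by auto
    then obtain V where V: "V \<in> SSYT lam n" "lower lam i U = Some V" "cols lam V = Z"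
      using lower_eq_Some[OF part U(1)] by blast
    have "(U, V) \<in> ?R" using U V by auto
    with U(3) have "(T, V) \<in> ?R\<^sup>*" by (rule rtrancl.rtrancl_into_rtrancl)
    then show ?case using V by blast
  qed
  moreover assume "column_le n (cols lam T) (cols lam T')"
  ultimately obtain U where "U \<in> SSYT lam n" "cols lam U = cols lam T'" "(T, U) \<in> ?R\<^sup>*" by blast
  moreover from this have "U = T'" using cols_inj[OF _ _ part] SSYT_column_strict[OF _ part] T by blast
  ultimately show "crystal_le lam n T T'" by (simp add: crystal_le_def)
qed

lemma is_lattice_on_iso:
  assumes "bij_betw g A B" "\<And>x y. x \<in> A \<Longrightarrow> y \<in> A \<Longrightarrow> le x y \<longleftrightarrow> le' (g x) (g y)"
  shows "is_lattice_on A le \<longleftrightarrow> is_lattice_on B le'"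
proof -
  have B: "B = g ` A" using assms(1) by (simp add: bij_betw_def)
  show ?thesis unfolding is_lattice_on_def B using assms(2) by simp
qed

lemma crystal_is_lattice_iff:
  assumes part: "sorted_wrt (\<ge>) lam"
  shows "crystal_is_lattice lam n \<longleftrightarrow> column_lattice (conjugate lam) n"
  unfolding crystal_is_lattice_def column_lattice_def
proof (rule is_lattice_on_iso)
  show "bij_betw (cols lam) (SSYT lam n) (columns (conjugate lam) n)"
    unfolding bij_betw_def
  proof
    show "inj_on (cols lam) (SSYT lam n)"
      using cols_inj[OF _ _ part] SSYT_column_strict[OF _ part] by (auto intro!: inj_onI)
    show "cols lam ` SSYT lam n = columns (conjugate lam) n"
      using cols_columns[OF _ part] cols_surj[OF _ part] by blast
  qed
qed (rule crystal_le_iff[OF part])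

section \<open>Obstructions\<close>

definition obstructed :: "nat list \<Rightarrow> nat \<Rightarrow> bool" where
  "obstructed mu n \<longleftrightarrow> (\<exists>U1\<in>columns mu n. \<exists>U2\<in>columns mu n. \<exists>X\<in>columns mu n. \<exists>Y\<in>columns mu n.
     column_le n U1 X \<and> column_le n U1 Y \<and> column_le n U2 X \<and> column_le n U2 Y \<and>
     (\<forall>Z. \<not> (column_le n U1 Z \<and> column_le n U2 Z \<and> column_le n Z X \<and> column_le n Z Y)))"

text \<open>A join of \<open>U1\<close> and \<open>U2\<close> would lie below both common upper
  bounds \<open>X\<close> and \<open>Y\<close>, and would thus be a forbidden
  \<open>Z\<close>.\<close>

lemma obstructed_not_lattice:
  assumes "obstructed mu n"
  shows "\<not> column_lattice mu n"
proof
  assume lat: "column_lattice mu n"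
  obtain U1 U2 X Y where U: "U1 \<in> columns mu n" "U2 \<in> columns mu n" "X \<in> columns mu n" "Y \<in> columns mu n"
    "column_le n U1 X \<and> column_le n U1 Y \<and> column_le n U2 X \<and> column_le n U2 Y \<and>
     (\<forall>Z. \<not> (column_le n U1 Z \<and> column_le n U2 Z \<and> column_le n Z X \<and> column_le n Z Y))"
    using assms unfolding obstructed_def by (elim bexE)
  obtain Z where Z: "column_le n U1 Z" "column_le n U2 Z"
    "\<And>W. W \<in> columns mu n \<Longrightarrow> column_le n U1 W \<Longrightarrow> column_le n U2 W \<Longrightarrow> column_le n Z W"
    using is_lattice_on_join[OF lat[unfolded column_lattice_def] U(1,2)] by auto
  have "column_le n Z X" "column_le n Z Y" using Z(3) U by simp_all
  with Z U(5) show False by simp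
qed

lemma obstructed_window:
  assumes "sorted_wrt (\<ge>) (p @ w @ q)" "\<forall>h\<in>set (p @ w @ q). h \<le> Suc n" "obstructed w n"
  shows "obstructed (p @ w @ q) n"
proof -
  let ?e = "\<lambda>X. highest p @ X @ lowest q n"
  obtain U1 U2 X Y where U: "U1 \<in> columns w n" "U2 \<in> columns w n" "X \<in> columns w n" "Y \<in> columns w n"
    "column_le n U1 X" "column_le n U1 Y" "column_le n U2 X" "column_le n U2 Y"
    and no: "\<And>Z. \<not> (column_le n U1 Z \<and> column_le n U2 Z \<and> column_le n Z X \<and> column_le n Z Y)"
    using assms(3) unfolding obstructed_def by (elim bexE conjE) simp
  have "\<not> (column_le n (?e U1) Z \<and> column_le n (?e U2) Z \<and> column_le n Z (?e X) \<and> column_le n Z (?e Y))" for Z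
  proof
    assume Z: "column_le n (?e U1) Z \<and> column_le n (?e U2) Z \<and> column_le n Z (?e X) \<and> column_le n Z (?e Y)"
    have len: "length U1 = length w" "length U2 = length w" "length X = length w" "length Y = length w"
      using U columns_length by auto
    then obtain Z' where Z': "Z = ?e Z'" "length Z' = length w"
      using column_le_window_cases[of n p U1 q Z X] Z by auto
    then show False using Z no[of Z'] len by (simp add: column_le_window_iff)
  qed
  then show ?thesis
    unfolding obstructed_def using U window_columns[OF assms(1,2)] column_le_window
    by (intro bexI[of _ "?e U1"] bexI[of _ "?e U2"] bexI[of _ "?e X"] bexI[of _ "?e Y"]) simp_all
qed

lemma column_le_stepI:
  assumes "i \<in> {1..n}" "X = A @ C # B" "Y = A @ raise i C # B" "i \<in> C" "Suc i \<notin> C"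
    "suffixes_nonneg (sig i) A" "prefixes_nonpos (sig i) B"
  shows "column_le n X Y"
  using assms colstepI colstep_le by blast

text \<open>A raise lowers a column strictly in dominance, and no later step can undo this. Since
  the two lists agree outside one place, the first step of a path must act at this place.\<close>

lemma column_le_first_step:
  assumes "column_le n (A @ C # B) (A @ C' # B)" "C \<noteq> C'"
  shows "\<exists>i\<in>{1..n}. i \<in> C \<and> Suc i \<notin> C \<and> suffixes_nonneg (sig i) A \<and> prefixes_nonpos (sig i) B \<and>
    dominates (raise i C) C' \<and> column_le n (A @ raise i C # B) (A @ C' # B)"
proof -
  obtain V i where V: "i \<in> {1..n}" "colstep i (A @ C # B) V" "column_le n V (A @ C' # B)"
    using assms(1)[unfolded column_le_def]
  proof (cases rule: converse_rtranclpE)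
    case base
    then show ?thesis using assms(2) by simp
  next
    case (step V)
    then show ?thesis using that by (auto simp: column_le_def)
  qed
  obtain A1 D B1 where 1: "A @ C # B = A1 @ D # B1" "V = A1 @ raise i D # B1" "i \<in> D" "Suc i \<notin> D"
    "suffixes_nonneg (sig i) A1" "prefixes_nonpos (sig i) B1"
    using V(2) by (auto simp: colstep_def)
  have d: "dominates (raise i D) ((A @ C' # B) ! length A1)"
    using column_le_dominates[OF V(3)] 1(2) by (auto simp: list_all2_conv_all_nth nth_append dest: spec[of _ "length A1"])
  have D: "D = (A @ C # B) ! length A1" by (simp add: 1(1))
  have "length A1 = length A"
  proof (rule ccontr)
    assume ne: "length A1 \<noteq> length A"
    have "(A @ C' # B) ! length A1 = (A @ C # B) ! length A1"
      using ne by (auto simp: nth_append nth_Cons')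
    then show False using d D not_dominates_raise[OF 1(3,4)] by simp
  qed
  then have "A1 = A" "D = C" "B1 = B" using 1(1) by simp_all
  then show ?thesis using 1 V d by (intro bexI[of _ i]) (auto simp: nth_append)
qed

text \<open>A path must begin with a raise of \<open>C\<close> that dominates
  \<open>raise k C\<close>; this is the raise at \<open>k\<close> itself, and the columns around it
  block this step.\<close>

lemma not_column_le_raise:
  assumes "k \<in> C" "Suc k \<notin> C" "\<not> (suffixes_nonneg (sig k) A \<and> prefixes_nonpos (sig k) B)"
  shows "\<not> column_le n (A @ C # B) (A @ raise k C # B)"
proof
  assume le: "column_le n (A @ C # B) (A @ raise k C # B)"
  have "k \<notin> raise k C" by (simp add: raise_def)
  then have "C \<noteq> raise k C" using assms(1) by metis
  then obtain i where "i \<in> C" "Suc i \<notin> C" "suffixes_nonneg (sig i) A" "prefixes_nonpos (sig i) B"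
    "dominates (raise i C) (raise k C)"
    using column_le_first_step[OF le] by blast
  then show False using raise_inj[of i C k] assms by blast
qed

text \<open>The count at threshold \<open>i\<close> is lowered only by raises at \<open>i\<close>,
  so one of the two successive raises must have this index.\<close>

lemma raise_raise_inj:
  assumes "i \<in> C" "Suc i \<notin> C" "k \<in> C" "Suc k \<notin> C" "l \<in> raise k C" "Suc l \<notin> raise k C"
    "dominates (raise i C) (raise l (raise k C))"
  shows "i = k \<or> i = l"
proof (rule ccontr)
  assume "\<not> ?thesis"
  moreover have "card (raise l (raise k C) \<inter> {..i}) \<le> card (raise i C \<inter> {..i})"
    using assms(7) by (simp add: dominates_def)
  ultimately show False
    using card_raise_atMost[OF assms(1,2), of i] card_raise_atMost[OF assms(3,4), of i]
      card_raise_atMost[OF assms(5,6), of i]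
    by simp
qed

lemma dominates_subset: "D \<subseteq> C \<Longrightarrow> dominates C D"
  by (auto simp: dominates_def intro!: card_mono)

lemma prefixes_nonpos_small [simp]:
  "prefixes_nonpos f [x] \<longleftrightarrow> f x \<le> 0"
  "prefixes_nonpos f [x, y] \<longleftrightarrow> f x \<le> 0 \<and> f x + f y \<le> 0"
  "prefixes_nonpos f [x, y, z] \<longleftrightarrow> f x \<le> 0 \<and> f x + f y \<le> 0 \<and> f x + f y + f z \<le> 0"
  using prefixes_nonpos_snoc[of f "[]" x] prefixes_nonpos_snoc[of f "[x]" y]
    prefixes_nonpos_snoc[of f "[x, y]" z] by auto

lemma suffixes_nonneg_small [simp]:
  "suffixes_nonneg f [x] \<longleftrightarrow> 0 \<le> f x"
  "suffixes_nonneg f [x, y] \<longleftrightarrow> 0 \<le> f x + f y \<and> 0 \<le> f y"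
  "suffixes_nonneg f [x, y, z] \<longleftrightarrow> 0 \<le> f x + f y + f z \<and> 0 \<le> f y + f z \<and> 0 \<le> f z"
  by (auto simp: suffixes_nonneg_Cons)

lemma columns_two:
  "[C, D] \<in> columns [a, b] n \<longleftrightarrow>
   C \<subseteq> {1..Suc n} \<and> D \<subseteq> {1..Suc n} \<and> card C = a \<and> card D = b \<and> dominates C D"
  by (auto simp: columns_def)

lemma columns_three:
  "[C, D, E] \<in> columns [a, b, c] n \<longleftrightarrow> [C, D] \<in> columns [a, b] n \<and> [D, E] \<in> columns [b, c] n"
  by (auto simp: columns_def intro: dominates_trans)

lemma columns_four:
  "[C, D, E, F] \<in> columns [a, b, c, d] n \<longleftrightarrow>
   [C, D] \<in> columns [a, b] n \<and> [D, E] \<in> columns [b, c] n \<and> [E, F] \<in> columns [c, d] n"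
  by (auto simp: columns_def intro: dominates_trans)

text \<open>Up to a shift and common entries, the columns \<open>13|24\<close> and \<open>13|34\<close> lie below \<open>23|34\<close> and \<open>14|34\<close>.\<close>

lemma obstructed_two_middle:
  assumes "2 \<le> b" "b \<le> a" "Suc a \<le> n"
  shows "obstructed [a, b] n"
proof -
  obtain s where s: "b = s + 2" using assms(1) by (metis add.commute le_Suc_ex)
  \<comment> \<open>The padding brings the column sizes to \<open>a\<close> and \<open>b\<close>. It
    avoids the letters \<open>s + 1\<close> to \<open>s + 4\<close>, so the signatures for
    \<open>s + 1\<close>, \<open>s + 2\<close> and \<open>s + 3\<close> are those of the small
    example.\<close>
  define c where "c p q = {1..s} \<union> {s + p, s + q} \<union> {s + 5..a + 2}" for p q
  define d where "d p q = {1..s} \<union> {s + p, s + q}" for p q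
  have r: "raise (s + 1) (c 1 3) = c 2 3" "raise (s + 3) (c 1 3) = c 1 4"
    "raise (s + 2) (d 2 4) = d 3 4" "raise (s + 1) (d 1 4) = d 2 4" "raise (s + 3) (d 1 3) = d 1 4"
    by (auto simp: raise_def c_def d_def)
  have c: "dominates (c 1 3) (d 2 4)" "dominates (d 2 4) (d 3 4)"
  proof -
    have "dominates (c 1 3) (d 1 3)" by (rule dominates_subset) (auto simp: c_def d_def)
    moreover have "dominates (d 1 3) (d 1 4)" using dominates_raise[of "s + 3" "d 1 3"] r by (simp add: d_def)
    moreover have "dominates (d 1 4) (d 2 4)" using dominates_raise[of "s + 1" "d 1 4"] r by (simp add: d_def)
    ultimately show "dominates (c 1 3) (d 2 4)" using dominates_trans by blast
    show "dominates (d 2 4) (d 3 4)" using dominates_raise[of "s + 2" "d 2 4"] r by (simp add: d_def)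
  qed
  have sub: "c 1 3 \<subseteq> {1..Suc n}" "d 2 4 \<subseteq> {1..Suc n}" "d 3 4 \<subseteq> {1..Suc n}"
    using assms s by (auto simp: c_def d_def)
  have card: "card (c 1 3) = a" "card (d 2 4) = b" "card (d 3 4) = b"
    unfolding c_def d_def using assms s by (subst card_Un_disjoint; auto)+
  have U: "[c 1 3, d 2 4] \<in> columns [a, b] n" "[c 1 3, d 3 4] \<in> columns [a, b] n"
    using sub card c dominates_trans by (auto simp: columns_two simp del: One_nat_def)
  have i: "s + 1 \<in> {1..n}" "s + 2 \<in> {1..n}" "s + 3 \<in> {1..n}" using assms s by auto
  note defs = c_def d_def sig_def
  have 1: "column_le n [c 1 3, D] [c 2 3, D]" if "D = d 2 4 \<or> D = d 3 4" for D
  proof -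
    have "sig (s + 1) D \<le> 0" using that by (elim disjE) (simp_all add: defs)
    moreover have "s + 1 \<in> c 1 3" "Suc (s + 1) \<notin> c 1 3" by (simp_all add: defs)
    ultimately show ?thesis using column_le_stepI[OF i(1) refl refl, of "c 1 3" "[]" "[D]"] by (simp add: r(1)[simplified])
  qed
  have 2: "column_le n [C, d 2 4] [C, d 3 4]" if "C = c 2 3 \<or> C = c 1 4" for C
  proof -
    have "0 \<le> sig (s + 2) C" using that by (elim disjE) (simp_all add: defs)
    moreover have "s + 2 \<in> d 2 4" "Suc (s + 2) \<notin> d 2 4" by (simp_all add: defs)
    ultimately show ?thesis using column_le_stepI[OF i(2) refl refl, of "d 2 4" "[C]" "[]"] by (simp add: r(3)[simplified])
  qed
  have 3: "column_le n [c 1 3, D] [c 1 4, D]" if "D = d 2 4 \<or> D = d 3 4" for D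
  proof -
    have "sig (s + 3) D \<le> 0" using that by (elim disjE) (simp_all add: defs)
    moreover have "s + 3 \<in> c 1 3" "Suc (s + 3) \<notin> c 1 3" by (simp_all add: defs)
    ultimately show ?thesis using column_le_stepI[OF i(3) refl refl, of "c 1 3" "[]" "[D]"] by (simp add: r(2)[simplified])
  qed
  have no: "\<not> (column_le n [c 1 3, d 2 4] Z \<and> column_le n [c 1 3, d 3 4] Z \<and>
      column_le n Z [c 2 3, d 3 4] \<and> column_le n Z [c 1 4, d 3 4])" for Z
  proof
    assume Z: "column_le n [c 1 3, d 2 4] Z \<and> column_le n [c 1 3, d 3 4] Z \<and>
      column_le n Z [c 2 3, d 3 4] \<and> column_le n Z [c 1 4, d 3 4]"
    have Zc: "Z \<in> columns [a, b] n" using Z U column_le_columns by blast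
    obtain z1 z2 where z: "Z = [z1, z2]" using columns_length[OF Zc] by (auto simp: length_Suc_conv)
    have no0: "0 \<notin> z1" "0 \<notin> z2" "0 \<notin> c 1 3" "0 \<notin> d 3 4"
      using columns_no_0[OF Zc] columns_no_0[OF U(2)] by (auto simp: z)
    have z1: "dominates (c 1 3) z1" "dominates z1 (c 2 3)" "dominates z1 (c 1 4)" and z2: "dominates (d 3 4) z2" "dominates z2 (d 3 4)"
      using Z z column_le_dominates by fastforce+
    have "z2 = d 3 4" using dominates_antisym z2 no0 by blast
    \<comment> \<open>The columns \<open>c 2 3\<close> and \<open>c 1 4\<close> are different raises
      of \<open>c 1 3\<close>, so only \<open>c 1 3\<close> itself fits between it and both of them.
      Hence \<open>Z\<close> is the second lower element. It is not above the first, because raising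
      \<open>s + 2\<close> in the second column is blocked by the \<open>s + 3\<close> without
      \<open>s + 2\<close> in \<open>c 1 3\<close>.\<close>
    moreover have "z1 = c 1 3"
      by (rule dominates_between_two_raises[of _ _ "s + 1" "s + 3"])
        (use z1 no0 r in \<open>simp_all add: c_def\<close>)
    ultimately have "column_le n [c 1 3, d 2 4] [c 1 3, d 3 4]" using Z z by simp
    moreover have "\<not> column_le n ([c 1 3] @ d 2 4 # []) ([c 1 3] @ raise (s + 2) (d 2 4) # [])"
      by (rule not_column_le_raise) (simp_all add: suffixes_nonneg_Cons c_def d_def sig_def)
    ultimately show False using r by simp
  qed
  have "[c 2 3, d 3 4] \<in> columns [a, b] n" "[c 1 4, d 3 4] \<in> columns [a, b] n"
    using column_le_columns[OF 1[of "d 3 4"] U(2)] column_le_columns[OF 3[of "d 3 4"] U(2)] by simp_all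
  then show ?thesis
    unfolding obstructed_def
  proof (intro bexI conjI allI)
    show "column_le n [c 1 3, d 2 4] [c 2 3, d 3 4]" "column_le n [c 1 3, d 2 4] [c 1 4, d 3 4]"
      using column_le_trans[OF 1[of "d 2 4"] 2[of "c 2 3"]] column_le_trans[OF 3[of "d 2 4"] 2[of "c 1 4"]] by simp_all
    show "column_le n [c 1 3, d 3 4] [c 2 3, d 3 4]" "column_le n [c 1 3, d 3 4] [c 1 4, d 3 4]"
      using 1 3 by simp_all
  qed (use U no in auto)
qed

lemma dominates_no_0: "X \<in> columns mu n \<Longrightarrow> \<forall>C\<in>set X. 0 \<notin> C"
  using columns_no_0 by blast

text \<open>Up to a shift and common entries, the columns \<open>124|1|3\<close> and \<open>124|1|4\<close> lie below \<open>134|3|4\<close> and \<open>234|2|4\<close>.\<close>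

lemma obstructed_middle_single:
  assumes "1 \<le> b" "b + 2 \<le> a" "a \<le> n"
  shows "obstructed [a, b, 1] n"
proof -
  obtain s where s: "b = s + 1" using assms(1) by (metis add.commute le_Suc_ex)
  define c where "c p q r = {1..s} \<union> {s + p, s + q, s + r} \<union> {s + 5..a + 1}" for p q r
  define d where "d p = {1..s} \<union> {s + p}" for p
  define e where "e p = {s + p}" for p
  have r: "raise (s + 2) (c 1 2 4) = c 1 3 4" "raise (s + 1) (c 1 3 4) = c 2 3 4"
    "raise (s + 1) (d 1) = d 2" "raise (s + 2) (d 2) = d 3"
    "raise (s + 1) (e 1) = e 2" "raise (s + 2) (e 2) = e 3" "raise (s + 3) (e 3) = e 4"
    by (auto simp: raise_def c_def d_def e_def)
  have mem: "s + 2 \<in> c 1 2 4" "Suc (s + 2) \<notin> c 1 2 4" "s + 1 \<in> c 1 3 4" "Suc (s + 1) \<notin> c 1 3 4"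
    "s + 1 \<in> d 1" "Suc (s + 1) \<notin> d 1" "s + 2 \<in> d 2" "Suc (s + 2) \<notin> d 2"
    "s + 1 \<in> e 1" "Suc (s + 1) \<notin> e 1" "s + 2 \<in> e 2" "Suc (s + 2) \<notin> e 2" "s + 3 \<in> e 3" "Suc (s + 3) \<notin> e 3"
    by (simp_all add: c_def d_def e_def)
  have sg1: "sig (s + 1) (c 1 2 4) = 0" "sig (s + 1) (c 1 3 4) = 1" "sig (s + 1) (d 1) = 1" "sig (s + 1) (d 2) = -1"
    "sig (s + 1) (e 3) = 0" "sig (s + 1) (e 4) = 0"
    by (simp_all add: sig_def c_def d_def e_def)
  have sg2: "sig (s + 2) (c 1 2 4) = 1" "sig (s + 2) (c 1 3 4) = -1" "sig (s + 2) (d 1) = 0" "sig (s + 2) (d 2) = 1"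
    "sig (s + 2) (d 3) = -1" "sig (s + 2) (e 3) = -1" "sig (s + 2) (e 4) = 0"
    by (simp_all add: sig_def c_def d_def e_def)
  have sg3: "sig (s + 3) (c 1 2 4) = -1" "sig (s + 3) (c 1 3 4) = 0" "sig (s + 3) (d 1) = 0" "sig (s + 3) (d 2) = 0"
    "sig (s + 3) (d 3) = 1"
    by (simp_all add: sig_def c_def d_def e_def)
  note facts = r[simplified] mem[simplified] sg1[simplified] sg2[simplified] sg3[simplified]
  have sub: "c 1 2 4 \<subseteq> {1..Suc n}" "d 1 \<subseteq> {1..Suc n}" "e 3 \<subseteq> {1..Suc n}" "e 4 \<subseteq> {1..Suc n}"
    using assms s by (auto simp: c_def d_def e_def)
  have card: "card (d 1) = b" "card (e 3) = 1" "card (e 4) = 1"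
    using s by (simp_all add: d_def e_def)
  have card_c: "card (c 1 2 4) = a"
  proof -
    have "c 1 2 4 = d 1 \<union> ({s + 2, s + 4} \<union> {s + 5..a + 1})" by (auto simp: c_def d_def)
    moreover have "card ({s + 2, s + 4} \<union> {s + 5..a + 1}) = 2 + (a + 1 - (s + 4))"
      by (subst card_Un_disjoint) auto
    moreover have "d 1 \<inter> ({s + 2, s + 4} \<union> {s + 5..a + 1}) = {}" by (auto simp: d_def)
    ultimately show ?thesis using s assms card(1) by (simp add: card_Un_disjoint d_def)
  qed
  have "dominates (c 1 2 4) (d 1)" by (rule dominates_subset) (auto simp: c_def d_def)
  moreover have "dominates (d 1) (e 1)" by (rule dominates_subset) (auto simp: d_def e_def)
  moreover have "dominates (e 1) (e 2)" "dominates (e 2) (e 3)" "dominates (e 3) (e 4)"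
    using dominates_raise[OF mem(9,10)] dominates_raise[OF mem(11,12)] dominates_raise[OF mem(13,14)] r(5-7) by simp_all
  ultimately have dm: "dominates (c 1 2 4) (d 1)" "dominates (d 1) (e 3)" "dominates (d 1) (e 4)" using dominates_trans by blast+
  have U: "[c 1 2 4, d 1, e 3] \<in> columns [a, b, 1] n" "[c 1 2 4, d 1, e 4] \<in> columns [a, b, 1] n"
    using sub card card_c dm by (simp_all add: columns_two columns_three del: One_nat_def)
  have i: "s + 1 \<in> {1..n}" "s + 2 \<in> {1..n}" "s + 3 \<in> {1..n}" using assms s by auto
  let ?le = "column_le n"
  have d12: "?le [c 1 2 4, d 1, E] [c 1 2 4, d 2, E]" "?le [c 1 3 4, d 1, E] [c 1 3 4, d 2, E]"
    "?le [c 1 3 4, d 2, E] [c 2 3 4, d 2, E]" if "E = e 3 \<or> E = e 4" for E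
    using that column_le_stepI[OF i(1) refl refl, of "d 1" "[c 1 2 4]" "[E]"]
      column_le_stepI[OF i(1) refl refl, of "d 1" "[c 1 3 4]" "[E]"]
      column_le_stepI[OF i(1) refl refl, of "c 1 3 4" "[]" "[d 2, E]"] by (auto simp: facts)
  have d23: "?le [c 1 2 4, d 2, E] [c 1 2 4, d 3, E]" if "E = e 3 \<or> E = e 4" for E
    using that column_le_stepI[OF i(2) refl refl, of "d 2" "[c 1 2 4]" "[E]"] by (auto simp: facts)
  have c23: "?le [c 1 2 4, d 1, e 3] [c 1 3 4, d 1, e 3]" "?le [c 1 2 4, d 1, e 4] [c 1 3 4, d 1, e 4]"
    "?le [c 1 2 4, d 3, e 4] [c 1 3 4, d 3, e 4]"
    using column_le_stepI[OF i(2) refl refl, of "c 1 2 4" "[]" "[d 1, e 3]"]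
      column_le_stepI[OF i(2) refl refl, of "c 1 2 4" "[]" "[d 1, e 4]"]
      column_le_stepI[OF i(2) refl refl, of "c 1 2 4" "[]" "[d 3, e 4]"] by (simp_all add: facts)
  have e34: "?le [c 1 2 4, d 3, e 3] [c 1 2 4, d 3, e 4]" "?le [c 1 3 4, d 2, e 3] [c 1 3 4, d 2, e 4]"
    using column_le_stepI[OF i(3) refl refl, of "e 3" "[c 1 2 4, d 3]" "[]"]
      column_le_stepI[OF i(3) refl refl, of "e 3" "[c 1 3 4, d 2]" "[]"] by (simp_all add: facts)
  have paths: "?le [c 1 2 4, d 1, e 3] [c 1 3 4, d 3, e 4]" "?le [c 1 2 4, d 1, e 3] [c 2 3 4, d 2, e 4]"
    "?le [c 1 2 4, d 1, e 4] [c 1 3 4, d 3, e 4]" "?le [c 1 2 4, d 1, e 4] [c 2 3 4, d 2, e 4]"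
  proof -
    show "?le [c 1 2 4, d 1, e 3] [c 1 3 4, d 3, e 4]"
      using d12(1)[of "e 3"] d23[of "e 3"] e34(1) c23(3) by (auto intro: column_le_trans)
    show "?le [c 1 2 4, d 1, e 3] [c 2 3 4, d 2, e 4]"
      using c23(1) d12(2)[of "e 3"] e34(2) d12(3)[of "e 4"] by (auto intro: column_le_trans)
    show "?le [c 1 2 4, d 1, e 4] [c 1 3 4, d 3, e 4]"
      using d12(1)[of "e 4"] d23[of "e 4"] c23(3) by (auto intro: column_le_trans)
    show "?le [c 1 2 4, d 1, e 4] [c 2 3 4, d 2, e 4]"
      using c23(2) d12(2)[of "e 4"] d12(3)[of "e 4"] by (auto intro: column_le_trans)
  qed
  have stuck: "\<not> ?le [c 1 2 4, d 1, e 3] [c 1 2 4, d 1, e 4]" "\<not> ?le [c 1 3 4, d 2, e 4] [c 1 3 4, d 3, e 4]"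
    using not_column_le_raise[OF mem(13,14), of "[c 1 2 4, d 1]" "[]" n]
      not_column_le_raise[OF mem(7,8), of "[c 1 3 4]" "[e 4]" n] by (simp_all add: facts)
  have stuck2: "\<not> ?le [c 1 3 4, d 1, e 4] [c 1 3 4, d 3, e 4]"
  proof
    assume le: "?le [c 1 3 4, d 1, e 4] [c 1 3 4, d 3, e 4]"
    have "s + 3 \<notin> d 1" "s + 3 \<in> d 3" by (simp_all add: d_def)
    then have "d 1 \<noteq> d 3" by metis
    then obtain i where i: "i \<in> d 1" "Suc i \<notin> d 1" "?le [c 1 3 4, raise i (d 1), e 4] [c 1 3 4, d 3, e 4]"
      using column_le_first_step[OF _ \<open>d 1 \<noteq> d 3\<close>, of n "[c 1 3 4]" "[e 4]"] le by auto
    have "i = s + 1" using i(1,2) by (auto simp: d_def)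
    then show False using i(3) stuck(2) facts by simp
  qed
  \<comment> \<open>The letter \<open>s + 1\<close> can move only after \<open>s + 2\<close> has
    moved, but \<open>d 2\<close> also offers an \<open>s + 2\<close>, which takes precedence over
    that of the first column.\<close>
  have stuck3: "\<not> ?le [c 1 2 4, d 2, e 4] [c 2 3 4, d 2, e 4]"
  proof
    assume le: "?le [c 1 2 4, d 2, e 4] [c 2 3 4, d 2, e 4]"
    have "s + 1 \<in> c 1 2 4" "s + 1 \<notin> c 2 3 4" by (simp_all add: c_def)
    then have "c 1 2 4 \<noteq> c 2 3 4" by metis
    then obtain i where i: "i \<in> c 1 2 4" "Suc i \<notin> c 1 2 4" "prefixes_nonpos (sig i) [d 2, e 4]"
        "dominates (raise i (c 1 2 4)) (c 2 3 4)"
      using column_le_first_step[OF _ \<open>c 1 2 4 \<noteq> c 2 3 4\<close>, of n "[]" "[d 2, e 4]"] le by auto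
    have "i = s + 2 \<or> i = s + 1"
      by (rule raise_raise_inj[of _ "c 1 2 4"]) (use i r(1,2) mem(1-4) in simp_all)
    moreover have "i \<noteq> s + 1" using i(2) mem(1) by auto
    ultimately have "i = s + 2" by simp
    then show False using i(3) by (simp add: facts)
  qed
  have no: "\<not> (?le [c 1 2 4, d 1, e 3] Z \<and> ?le [c 1 2 4, d 1, e 4] Z \<and>
      ?le Z [c 1 3 4, d 3, e 4] \<and> ?le Z [c 2 3 4, d 2, e 4])" for Z
  proof
    assume Z: "?le [c 1 2 4, d 1, e 3] Z \<and> ?le [c 1 2 4, d 1, e 4] Z \<and>
      ?le Z [c 1 3 4, d 3, e 4] \<and> ?le Z [c 2 3 4, d 2, e 4]"
    then have Zc: "Z \<in> columns [a, b, 1] n" using U(2) column_le_columns by blast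
    obtain z1 z2 z3 where z: "Z = [z1, z2, z3]"
      using columns_length[OF Zc] by (auto simp: length_Suc_conv)
    have no0: "0 \<notin> z1" "0 \<notin> z2" "0 \<notin> z3" "0 \<notin> c 1 2 4" "0 \<notin> d 1" "0 \<notin> e 4"
      using dominates_no_0[OF Zc] dominates_no_0[OF U(2)] by (auto simp: z)
    have z1: "dominates (c 1 2 4) z1" "dominates z1 (c 1 3 4)" and z2: "dominates (d 1) z2" "dominates z2 (d 2)"
      and z3: "dominates (e 4) z3" "dominates z3 (e 4)"
      using Z column_le_dominates[of n "[c 1 2 4, d 1, e 4]" Z] column_le_dominates[of n Z "[c 1 3 4, d 3, e 4]"]
        column_le_dominates[of n Z "[c 2 3 4, d 2, e 4]"] by (simp_all add: z)
    have "z3 = e 4" using dominates_antisym z3 no0 by blast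
    moreover have "z1 = c 1 2 4 \<or> z1 = c 1 3 4"
      using dominates_between_raise[of "c 1 2 4" z1 "s + 2"] z1 no0 mem(1,2) r(1) by simp
    moreover have "z2 = d 1 \<or> z2 = d 2"
      using dominates_between_raise[of "d 1" z2 "s + 1"] z2 no0 mem(5,6) r(3) by simp
    \<comment> \<open>Four candidates remain. With \<open>(c 1 2 4, d 1)\<close>, \<open>Z\<close>
      is the second lower element and is not above the first. With first column
      \<open>c 1 3 4\<close>, \<open>Z\<close> is not below the first upper element, by
      \<open>stuck\<close> for \<open>d 2\<close> and \<open>stuck2\<close> for \<open>d 1\<close>.
      With \<open>(c 1 2 4, d 2)\<close> it is not below the second, by
      \<open>stuck3\<close>.\<close>
    ultimately show False using Z z stuck stuck2 stuck3 by auto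
  qed
  have "[c 1 3 4, d 3, e 4] \<in> columns [a, b, 1] n" "[c 2 3 4, d 2, e 4] \<in> columns [a, b, 1] n"
    using column_le_columns[OF paths(3) U(2)] column_le_columns[OF paths(4) U(2)] by simp_all
  then show ?thesis
    unfolding obstructed_def
    by (intro bexI[OF _ U(1)] bexI[OF _ U(2)] bexI[of _ "[c 1 3 4, d 3, e 4]"] bexI[of _ "[c 2 3 4, d 2, e 4]"])
      (use paths no in auto)
qed

lemma dominates_singletons: "a \<le> b \<Longrightarrow> dominates {a} {b}"
  by (auto simp: dominates_def Int_insert_left)

text \<open>This is the obstruction for \<open>(3, 1, 1)\<close> with \<open>1\<close> and \<open>2\<close> added at the left of the first two rows.\<close>

lemma obstructed_3211: "obstructed [3, 2, 1, 1] 3"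
proof -
  \<comment> \<open>The entry 4 without 3 gives \<open>k\<close> signature -1 for the operator 3;
    this keeps the last column of the first lower element from being raised directly to that of the
    second.\<close>
  define k :: "nat set" where "k = {1, 2, 4}"
  define d :: "nat \<Rightarrow> nat \<Rightarrow> nat set" where "d p q = {p, q}" for p q
  define e :: "nat \<Rightarrow> nat set" where "e p = {p}" for p
  have r: "raise 2 (d 1 2) = d 1 3" "raise 1 (d 1 3) = d 2 3"
    "raise 1 (e 1) = e 2" "raise 2 (e 2) = e 3" "raise 3 (e 3) = e 4"
    by (auto simp: raise_def d_def e_def)
  have mem: "2 \<in> d 1 2" "Suc 2 \<notin> d 1 2" "1 \<in> d 1 3" "Suc 1 \<notin> d 1 3" "1 \<in> e 1" "Suc 1 \<notin> e 1"
    "2 \<in> e 2" "Suc 2 \<notin> e 2" "3 \<in> e 3" "Suc 3 \<notin> e 3"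
    by (simp_all add: d_def e_def)
  have sg: "sig 1 k = 0" "sig 2 k = 1" "sig 3 k = -1" "sig 1 (d 1 2) = 0" "sig 2 (d 1 2) = 1" "sig 3 (d 1 2) = 0"
    "sig 1 (d 1 3) = 1" "sig 2 (d 1 3) = -1" "sig 3 (d 1 3) = 1"
    "sig 1 (e 1) = 1" "sig 2 (e 1) = 0" "sig 3 (e 1) = 0" "sig 1 (e 2) = -1" "sig 2 (e 2) = 1" "sig 3 (e 2) = 0"
    "sig 1 (e 3) = 0" "sig 2 (e 3) = -1" "sig 3 (e 3) = 1" "sig 1 (e 4) = 0" "sig 2 (e 4) = 0"
    by (simp_all add: sig_def k_def d_def e_def)
  note facts = r[simplified] mem[simplified] sg[simplified]
  have "dominates k (d 1 2)" "dominates (d 1 2) (e 1)" by (rule dominates_subset; simp add: k_def d_def e_def)+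
  moreover have "dominates (e 1) (e 3)" "dominates (e 1) (e 4)" by (simp_all add: e_def dominates_singletons)
  ultimately have U: "[k, d 1 2, e 1, e 3] \<in> columns [3, 2, 1, 1] 3" "[k, d 1 2, e 1, e 4] \<in> columns [3, 2, 1, 1] 3"
    by (simp_all add: columns_four columns_two) (simp_all add: k_def d_def e_def)
  have i: "1 \<in> {1..3::nat}" "2 \<in> {1..3::nat}" "3 \<in> {1..3::nat}" by simp_all
  let ?le = "column_le 3"
  have e12: "?le [k, d 1 2, e 1, E] [k, d 1 2, e 2, E]" "?le [k, d 1 3, e 1, E] [k, d 1 3, e 2, E]"
    "?le [k, d 1 3, e 2, E] [k, d 2 3, e 2, E]" if "E = e 3 \<or> E = e 4" for E
    using that column_le_stepI[OF i(1) refl refl, of "e 1" "[k, d 1 2]" "[E]"]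
      column_le_stepI[OF i(1) refl refl, of "e 1" "[k, d 1 3]" "[E]"]
      column_le_stepI[OF i(1) refl refl, of "d 1 3" "[k]" "[e 2, E]"] by (auto simp: facts)
  have e23: "?le [k, d 1 2, e 2, E] [k, d 1 2, e 3, E]" if "E = e 3 \<or> E = e 4" for E
    using that column_le_stepI[OF i(2) refl refl, of "e 2" "[k, d 1 2]" "[E]"] by (auto simp: facts)
  have d12: "?le [k, d 1 2, e 1, e 3] [k, d 1 3, e 1, e 3]" "?le [k, d 1 2, e 1, e 4] [k, d 1 3, e 1, e 4]"
    "?le [k, d 1 2, e 3, e 4] [k, d 1 3, e 3, e 4]"
    using column_le_stepI[OF i(2) refl refl, of "d 1 2" "[k]" "[e 1, e 3]"]
      column_le_stepI[OF i(2) refl refl, of "d 1 2" "[k]" "[e 1, e 4]"]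
      column_le_stepI[OF i(2) refl refl, of "d 1 2" "[k]" "[e 3, e 4]"] by (simp_all add: facts)
  have e34: "?le [k, d 1 2, e 3, e 3] [k, d 1 2, e 3, e 4]" "?le [k, d 1 3, e 1, e 3] [k, d 1 3, e 1, e 4]"
    using column_le_stepI[OF i(3) refl refl, of "e 3" "[k, d 1 2, e 3]" "[]"]
      column_le_stepI[OF i(3) refl refl, of "e 3" "[k, d 1 3, e 1]" "[]"] by (simp_all add: facts suffixes_nonneg_Cons)
  have paths: "?le [k, d 1 2, e 1, e 3] [k, d 1 3, e 3, e 4]" "?le [k, d 1 2, e 1, e 3] [k, d 2 3, e 2, e 4]"
    "?le [k, d 1 2, e 1, e 4] [k, d 1 3, e 3, e 4]" "?le [k, d 1 2, e 1, e 4] [k, d 2 3, e 2, e 4]"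
  proof -
    show "?le [k, d 1 2, e 1, e 3] [k, d 1 3, e 3, e 4]"
      using e12(1)[of "e 3"] e23[of "e 3"] e34(1) d12(3) by (auto intro: column_le_trans)
    show "?le [k, d 1 2, e 1, e 3] [k, d 2 3, e 2, e 4]"
      using d12(1) e34(2) e12(2)[of "e 4"] e12(3)[of "e 4"] by (auto intro: column_le_trans)
    show "?le [k, d 1 2, e 1, e 4] [k, d 1 3, e 3, e 4]"
      using e12(1)[of "e 4"] e23[of "e 4"] d12(3) by (auto intro: column_le_trans)
    show "?le [k, d 1 2, e 1, e 4] [k, d 2 3, e 2, e 4]"
      using d12(2) e12(2)[of "e 4"] e12(3)[of "e 4"] by (auto intro: column_le_trans)
  qed
  have stuck: "\<not> ?le [k, d 1 2, e 1, e 3] [k, d 1 2, e 1, e 4]" "\<not> ?le [k, d 1 3, e 2, e 4] [k, d 1 3, e 3, e 4]"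
    using not_column_le_raise[OF mem(9,10), of "[k, d 1 2, e 1]" "[]" 3]
      not_column_le_raise[OF mem(7,8), of "[k, d 1 3]" "[e 4]" 3] by (simp_all add: facts)
  have stuck2: "\<not> ?le [k, d 1 3, e 1, e 4] [k, d 1 3, e 3, e 4]"
  proof
    assume le: "?le [k, d 1 3, e 1, e 4] [k, d 1 3, e 3, e 4]"
    have "e 1 \<noteq> e 3" by (simp add: e_def)
    then obtain i where i: "i \<in> e 1" "?le [k, d 1 3, raise i (e 1), e 4] [k, d 1 3, e 3, e 4]"
      using column_le_first_step[OF _ \<open>e 1 \<noteq> e 3\<close>, of 3 "[k, d 1 3]" "[e 4]"] le by auto
    have "i = 1" using i(1) by (simp add: e_def)
    then show False using i(2) stuck(2) facts by simp
  qed
  have stuck3: "\<not> ?le [k, d 1 2, e 2, e 4] [k, d 2 3, e 2, e 4]"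
  proof
    assume le: "?le [k, d 1 2, e 2, e 4] [k, d 2 3, e 2, e 4]"
    have "1 \<in> d 1 2" "1 \<notin> d 2 3" by (simp_all add: d_def)
    then have "d 1 2 \<noteq> d 2 3" by metis
    then obtain i where i: "i \<in> d 1 2" "Suc i \<notin> d 1 2" "prefixes_nonpos (sig i) [e 2, e 4]"
      using column_le_first_step[OF _ \<open>d 1 2 \<noteq> d 2 3\<close>, of 3 "[k]" "[e 2, e 4]"] le by auto
    have "i = 2" using i(1,2) by (auto simp: d_def)
    then show False using i(3) by (simp add: facts)
  qed
  have no: "\<not> (?le [k, d 1 2, e 1, e 3] Z \<and> ?le [k, d 1 2, e 1, e 4] Z \<and>
      ?le Z [k, d 1 3, e 3, e 4] \<and> ?le Z [k, d 2 3, e 2, e 4])" for Z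
  proof
    assume Z: "?le [k, d 1 2, e 1, e 3] Z \<and> ?le [k, d 1 2, e 1, e 4] Z \<and>
      ?le Z [k, d 1 3, e 3, e 4] \<and> ?le Z [k, d 2 3, e 2, e 4]"
    then have Zc: "Z \<in> columns [3, 2, 1, 1] 3" using U(2) column_le_columns by blast
    obtain z0 z1 z2 z3 where z: "Z = [z0, z1, z2, z3]"
      using columns_length[OF Zc] by (auto simp: length_Suc_conv numeral_eq_Suc)
    have no0: "0 \<notin> z0" "0 \<notin> z1" "0 \<notin> z2" "0 \<notin> z3" "0 \<notin> k" "0 \<notin> d 1 2" "0 \<notin> e 1" "0 \<notin> e 4"
      using dominates_no_0[OF Zc] dominates_no_0[OF U(2)] by (auto simp: z)
    have z0: "dominates k z0" "dominates z0 k" and z1: "dominates (d 1 2) z1" "dominates z1 (d 1 3)"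
      and z2: "dominates (e 1) z2" "dominates z2 (e 2)" and z3: "dominates (e 4) z3" "dominates z3 (e 4)"
      using Z column_le_dominates[of 3 "[k, d 1 2, e 1, e 4]" Z] column_le_dominates[of 3 Z "[k, d 1 3, e 3, e 4]"]
        column_le_dominates[of 3 Z "[k, d 2 3, e 2, e 4]"] by (simp_all add: z)
    have "z3 = e 4" "z0 = k" using dominates_antisym z0 z3 no0 by blast+
    moreover have "z1 = d 1 2 \<or> z1 = d 1 3"
      using dominates_between_raise[of "d 1 2" z1 2] z1 no0 mem(1,2) r(1) by simp
    moreover have "z2 = e 1 \<or> z2 = e 2"
      using dominates_between_raise[of "e 1" z2 1] z2 no0 mem(5,6) r(3) by simp
    \<comment> \<open>The same four cases as for three columns, with the additional first column
      frozen at \<open>k\<close>.\<close>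
    ultimately show False using Z z stuck stuck2 stuck3 by auto
  qed
  have "[k, d 1 3, e 3, e 4] \<in> columns [3, 2, 1, 1] 3" "[k, d 2 3, e 2, e 4] \<in> columns [3, 2, 1, 1] 3"
    using column_le_columns[OF paths(3) U(2)] column_le_columns[OF paths(4) U(2)] by simp_all
  then show ?thesis
    unfolding obstructed_def
    by (intro bexI[OF _ U(1)] bexI[OF _ U(2)] bexI[of _ "[k, d 1 3, e 3, e 4]"] bexI[of _ "[k, d 2 3, e 2, e 4]"])
      (use paths no in auto)
qed

section \<open>Models of the crystal order\<close>

text \<open>Assumption \<open>closed\<close> shows that the crystal order implies \<open>R\<close>,
  and \<open>first\<close> gives the converse by induction on the remaining rank. Since the bottom
  state is the highest element, closure also makes \<open>emb\<close> onto, so the states need not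
  be counted, and \<open>R\<close> puts their images into \<open>columns\<close>.\<close>

lemma column_lattice_model:
  fixes S :: "'s set" and emb :: "'s \<Rightarrow> nat set list" and R :: "'s \<Rightarrow> 's \<Rightarrow> bool"
  assumes mu: "sorted_wrt (\<ge>) mu" "\<forall>h\<in>set mu. h \<le> Suc n"
    and bot: "b \<in> S" "emb b = highest mu" "\<And>x. x \<in> S \<Longrightarrow> R b x"
    and inj: "inj_on emb S"
    and refl: "\<And>x. x \<in> S \<Longrightarrow> R x x"
    and trans: "\<And>x y z. x \<in> S \<Longrightarrow> y \<in> S \<Longrightarrow> z \<in> S \<Longrightarrow> R x y \<Longrightarrow> R y z \<Longrightarrow> R x z"
    and closed: "\<And>x i Y. x \<in> S \<Longrightarrow> i \<in> {1..n} \<Longrightarrow> colstep i (emb x) Y \<Longrightarrow> \<exists>y\<in>S. Y = emb y \<and> R x y"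
    and first: "\<And>x y. x \<in> S \<Longrightarrow> y \<in> S \<Longrightarrow> R x y \<Longrightarrow> x \<noteq> y \<Longrightarrow>
      \<exists>i\<in>{1..n}. \<exists>z\<in>S. colstep i (emb x) (emb z) \<and> R z y"
    and join: "\<And>x y. x \<in> S \<Longrightarrow> y \<in> S \<Longrightarrow> \<exists>z\<in>S. R x z \<and> R y z \<and> (\<forall>w\<in>S. R x w \<and> R y w \<longrightarrow> R z w)"
  shows "column_lattice mu n"
proof -
  have le: "\<exists>y\<in>S. Y = emb y \<and> R x y" if "column_le n (emb x) Y" "x \<in> S" for x Y
    using that(1) unfolding column_le_def
  proof (induction rule: rtranclp_induct)
    case base
    then show ?case using refl that(2) by blast
  next
    case (step Y Z)
    then obtain y i where y: "y \<in> S" "Y = emb y" "R x y" "i \<in> {1..n}" "colstep i Y Z" by blast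
    then obtain z where "z \<in> S" "Z = emb z" "R y z" using closed by blast
    then show ?case using trans that(2) y by blast
  qed
  have R: "column_le n (emb x) (emb y)" if "R x y" "x \<in> S" "y \<in> S" "emb x \<in> columns mu n" for x y
    using that
  proof (induction "length mu * \<Sum>{1..Suc n} - rank (emb x)" arbitrary: x rule: less_induct)
    case less
    show ?case
    proof (cases "x = y")
      case False
      then obtain i z where z: "i \<in> {1..n}" "z \<in> S" "colstep i (emb x) (emb z)" "R z y"
        using first less.prems by blast
      have zc: "emb z \<in> columns mu n" using colstep_columns z less.prems by blast
      have "rank (emb z) = Suc (rank (emb x))" using colstep_rank z less.prems by blast
      moreover have "rank (emb z) \<le> length mu * \<Sum>{1..Suc n}" using rank_le zc by blast
      ultimately have "column_le n (emb z) (emb y)" using less.hyps[of z] z zc less.prems by simp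
      then show ?thesis using column_le_trans colstep_le z by blast
    qed simp
  qed
  have high: "highest mu \<in> columns mu n" using mu by (rule highest_columns)
  have sub: "emb x \<in> columns mu n" if "x \<in> S" for x
    using R[OF bot(3)[OF that] bot(1) that] column_le_columns bot(2) high by simp
  have iff: "column_le n (emb x) (emb y) \<longleftrightarrow> R x y" if "x \<in> S" "y \<in> S" for x y
    using le[of x "emb y"] R[of x y] sub that inj by (auto dest: inj_onD)
  have im: "X \<in> emb ` S" if "X \<in> columns mu n" for X
    using le[of b X] highest_le[OF that mu(2)] bot by auto
  show ?thesis
  proof (rule column_latticeI_joins[OF mu])
    fix X Y assume XY: "X \<in> columns mu n" "Y \<in> columns mu n"
    obtain x y where xy: "x \<in> S" "y \<in> S" "X = emb x" "Y = emb y" using im[OF XY(1)] im[OF XY(2)] by blast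
    obtain z where z: "z \<in> S" "R x z" "R y z" "\<forall>w\<in>S. R x w \<and> R y w \<longrightarrow> R z w"
      using join[OF xy(1,2)] by (elim bexE conjE) (rule that)
    show "\<exists>Z\<in>columns mu n. column_le n X Z \<and> column_le n Y Z \<and>
        (\<forall>W\<in>columns mu n. column_le n X W \<and> column_le n Y W \<longrightarrow> column_le n Z W)"
    proof (intro bexI[of _ "emb z"] conjI ballI impI)
      fix W assume W: "W \<in> columns mu n" "column_le n X W \<and> column_le n Y W"
      obtain w where "w \<in> S" "W = emb w" using im[OF W(1)] by blast
      then show "column_le n (emb z) W" using W(2) xy z iff by simp
    qed (use xy z iff sub in auto)
  qed
qed

lemma map_upt_eq_append:
  assumes "map g [p..<q] = A @ C # B"
  shows "\<exists>j. p \<le> j \<and> j < q \<and> A = map g [p..<j] \<and> C = g j \<and> B = map g [Suc j..<q]"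
proof -
  define j where "j = p + length A"
  have len: "q - p = length A + Suc (length B)" using arg_cong[OF assms, of length] by simp
  then have j: "p \<le> j" "j < q" by (simp_all add: j_def)
  have "[p..<q] = [p..<j] @ j # [Suc j..<q]"
    using j upt_add_eq_append[of p j "q - j"] by (simp add: upt_conv_Cons)
  then have "map g [p..<j] @ g j # map g [Suc j..<q] = A @ C # B" using assms by simp
  moreover have "length (map g [p..<j]) = length A" by (simp add: j_def)
  ultimately show ?thesis using j by (intro exI[of _ j]) simp
qed

lemma map_upt_split: "p \<le> j \<Longrightarrow> j < q \<Longrightarrow> map g [p..<q] = map g [p..<j] @ g j # map g [Suc j..<q]"
  using upt_add_eq_append[of p j "q - j"] by (simp add: upt_conv_Cons)

lemma sig_singleton: "sig i {x} = (if x = i then 1 else 0) - (if x = Suc i then 1 else 0)"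
  by (auto simp: sig_def)

section \<open>Shapes with one box in the second row\<close>

text \<open>A state \<open>(a, b)\<close> is the tableau with first row \<open>a 0, \<dots>, a (k - 1)\<close> and the entry \<open>b\<close> below \<open>a 0\<close>.\<close>

definition hook_states :: "nat \<Rightarrow> nat \<Rightarrow> ((nat \<Rightarrow> nat) \<times> nat) set" where
  "hook_states k n = {(a, b). (\<forall>i j. i \<le> j \<longrightarrow> j < k \<longrightarrow> a i \<le> a j) \<and> (\<forall>j\<ge>k. a j = 0) \<and>
     (\<forall>j<k. a j \<le> Suc n) \<and> 1 \<le> a 0 \<and> a 0 < b \<and> b \<le> Suc n}"

definition hook_columns :: "nat \<Rightarrow> (nat \<Rightarrow> nat) \<times> nat \<Rightarrow> nat set list" where
  "hook_columns k = (\<lambda>(a, b). {a 0, b} # map (\<lambda>j. {a j}) [1..<k])"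

text \<open>A first-row entry that has reached the second-row entry is never overtaken again, since
  the second row waits while an equal entry is present: this is the third condition. The last one
  records a crossing: an entry reaches the second-row entry from just below only if its left
  neighbour equals it at that moment, so the neighbour ends at \<open>b - 1\<close> or
  higher.\<close>

definition hook_le :: "nat \<Rightarrow> (nat \<Rightarrow> nat) \<times> nat \<Rightarrow> (nat \<Rightarrow> nat) \<times> nat \<Rightarrow> bool" where
  "hook_le k = (\<lambda>(a, b) (a', b'). (\<forall>j<k. a j \<le> a' j) \<and> b \<le> b' \<and> (\<forall>j<k. a' j < b' \<longrightarrow> a j < b) \<and>
     (\<forall>j. Suc j < k \<longrightarrow> a (Suc j) < b \<longrightarrow> b' \<le> a' (Suc j) \<longrightarrow> b \<le> Suc (a' j)))"

text \<open>For \<open>i = b - 1\<close> the second-row entry matches one \<open>i\<close> of the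
  first row, so a second \<open>i\<close> is needed, which sorting makes the left neighbour. For
  \<open>i = b\<close> any \<open>i\<close> in the first row is raised in preference to the
  second-row entry.\<close>

definition hook_move :: "nat \<Rightarrow> nat \<Rightarrow> (nat \<Rightarrow> nat) \<times> nat \<Rightarrow> (nat \<Rightarrow> nat) \<times> nat \<Rightarrow> bool" where
  "hook_move k i = (\<lambda>(a, b) y.
     (\<exists>j<k. i = a j \<and> (Suc j < k \<longrightarrow> a j < a (Suc j)) \<and> (b = Suc (a j) \<longrightarrow> 0 < j \<and> a (j - 1) = a j) \<and>
        y = (a(j := Suc (a j)), b)) \<or>
     (i = b \<and> (\<forall>j<k. a j \<noteq> b) \<and> y = (a, Suc b)))"

lemma hook_colstep_move:
  assumes "0 < k" "(a, b) \<in> hook_states k n" "colstep i (hook_columns k (a, b)) Y"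
  shows "\<exists>y. hook_move k i (a, b) y \<and> Y = hook_columns k y"
proof -
  have st: "\<And>i j. i \<le> j \<Longrightarrow> j < k \<Longrightarrow> a i \<le> a j" "a 0 < b"
    using assms(2) by (auto simp: hook_states_def)
  obtain A C B where 1: "{a 0, b} # map (\<lambda>j. {a j}) [1..<k] = A @ C # B" "Y = A @ raise i C # B"
    "i \<in> C" "Suc i \<notin> C" "suffixes_nonneg (sig i) A" "prefixes_nonpos (sig i) B"
    using assms(3) by (auto simp: colstep_def hook_columns_def)
  show ?thesis
  proof (cases A)
    case Nil
    then have C: "C = {a 0, b}" and B: "B = map (\<lambda>j. {a j}) [1..<k]" using 1(1) by auto
    consider "i = a 0" | "i = b" using 1(3) C by auto
    then show ?thesis
    proof cases
      case i: 1
      have "a 0 < a 1" if "1 < k"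
      proof -
        have "B = {a 1} # map (\<lambda>j. {a j}) [2..<k]" using B that by (simp add: upt_conv_Cons numeral_2_eq_2)
        then have "sig i {a 1} \<le> 0"
          using 1(6) prefixes_nonpos_appendD[of "sig i" "[{a 1}]"] prefixes_nonpos_wsum[of "sig i" "[{a 1}]"] by simp
        then have "a 1 \<noteq> a 0" using i by (auto simp: sig_singleton)
        then show ?thesis using st(1)[of 0 1] that by simp
      qed
      moreover have "b \<noteq> Suc (a 0)" using 1(4) C i by auto
      moreover have "raise i {a 0, b} = {Suc (a 0), b}" using i st(2) by (auto simp: raise_def)
      ultimately have "hook_move k i (a, b) (a(0 := Suc (a 0)), b)" "Y = hook_columns k (a(0 := Suc (a 0)), b)"
        using assms(1) i by (auto simp: hook_move_def 1(2) Nil C B hook_columns_def)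
      then show ?thesis by blast
    next
      case i: 2
      have "a j \<noteq> b" if "j < k" for j
      proof
        assume aj: "a j = b"
        then have "1 \<le> j" using st(2) by (cases j) auto
        have "B = map (\<lambda>j. {a j}) [1..<Suc j] @ map (\<lambda>j. {a j}) [Suc j..<k]"
          using B map_upt_split[OF \<open>1 \<le> j\<close> that, of "\<lambda>j. {a j}"] \<open>1 \<le> j\<close> by simp
        then have "wsum (sig i) (map (\<lambda>j. {a j}) [1..<Suc j]) \<le> 0"
          using 1(6) prefixes_nonpos_appendD prefixes_nonpos_wsum by blast
        then have "wsum (sig i) (map (\<lambda>j. {a j}) [1..<j]) + 1 \<le> 0"
          using \<open>1 \<le> j\<close> aj i by (simp add: sig_singleton)
        moreover have "0 \<le> wsum (sig i) (map (\<lambda>j. {a j}) [1..<j])"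
        proof (rule suffixes_nonneg_wsum, rule suffixes_nonnegI)
          fix D assume "D \<in> set (map (\<lambda>j. {a j}) [1..<j])"
          then obtain m where "m < j" "D = {a m}" by auto
          then show "0 \<le> sig i D" using st(1)[of m j] that aj i by (simp add: sig_singleton)
        qed
        ultimately show False by simp
      qed
      moreover have "raise i {a 0, b} = {a 0, Suc b}" using i st(2) by (auto simp: raise_def)
      ultimately have "hook_move k i (a, b) (a, Suc b)" "Y = hook_columns k (a, Suc b)"
        using i by (auto simp: hook_move_def 1(2) Nil C B hook_columns_def)
      then show ?thesis by blast
    qed
  next
    case (Cons D A')
    then have D: "D = {a 0, b}" and m: "map (\<lambda>j. {a j}) [1..<k] = A' @ C # B" using 1(1) by auto
    obtain j where j: "1 \<le> j" "j < k" "A' = map (\<lambda>j. {a j}) [1..<j]" "C = {a j}" "B = map (\<lambda>j. {a j}) [Suc j..<k]"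
      using map_upt_eq_append[OF m] by blast
    have i: "i = a j" using 1(3) j(4) by simp
    have "a j < a (Suc j)" if "Suc j < k"
    proof -
      have "B = {a (Suc j)} # map (\<lambda>j. {a j}) [Suc (Suc j)..<k]" using j(5) that by (simp add: upt_conv_Cons)
      then have "sig i {a (Suc j)} \<le> 0"
        using 1(6) prefixes_nonpos_appendD[of "sig i" "[{a (Suc j)}]"] prefixes_nonpos_wsum[of "sig i" "[{a (Suc j)}]"] by simp
      then have "a (Suc j) \<noteq> a j" using i by (auto simp: sig_singleton)
      then show ?thesis using st(1)[of j "Suc j"] that by simp
    qed
    moreover have "a (j - 1) = a j" if "b = Suc (a j)"
    proof (rule ccontr)
      assume "a (j - 1) \<noteq> a j"
      then have "a (j - 1) < i" using st(1)[of "j - 1" j] j i by simp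
      then have lt: "a m < i" if "m < j" for m
        using that j st(1)[of m "j - 1"] by (intro le_less_trans[OF _ \<open>a (j - 1) < i\<close>]) simp
      have "wsum (sig i) A' \<le> 0"
      proof (rule prefixes_nonpos_wsum, rule prefixes_nonposI)
        fix D assume "D \<in> set A'"
        then obtain m where "m < j" "D = {a m}" using j(3) by auto
        then show "sig i D \<le> 0" using lt[of m] by (simp add: sig_singleton)
      qed
      moreover have "sig i D = -1" using D lt[of 0] j(1) that i by (auto simp: sig_def)
      ultimately show False using 1(5) Cons suffixes_nonneg_wsum by fastforce
    qed
    moreover have "raise i C = {Suc (a j)}" using j(4) i by (auto simp: raise_def)
    moreover have "map (\<lambda>m. {(a(j := Suc (a j))) m}) [1..<k] = A' @ {Suc (a j)} # B"
      using map_upt_split[OF j(1,2), of "\<lambda>m. {(a(j := Suc (a j))) m}"] j(3,5) by simp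
    ultimately have "hook_move k i (a, b) (a(j := Suc (a j)), b)" "Y = hook_columns k (a(j := Suc (a j)), b)"
      using j i Cons D by (auto simp: hook_move_def 1(2) hook_columns_def)
    then show ?thesis by blast
  qed
qed

lemma hook_move_colstep:
  assumes "0 < k" "(a, b) \<in> hook_states k n" "hook_move k i (a, b) y"
  shows "colstep i (hook_columns k (a, b)) (hook_columns k y)"
proof -
  have st: "\<And>i j. i \<le> j \<Longrightarrow> j < k \<Longrightarrow> a i \<le> a j" "a 0 < b"
    using assms(2) by (auto simp: hook_states_def)
  consider (row) j where "j < k" "i = a j" "Suc j < k \<Longrightarrow> a j < a (Suc j)"
      "b = Suc (a j) \<Longrightarrow> 0 < j \<and> a (j - 1) = a j" "y = (a(j := Suc (a j)), b)"
    | (col) "i = b" "\<forall>j<k. a j \<noteq> b" "y = (a, Suc b)"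
    using assms(3) by (auto simp: hook_move_def)
  then show ?thesis
  proof cases
    case row
    have gt: "i < a m" if "j < m" "m < k" for m
      using st(1)[of "Suc j" m] row that by simp
    have P: "prefixes_nonpos (sig i) (map (\<lambda>j. {a j}) [m..<k])" if "j < m" for m
    proof (rule prefixes_nonposI)
      fix D assume "D \<in> set (map (\<lambda>j. {a j}) [m..<k])"
      then obtain l where "m \<le> l" "l < k" "D = {a l}" by auto
      then show "sig i D \<le> 0" using gt[of l] that by (simp add: sig_singleton)
    qed
    show ?thesis
    proof (cases j)
      case 0
      have "a 0 \<noteq> b" "b \<noteq> Suc (a 0)" using st(2) row 0 by auto
      then have "raise i {a 0, b} = {Suc (a 0), b}" using row(2) 0 by (auto simp: raise_def)
      moreover have "hook_columns k y = {Suc (a 0), b} # map (\<lambda>j. {a j}) [1..<k]"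
        by (auto simp: hook_columns_def row(5) 0)
      moreover have "hook_columns k (a, b) = {a 0, b} # map (\<lambda>j. {a j}) [1..<k]"
        by (simp add: hook_columns_def)
      ultimately show ?thesis
        using colstepI[of i "{a 0, b}" "[]" "map (\<lambda>j. {a j}) [1..<k]"] P[of 1] row(1,2) 0 \<open>b \<noteq> Suc (a 0)\<close>
        by simp
    next
      case (Suc j')
      then have j: "1 \<le> j" by simp
      have nn: "0 \<le> sig i {a m}" if "m < j" for m
        using st(1)[of m j] that row(1,2) by (simp add: sig_singleton)
      have S: "suffixes_nonneg (sig i) (map (\<lambda>j. {a j}) [1..<j])"
        using nn by (intro suffixes_nonnegI) auto
      have "0 \<le> sig i {a 0, b} + wsum (sig i) (map (\<lambda>j. {a j}) [1..<j])"
      proof (cases "b = Suc (a j)")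
        case True
        then have e: "a j' = i" using row(2,4) Suc by simp
        show ?thesis
        proof (cases "j' = 0")
          case True
          then have "0 \<le> sig i {a 0, b}" using e by (simp add: sig_def)
          then show ?thesis using suffixes_nonneg_wsum[OF S] by simp
        next
          case False
          then have "wsum (sig i) (map (\<lambda>j. {a j}) [1..<j]) = wsum (sig i) (map (\<lambda>j. {a j}) [1..<j']) + 1"
            using e Suc by (simp add: sig_singleton)
          moreover have "0 \<le> wsum (sig i) (map (\<lambda>j. {a j}) [1..<j'])"
            using nn Suc by (intro suffixes_nonneg_wsum suffixes_nonnegI) auto
          ultimately show ?thesis using sig_bounds(2)[of i "{a 0, b}"] by simp
        qed
      next
        case False
        moreover have "a 0 \<le> i" using st(1)[of 0 j] row(1,2) by simp
        ultimately have "0 \<le> sig i {a 0, b}" using row(2) by (simp add: sig_def)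
        then show ?thesis using suffixes_nonneg_wsum[OF S] by simp
      qed
      then have "suffixes_nonneg (sig i) ({a 0, b} # map (\<lambda>j. {a j}) [1..<j])"
        using S by (simp add: suffixes_nonneg_Cons)
      moreover have "raise i {a j} = {Suc (a j)}" using row(2) by (auto simp: raise_def)
      ultimately have "colstep i (({a 0, b} # map (\<lambda>j. {a j}) [1..<j]) @ {a j} # map (\<lambda>j. {a j}) [Suc j..<k])
          (({a 0, b} # map (\<lambda>j. {a j}) [1..<j]) @ {Suc (a j)} # map (\<lambda>j. {a j}) [Suc j..<k])"
        using colstepI[of i "{a j}" "{a 0, b} # map (\<lambda>j. {a j}) [1..<j]" "map (\<lambda>j. {a j}) [Suc j..<k]"]
          P[of "Suc j"] row(2) by simp
      moreover have "hook_columns k y = ({a 0, b} # map (\<lambda>j. {a j}) [1..<j]) @ {Suc (a j)} # map (\<lambda>j. {a j}) [Suc j..<k]"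
      proof -
        have "map (\<lambda>m. {(a(j := Suc (a j))) m}) [1..<k] =
            map (\<lambda>m. {(a(j := Suc (a j))) m}) [1..<j] @ {Suc (a j)} # map (\<lambda>m. {(a(j := Suc (a j))) m}) [Suc j..<k]"
          using map_upt_split[OF j row(1), of "\<lambda>m. {(a(j := Suc (a j))) m}"] by (simp only: fun_upd_same)
        also have "\<dots> = map (\<lambda>j. {a j}) [1..<j] @ {Suc (a j)} # map (\<lambda>j. {a j}) [Suc j..<k]" by auto
        finally show ?thesis using Suc by (simp add: hook_columns_def row(5) del: One_nat_def)
      qed
      moreover have "hook_columns k (a, b) = ({a 0, b} # map (\<lambda>j. {a j}) [1..<j]) @ {a j} # map (\<lambda>j. {a j}) [Suc j..<k]"
        using map_upt_split[OF j row(1), of "\<lambda>j. {a j}"] by (simp add: hook_columns_def)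
      ultimately show ?thesis by (simp only:)
    qed
  next
    case col
    have "prefixes_nonpos (sig i) (map (\<lambda>j. {a j}) [1..<k])"
      using col by (intro prefixes_nonposI) (auto simp: sig_singleton)
    moreover have "raise i {a 0, b} = {a 0, Suc b}" using col st(2) by (auto simp: raise_def)
    ultimately show ?thesis
      using colstepI[of i "{a 0, b}" "[]" "map (\<lambda>j. {a j}) [1..<k]"] col st(2) by (simp add: hook_columns_def)
  qed
qed

lemma hook_move_le:
  assumes "(a, b) \<in> hook_states k n" "hook_move k i (a, b) y" "i \<in> {1..n}" "0 < k"
  shows "y \<in> hook_states k n \<and> hook_le k (a, b) y"
proof -
  have st: "\<And>i j. i \<le> j \<Longrightarrow> j < k \<Longrightarrow> a i \<le> a j" "a 0 < b" "b \<le> Suc n" "\<And>j. j < k \<Longrightarrow> a j \<le> Suc n"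
    "\<And>j. k \<le> j \<Longrightarrow> a j = 0" "1 \<le> a 0"
    using assms(1) by (auto simp: hook_states_def)
  consider (row) j where "j < k" "i = a j" "Suc j < k \<Longrightarrow> a j < a (Suc j)"
      "b = Suc (a j) \<Longrightarrow> 0 < j \<and> a (j - 1) = a j" "y = (a(j := Suc (a j)), b)"
    | (col) "i = b" "\<forall>j<k. a j \<noteq> b" "y = (a, Suc b)"
    using assms(2) by (auto simp: hook_move_def)
  then show ?thesis
  proof cases
    case row
    have gt: "i < a m" if "j < m" "m < k" for m
      using st(1)[of "Suc j" m] row that by simp
    let ?a = "a(j := Suc (a j))"
    have "?a p \<le> ?a q" if "p \<le> q" "q < k" for p q
      using st(1)[OF that] gt[of q] that row(2) by (cases "p = q") auto
    moreover have "?a 0 < b" using row(4) st(2) by (cases "j = 0"; cases "b = Suc (a 0)") auto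
    ultimately have "y \<in> hook_states k n"
      using st row assms(3) by (auto simp: hook_states_def)
    moreover have "hook_le k (a, b) y"
      using row(4) by (auto simp: hook_le_def row(5))
    ultimately show ?thesis by simp
  next
    case col
    then show ?thesis using st assms(3) by (auto simp: hook_states_def hook_le_def less_Suc_eq)
  qed
qed

lemma exists_last:
  fixes P :: "nat \<Rightarrow> bool"
  assumes "P j" "j < k"
  obtains m where "P m" "m < k" "\<And>i. m < i \<Longrightarrow> i < k \<Longrightarrow> \<not> P i"
proof -
  let ?M = "{j. j < k \<and> P j}"
  have M: "finite ?M" "?M \<noteq> {}" using assms by auto
  have "P (Max ?M)" "Max ?M < k" using Max_in[OF M] by auto
  moreover have "\<not> P i" if "Max ?M < i" "i < k" for i using Max_ge[of ?M i] that by fastforce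
  ultimately show thesis using that by blast
qed

text \<open>Priority of moves: entries already at or above \<open>b\<close>; then entries that must
  still cross \<open>b\<close>; then \<open>b\<close> itself; last the entries that stay below.
  Within a group the rightmost entry moves, so that its right neighbour leaves room. If the crossing
  entry stands at \<open>b - 1\<close> without an equal left neighbour, the left neighbour is raised
  instead.\<close>

lemma hook_le_first_move:
  assumes "0 < k" "(a, b) \<in> hook_states k n" "(a', b') \<in> hook_states k n" "hook_le k (a, b) (a', b')"
    "(a, b) \<noteq> (a', b')"
  shows "\<exists>i y. i \<in> {1..n} \<and> hook_move k i (a, b) y \<and> hook_le k y (a', b')"
proof -
  have st: "\<And>i j. i \<le> j \<Longrightarrow> j < k \<Longrightarrow> a i \<le> a j" "a 0 < b" "b \<le> Suc n" "\<And>j. j < k \<Longrightarrow> a j \<le> Suc n"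
    "\<And>j. k \<le> j \<Longrightarrow> a j = 0" "1 \<le> a 0"
    using assms(2) by (auto simp: hook_states_def)
  have st': "\<And>i j. i \<le> j \<Longrightarrow> j < k \<Longrightarrow> a' i \<le> a' j" "a' 0 < b'" "b' \<le> Suc n" "\<And>j. j < k \<Longrightarrow> a' j \<le> Suc n"
    "\<And>j. k \<le> j \<Longrightarrow> a' j = 0"
    using assms(3) by (auto simp: hook_states_def)
  have le: "\<And>j. j < k \<Longrightarrow> a j \<le> a' j" "b \<le> b'" "\<And>j. j < k \<Longrightarrow> a' j < b' \<Longrightarrow> a j < b"
    "\<And>j. Suc j < k \<Longrightarrow> a (Suc j) < b \<Longrightarrow> b' \<le> a' (Suc j) \<Longrightarrow> b \<le> Suc (a' j)"
    using assms(4) by (auto simp: hook_le_def)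
  have pos: "1 \<le> a j" if "j < k" for j using st(1)[of 0 j] st(6) that by simp
  have row: ?thesis if "j < k" "Suc j < k \<Longrightarrow> a j < a (Suc j)" "b = Suc (a j) \<Longrightarrow> 0 < j \<and> a (j - 1) = a j"
    "a j < a' j" "a' j < b' \<Longrightarrow> Suc (a j) < b" for j
  proof (intro exI conjI)
    show "a j \<in> {1..n}" using pos[OF that(1)] st'(4)[OF that(1)] that(4) by simp
    show "hook_move k (a j) (a, b) (a(j := Suc (a j)), b)" using that(1-3) by (auto simp: hook_move_def)
    show "hook_le k (a(j := Suc (a j)), b) (a', b')"
      using le that(4,5) by (auto simp: hook_le_def split: if_splits)
  qed
  show ?thesis
  proof (cases "\<exists>j<k. b \<le> a j \<and> a j < a' j")
    case True
    then obtain j where j: "b \<le> a j \<and> a j < a' j" "j < k" "\<And>m. j < m \<Longrightarrow> m < k \<Longrightarrow> \<not> (b \<le> a m \<and> a m < a' m)"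
      using exists_last[of "\<lambda>j. b \<le> a j \<and> a j < a' j" _ k] by blast
    show ?thesis
    proof (rule row[of j])
      assume s: "Suc j < k"
      then have "a' (Suc j) \<le> a (Suc j)" using j(1) j(3)[of "Suc j"] st(1)[of j "Suc j"] by auto
      then show "a j < a (Suc j)" using st'(1)[of j "Suc j"] s j(1) by simp
    qed (use j le(3)[of j] in auto)
  next
    case A: False
    show ?thesis
    proof (cases "\<exists>j<k. a j < b \<and> b' \<le> a' j")
      case True
      then obtain j0 where j0: "j0 < k" "a j0 < b" "b' \<le> a' j0" by blast
      obtain j where j: "a j < b" "j < k" "\<And>m. j < m \<Longrightarrow> m < k \<Longrightarrow> b \<le> a m"
        using exists_last[of "\<lambda>j. a j < b", OF j0(2,1)] by (metis not_le)
      have "j0 \<le> j" using j(3)[of j0] j0 by (meson leD leI)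
      then have j': "b' \<le> a' j" using st'(1)[of j0 j] j(2) j0(3) by simp
      \<comment> \<open>The first entry at or above \<open>b'\<close> in the target must cross, and
        its left neighbour does not. The crossing condition there bounds the neighbour's target from
        below, and monotonicity passes this bound on to \<open>a' (j - 1)\<close>.\<close>
      define m where "m = (LEAST m. b' \<le> a' m)"
      have m: "b' \<le> a' m" "m \<le> j" unfolding m_def using j' by (rule LeastI, rule Least_le)
      obtain l where l: "m = Suc l" using m(1) st'(2) by (cases m) auto
      have "a m < b" using st(1)[OF m(2) j(2)] j(1) by simp
      then have "b \<le> Suc (a' l)" using le(4)[of l] m l j(2) by simp
      also have "\<dots> \<le> Suc (a' (j - 1))" using st'(1)[of l "j - 1"] l m(2) j(2) by simp
      finally have bl: "b \<le> Suc (a' (j - 1))" .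
      have "0 < j" using l m(2) by simp
      show ?thesis
      proof (cases "Suc (a j) < b \<or> a (j - 1) = a j")
        case True
        show ?thesis
        proof (rule row[of j])
          show "Suc j < k \<Longrightarrow> a j < a (Suc j)" using j(1) j(3)[of "Suc j"] by simp
        qed (use True j j' le(2) \<open>0 < j\<close> in auto)
      next
        case False
        then have f: "b = Suc (a j)" "a (j - 1) < a j" using j(1) st(1)[of "j - 1" j] j(2) by auto
        show ?thesis
          by (rule row[of "j - 1"]) (use f j(2) bl \<open>0 < j\<close> in auto)
      qed
    next
      case B: False
      show ?thesis
      proof (cases "b < b'")
        case True
        have ne: "a j \<noteq> b" if "j < k" for j
          using A le(1)[OF that] le(3)[OF that] that True by (metis le_eq_less_or_eq less_irrefl)
        show ?thesis
        proof (intro exI conjI)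
          show "b \<in> {1..n}" using True st(2) st'(3) by simp
          show "hook_move k b (a, b) (a, Suc b)" using ne by (simp add: hook_move_def)
          show "hook_le k (a, Suc b) (a', b')"
            using le True B ne by (auto simp: hook_le_def less_Suc_eq)
        qed
      next
        case False
        then have bb: "b' = b" using le(2) by simp
        then have "a \<noteq> a'" using assms(5) by simp
        then obtain j1 where "a j1 \<noteq> a' j1" by blast
        moreover from this have "j1 < k" using st(5) st'(5) by (metis leI)
        ultimately have "a j1 < a' j1" "j1 < k" using le(1)[of j1] by auto
        then obtain j where j: "a j < a' j" "j < k" "\<And>m. j < m \<Longrightarrow> m < k \<Longrightarrow> \<not> a m < a' m"
          using exists_last[of "\<lambda>j. a j < a' j" j1 k] by blast
        have ab: "a j < b" using A j by force
        then have "a' j < b" using B j(2) bb by force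
        show ?thesis
        proof (rule row[of j])
          assume s: "Suc j < k"
          show "a j < a (Suc j)" using j(3)[of "Suc j"] st'(1)[of j "Suc j"] s j(1) by simp
        qed (use j \<open>a' j < b\<close> in auto)
      qed
    qed
  qed
qed

text \<open>The first row of the least state above \<open>(a1, b1)\<close> whose entries \<open>j\<close> with \<open>b2 \<le> a2 j\<close> are
  no longer smaller than the entry in the second row.\<close>

definition hook_lift :: "nat \<Rightarrow> (nat \<Rightarrow> nat) \<Rightarrow> nat \<Rightarrow> (nat \<Rightarrow> nat) \<Rightarrow> nat \<Rightarrow> nat \<Rightarrow> nat" where
  "hook_lift k a1 b1 a2 b2 j =
     (if a1 j < b1 \<and> b2 \<le> a2 j then b1
      else if Suc j < k \<and> a1 (Suc j) < b1 \<and> b2 \<le> a2 (Suc j) then b1 - 1 else a1 j)"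

text \<open>The join takes the maximum of the second-row entries and, entrywise, the maximum of the
  two lifts. Each lift is forced by the crossing conditions for one of the two states.\<close>

lemma hook_join:
  assumes "0 < k" "(a1, b1) \<in> hook_states k n" "(a2, b2) \<in> hook_states k n"
  shows "\<exists>z\<in>hook_states k n. hook_le k (a1, b1) z \<and> hook_le k (a2, b2) z \<and>
    (\<forall>w\<in>hook_states k n. hook_le k (a1, b1) w \<and> hook_le k (a2, b2) w \<longrightarrow> hook_le k z w)"
proof -
  have lift: "(\<forall>i j. i \<le> j \<longrightarrow> j < k \<longrightarrow> hook_lift k a1 b1 a2 b2 i \<le> hook_lift k a1 b1 a2 b2 j) \<and>
      (\<forall>j<k. a1 j \<le> hook_lift k a1 b1 a2 b2 j \<and> hook_lift k a1 b1 a2 b2 j \<le> Suc n) \<and>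
      (\<forall>j<k. a1 j < b1 \<longrightarrow> a2 j < b2 \<longrightarrow> hook_lift k a1 b1 a2 b2 j < b1)"
    if "(a1, b1) \<in> hook_states k n" "(a2, b2) \<in> hook_states k n" for a1 b1 a2 b2
  proof -
    have st1: "\<And>i j. i \<le> j \<Longrightarrow> j < k \<Longrightarrow> a1 i \<le> a1 j" "a1 0 < b1" "b1 \<le> Suc n" "\<And>j. j < k \<Longrightarrow> a1 j \<le> Suc n"
      using that(1) by (auto simp: hook_states_def)
    have st2: "\<And>i j. i \<le> j \<Longrightarrow> j < k \<Longrightarrow> a2 i \<le> a2 j"
      using that(2) by (auto simp: hook_states_def)
    have "hook_lift k a1 b1 a2 b2 i \<le> hook_lift k a1 b1 a2 b2 j" if "i \<le> j" "j < k" for i j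
    proof (cases "i = j")
      case False
      then have ij: "Suc i \<le> j" using that by simp
      show ?thesis
        using st1(1)[OF that] st1(1)[OF ij that(2)] st2[OF that] st2[OF ij that(2)] that
          st1(1)[of j "Suc j"] st2[of j "Suc j"] st1(1)[of i "Suc i"] ij
        unfolding hook_lift_def by (simp; linarith)
    qed simp
    moreover have "a1 j \<le> hook_lift k a1 b1 a2 b2 j \<and> hook_lift k a1 b1 a2 b2 j \<le> Suc n" if "j < k" for j
      using st1(1)[of j "Suc j"] st1(3,4) that by (fastforce simp: hook_lift_def)
    moreover have "hook_lift k a1 b1 a2 b2 j < b1" if "j < k" "a1 j < b1" "a2 j < b2" for j
      using that by (auto simp: hook_lift_def)
    ultimately show ?thesis by blast
  qed
  define g1 where "g1 = hook_lift k a1 b1 a2 b2"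
  define g2 where "g2 = hook_lift k a2 b2 a1 b1"
  define za where "za j = (if j < k then max (g1 j) (g2 j) else 0)" for j
  define zb where "zb = max b1 b2"
  note l1 = lift[OF assms(2,3), folded g1_def] and l2 = lift[OF assms(3,2), folded g2_def]
  have g_mono: "g1 i \<le> g1 j" "g2 i \<le> g2 j" if "i \<le> j" "j < k" for i j
    using l1 l2 that by blast+
  have g_ge: "a1 j \<le> g1 j" "a2 j \<le> g2 j" "g1 j \<le> Suc n" "g2 j \<le> Suc n" if "j < k" for j
    using l1 l2 that by blast+
  have st1: "\<And>i j. i \<le> j \<Longrightarrow> j < k \<Longrightarrow> a1 i \<le> a1 j" "a1 0 < b1" "b1 \<le> Suc n" "1 \<le> a1 0"
    using assms(2) by (auto simp: hook_states_def)
  have st2: "\<And>i j. i \<le> j \<Longrightarrow> j < k \<Longrightarrow> a2 i \<le> a2 j" "a2 0 < b2" "b2 \<le> Suc n"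
    using assms(3) by (auto simp: hook_states_def)
  \<comment> \<open>An entry of the join stays below the second row exactly if it does so in both
    states: if it has crossed in one, the lift of the other brings it up to that state's own
    second-row entry, hence to both and to their maximum.\<close>
  have small: "za j < zb \<longleftrightarrow> a1 j < b1 \<and> a2 j < b2" if "j < k" for j
  proof
    assume "a1 j < b1 \<and> a2 j < b2"
    then have "g1 j < b1" "g2 j < b2" using l1 l2 that by auto
    then show "za j < zb" using that by (auto simp: za_def zb_def max_def)
  next
    assume z: "za j < zb"
    show "a1 j < b1 \<and> a2 j < b2"
    proof (rule ccontr)
      assume "\<not> ?thesis"
      then have or: "b1 \<le> a1 j \<or> b2 \<le> a2 j" by auto
      have "b1 \<le> g1 j"
      proof (cases "a1 j < b1")
        case True
        then show ?thesis using or by (simp add: g1_def hook_lift_def)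
      next
        case False
        moreover have "a1 j \<le> g1 j" using l1 that by blast
        ultimately show ?thesis by simp
      qed
      moreover have "b2 \<le> g2 j"
      proof (cases "a2 j < b2")
        case True
        then show ?thesis using or by (simp add: g2_def hook_lift_def)
      next
        case False
        moreover have "a2 j \<le> g2 j" using l2 that by blast
        ultimately show ?thesis by simp
      qed
      ultimately show False using z that by (auto simp: za_def zb_def)
    qed
  qed
  have "(za, zb) \<in> hook_states k n"
    unfolding hook_states_def
  proof (clarify, intro conjI allI impI)
    fix i j assume "i \<le> j" "j < k"
    then show "za i \<le> za j" using g_mono[of i j] by (simp add: za_def max.coboundedI1 max.coboundedI2)
  next
    show "za 0 < zb" using small[of 0] assms(1) st1(2) st2(2) by simp
    show "1 \<le> za 0" using g_ge(1)[of 0] st1(4) assms(1) by (simp add: za_def le_max_iff_disj)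
  qed (use g_ge st1(3) st2(3) in \<open>simp_all add: za_def zb_def\<close>)
  moreover have lift_pred: "b1 \<le> Suc (hook_lift k a1 b1 a2 b2 j)"
    if "Suc j < k" "a1 (Suc j) < b1" "b2 \<le> a2 (Suc j)" for a1 b1 a2 b2 j
    using that by (auto simp: hook_lift_def)
  moreover have "hook_le k (a1, b1) (za, zb)"
  proof -
    have "b1 \<le> Suc (za j)" if "Suc j < k" "a1 (Suc j) < b1" "zb \<le> za (Suc j)" for j
    proof -
      have "b2 \<le> a2 (Suc j)" using small[OF that(1)] that(2,3) by auto
      then have "b1 \<le> Suc (g1 j)" unfolding g1_def using lift_pred that by blast
      then show ?thesis using that(1) by (simp add: za_def)
    qed
    then show ?thesis using g_ge(1) small by (simp add: hook_le_def za_def zb_def le_max_iff_disj)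
  qed
  moreover have "hook_le k (a2, b2) (za, zb)"
  proof -
    have "b2 \<le> Suc (za j)" if "Suc j < k" "a2 (Suc j) < b2" "zb \<le> za (Suc j)" for j
    proof -
      have "b1 \<le> a1 (Suc j)" using small[OF that(1)] that(2,3) by auto
      then have "b2 \<le> Suc (g2 j)" unfolding g2_def using lift_pred that by blast
      then show ?thesis using that(1) by (simp add: za_def)
    qed
    then show ?thesis using g_ge(2) small by (simp add: hook_le_def za_def zb_def le_max_iff_disj)
  qed
  moreover have "hook_le k (za, zb) (a, b)"
    if "hook_le k (a1, b1) (a, b)" "hook_le k (a2, b2) (a, b)" for a b
  proof -
    have lower: "hook_lift k a1 b1 a2 b2 j \<le> a j"
      if "hook_le k (a1, b1) (a, b)" "hook_le k (a2, b2) (a, b)" "j < k" for a1 b1 a2 b2 j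
    proof -
      have 1: "b1 \<le> b" "a1 j \<le> a j" using that by (auto simp: hook_le_def)
      have 2: "b \<le> a m" if "m < k" "b2 \<le> a2 m" for m
        using \<open>hook_le k (a2, b2) (a, b)\<close> that by (fastforce simp: hook_le_def)
      have 3: "b1 \<le> Suc (a j)" if "Suc j < k" "a1 (Suc j) < b1" "b2 \<le> a2 (Suc j)"
        using \<open>hook_le k (a1, b1) (a, b)\<close> that 2[of "Suc j"] by (simp add: hook_le_def)
      show ?thesis using 1 2[OF \<open>j < k\<close>] 3 by (fastforce simp: hook_lift_def)
    qed
    have "za j \<le> a j" if "j < k" for j
      using lower[OF \<open>hook_le k (a1, b1) (a, b)\<close> \<open>hook_le k (a2, b2) (a, b)\<close> that]
        lower[OF \<open>hook_le k (a2, b2) (a, b)\<close> \<open>hook_le k (a1, b1) (a, b)\<close> that] that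
      by (simp add: za_def g1_def g2_def)
    moreover have "za j < zb" if "j < k" "a j < b" for j
      using \<open>hook_le k (a1, b1) (a, b)\<close> \<open>hook_le k (a2, b2) (a, b)\<close> small that by (simp add: hook_le_def)
    moreover have "zb \<le> Suc (a j)" if "Suc j < k" "za (Suc j) < zb" "b \<le> a (Suc j)" for j
      using \<open>hook_le k (a1, b1) (a, b)\<close> \<open>hook_le k (a2, b2) (a, b)\<close> small[OF that(1)] that
      by (simp add: hook_le_def zb_def)
    ultimately show ?thesis using that by (auto simp: hook_le_def zb_def)
  qed
  ultimately show ?thesis by (intro bexI[of _ "(za, zb)"]) auto
qed

lemma hook_le_trans: "hook_le k x y \<Longrightarrow> hook_le k y z \<Longrightarrow> hook_le k x z"
  unfolding hook_le_def
proof (clarsimp, intro conjI allI impI)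
  fix a b a1 b1 a2 b2 j
  assume 1: "\<forall>j<k. a j \<le> a1 j" "\<forall>j<k. a1 j < b1 \<longrightarrow> a j < b"
    "\<forall>j. Suc j < k \<longrightarrow> a (Suc j) < b \<longrightarrow> b1 \<le> a1 (Suc j) \<longrightarrow> b \<le> Suc (a1 j)" "b \<le> b1"
    and 2: "\<forall>j<k. a1 j \<le> a2 j" "b1 \<le> b2" "\<forall>j<k. a2 j < b2 \<longrightarrow> a1 j < b1"
    "\<forall>j. Suc j < k \<longrightarrow> a1 (Suc j) < b1 \<longrightarrow> b2 \<le> a2 (Suc j) \<longrightarrow> b1 \<le> Suc (a2 j)"
    and j: "Suc j < k" "a (Suc j) < b" "b2 \<le> a2 (Suc j)"
  show "b \<le> Suc (a2 j)"
  proof (cases "b1 \<le> a1 (Suc j)")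
    case True
    then have "b \<le> Suc (a1 j)" using 1(3) j by blast
    moreover have "a1 j \<le> a2 j" using 2(1) j(1) by simp
    ultimately show ?thesis by simp
  next
    case False
    then have "b1 \<le> Suc (a2 j)" using 2(4) j by simp
    then show ?thesis using 1(4) by simp
  qed
qed (meson order_trans le_trans)+

lemma column_lattice_hook:
  assumes "0 < k" "1 \<le> n"
  shows "column_lattice (2 # replicate (k - 1) 1) n"
proof (rule column_lattice_model[where S = "hook_states k n" and emb = "hook_columns k" and R = "hook_le k"
      and b = "(\<lambda>j. if j < k then 1 else 0, 2)"])
  show "sorted_wrt (\<ge>) (2 # replicate (k - 1) (1::nat))"
    by (auto simp: sorted_wrt_iff_nth_less nth_Cons')
  show "\<forall>h\<in>set (2 # replicate (k - 1) 1). h \<le> Suc n" using assms by auto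
  show "(\<lambda>j. if j < k then 1 else 0, 2) \<in> hook_states k n" using assms by (auto simp: hook_states_def)
  have "map (\<lambda>j. {if j < k then 1 else 0 :: nat}) [1..<k] = replicate (k - 1) {1}"
    by (rule nth_equalityI) auto
  then show "hook_columns k (\<lambda>j. if j < k then 1 else 0, 2) = highest (2 # replicate (k - 1) 1)"
    using assms by (auto simp: hook_columns_def highest_def)
  show "hook_le k (\<lambda>j. if j < k then 1 else 0, 2) x" if "x \<in> hook_states k n" for x
  proof -
    obtain a b where x: "x = (a, b)" by fastforce
    have "1 \<le> a j" if "j < k" for j
    proof -
      have "1 \<le> a 0" "a 0 \<le> a j" using \<open>x \<in> hook_states k n\<close> x that by (simp_all add: hook_states_def)
      then show ?thesis by simp
    qed
    moreover have "2 \<le> b" using that x by (auto simp: hook_states_def)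
    ultimately show ?thesis using x by (auto simp: hook_le_def)
  qed
  show "inj_on (hook_columns k) (hook_states k n)"
  proof (rule inj_onI, clarify)
    fix a b a' b' assume st: "(a, b) \<in> hook_states k n" "(a', b') \<in> hook_states k n"
      and e: "hook_columns k (a, b) = hook_columns k (a', b')"
    have "{a 0, b} = {a' 0, b'}" using e by (simp add: hook_columns_def)
    then have "a 0 = a' 0 \<and> b = b'" using st by (auto simp: hook_states_def doubleton_eq_iff)
    moreover have "a j = a' j" if "1 \<le> j" "j < k" for j
      using e that by (auto simp: hook_columns_def)
    moreover have "a j = a' j" if "k \<le> j" for j using st that by (auto simp: hook_states_def)
    ultimately have "a j = a' j" for j by (metis One_nat_def Suc_leI leI neq0_conv)
    then show "a = a' \<and> b = b'" using \<open>a 0 = a' 0 \<and> b = b'\<close> by blast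
  qed
  show "hook_le k x x" for x by (auto simp: hook_le_def)
  show "hook_le k x z" if "hook_le k x y" "hook_le k y z" for x y z using that by (rule hook_le_trans)
  show "\<exists>y\<in>hook_states k n. Y = hook_columns k y \<and> hook_le k x y"
    if "x \<in> hook_states k n" "i \<in> {1..n}" "colstep i (hook_columns k x) Y" for x i Y
    using hook_colstep_move[OF assms(1), of "fst x" "snd x" n i Y] hook_move_le[of "fst x" "snd x" k n i] that assms(1)
    by auto
  show "\<exists>i\<in>{1..n}. \<exists>z\<in>hook_states k n. colstep i (hook_columns k x) (hook_columns k z) \<and> hook_le k z y"
    if xy: "x \<in> hook_states k n" "y \<in> hook_states k n" "hook_le k x y" "x \<noteq> y" for x y
  proof -
    obtain i z where z: "i \<in> {1..n}" "hook_move k i x z" "hook_le k z y"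
      using hook_le_first_move[OF assms(1), of "fst x" "snd x" n "fst y" "snd y"] xy by auto
    then show ?thesis
      using hook_move_colstep[OF assms(1), of "fst x" "snd x" n i z] hook_move_le[of "fst x" "snd x" k n i z]
        xy(1) assms(1) by auto
  qed
  show "\<exists>z\<in>hook_states k n. hook_le k x z \<and> hook_le k y z \<and>
      (\<forall>w\<in>hook_states k n. hook_le k x w \<and> hook_le k y w \<longrightarrow> hook_le k z w)"
    if "x \<in> hook_states k n" "y \<in> hook_states k n" for x y
    using hook_join[OF assms(1), of "fst x" "snd x" n "fst y" "snd y"] that by simp
qed

section \<open>A column next to a single box\<close>

text \<open>A state \<open>(c, d)\<close> is the tableau with first column \<open>c 0, \<dots>, c (m - 1)\<close> and the entry \<open>d\<close>
  to the right of \<open>c 0\<close>.\<close>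

definition box_states :: "nat \<Rightarrow> nat \<Rightarrow> ((nat \<Rightarrow> nat) \<times> nat) set" where
  "box_states m n = {(c, d). (\<forall>i j. i < j \<longrightarrow> j < m \<longrightarrow> c i < c j) \<and> (\<forall>j\<ge>m. c j = 0) \<and>
     (\<forall>j<m. c j \<le> Suc n) \<and> 1 \<le> c 0 \<and> c 0 \<le> d \<and> d \<le> Suc n}"

definition box_columns :: "nat \<Rightarrow> (nat \<Rightarrow> nat) \<times> nat \<Rightarrow> nat set list" where
  "box_columns m = (\<lambda>(c, d). [c ` {..<m}, {d}])"

text \<open>A column entry equal to \<open>d\<close> cannot move, so entries at most
  \<open>d\<close> never get past the single box. Conversely the box steps onto an entry of the
  column only if the entry just above in the column is smaller by one at that moment; the last
  condition is what remains of this in the final state.\<close>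

definition box_le :: "nat \<Rightarrow> (nat \<Rightarrow> nat) \<times> nat \<Rightarrow> (nat \<Rightarrow> nat) \<times> nat \<Rightarrow> bool" where
  "box_le m = (\<lambda>(c, d) (c', d'). (\<forall>j<m. c j \<le> c' j) \<and> d \<le> d' \<and> (\<forall>j<m. c j \<le> d \<longrightarrow> c' j \<le> d') \<and>
     (\<forall>j. Suc j < m \<longrightarrow> d < c (Suc j) \<longrightarrow> c' (Suc j) \<le> d' \<longrightarrow> c (Suc j) \<le> Suc (c' j)))"

definition box_move :: "nat \<Rightarrow> nat \<Rightarrow> (nat \<Rightarrow> nat) \<times> nat \<Rightarrow> (nat \<Rightarrow> nat) \<times> nat \<Rightarrow> bool" where
  "box_move m i = (\<lambda>(c, d) y.
     (\<exists>j<m. i = c j \<and> (Suc j < m \<longrightarrow> Suc (c j) < c (Suc j)) \<and> d \<noteq> c j \<and> y = (c(j := Suc (c j)), d)) \<or>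
     (i = d \<and> (Suc d \<in> c ` {..<m} \<longrightarrow> d \<in> c ` {..<m}) \<and> y = (c, Suc d)))"

lemma strict_mono_le:
  fixes c :: "nat \<Rightarrow> nat"
  assumes "\<And>i j. i < j \<Longrightarrow> j < m \<Longrightarrow> c i < c j" "i \<le> j" "j < m"
  shows "c i \<le> c j"
proof (cases "i = j")
  case False
  then have "i < j" using assms(2) by simp
  then show ?thesis using assms(1,3) by (simp add: less_imp_le)
qed simp

lemma raise_image:
  fixes c :: "nat \<Rightarrow> nat"
  assumes "\<And>i j. i < j \<Longrightarrow> j < m \<Longrightarrow> c i < c j" "j < m"
  shows "(c(j := Suc (c j))) ` {..<m} = raise (c j) (c ` {..<m})"
proof -
  have m: "{..<m} = insert j ({..<m} - {j})" using assms(2) by auto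
  have ne: "c j \<notin> c ` ({..<m} - {j})"
  proof
    assume "c j \<in> c ` ({..<m} - {j})"
    then obtain l where l: "l < m" "l \<noteq> j" "c j = c l" by auto
    consider "l < j" | "j < l" using l(2) nat_neq_iff by blast
    then show False using assms(1)[of l j] assms(1)[of j l] assms(2) l by cases simp_all
  qed
  have "(c(j := Suc (c j))) ` {..<m} = insert (Suc (c j)) (c ` ({..<m} - {j}))"
    by (subst m) auto
  moreover have "c ` {..<m} = insert (c j) (c ` ({..<m} - {j}))" by (subst m) (rule image_insert)
  then have "c ` {..<m} - {c j} = c ` ({..<m} - {j})" using ne by (metis Diff_insert_absorb)
  ultimately show ?thesis by (simp add: raise_def)
qed

lemma Suc_notin_image_iff:
  fixes c :: "nat \<Rightarrow> nat"
  assumes "\<And>i j. i < j \<Longrightarrow> j < m \<Longrightarrow> c i < c j" "j < m"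
  shows "Suc (c j) \<notin> c ` {..<m} \<longleftrightarrow> (Suc j < m \<longrightarrow> Suc (c j) < c (Suc j))"
proof
  assume n: "Suc (c j) \<notin> c ` {..<m}"
  show "Suc j < m \<longrightarrow> Suc (c j) < c (Suc j)"
  proof
    assume s: "Suc j < m"
    then have "c j < c (Suc j)" using assms(1) by simp
    moreover have "c (Suc j) \<noteq> Suc (c j)" using n s by (metis imageI lessThan_iff)
    ultimately show "Suc (c j) < c (Suc j)" by simp
  qed
next
  assume s: "Suc j < m \<longrightarrow> Suc (c j) < c (Suc j)"
  show "Suc (c j) \<notin> c ` {..<m}"
  proof
    assume "Suc (c j) \<in> c ` {..<m}"
    then obtain l where l: "l < m" "c l = Suc (c j)" by auto
    have "j < l"
    proof (rule ccontr)
      assume "\<not> j < l"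
      then have "c l \<le> c j" using strict_mono_le[of m c l j] assms by simp
      then show False using l by simp
    qed
    then have "c (Suc j) \<le> c l" using strict_mono_le[of m c "Suc j" l] assms(1) l by simp
    then show False using s \<open>j < l\<close> l by simp
  qed
qed

lemma colstep_pair:
  "colstep i [C, D] Y \<longleftrightarrow>
    (i \<in> C \<and> Suc i \<notin> C \<and> prefixes_nonpos (sig i) [D] \<and> Y = [raise i C, D]) \<or>
    (i \<in> D \<and> Suc i \<notin> D \<and> suffixes_nonneg (sig i) [C] \<and> Y = [C, raise i D])"
proof -
  have split: "[C, D] = A @ K # B \<longleftrightarrow> A = [] \<and> K = C \<and> B = [D] \<or> A = [C] \<and> K = D \<and> B = []" for A K B
    by (cases A) (auto simp: Cons_eq_append_conv append_eq_Cons_conv)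
  show ?thesis
    unfolding colstep_def split by (simp add: conj_disj_distribR ex_disj_distrib) blast
qed

lemma box_colstep_iff:
  assumes "(c, d) \<in> box_states m n"
  shows "colstep i (box_columns m (c, d)) Y \<longleftrightarrow> (\<exists>y. box_move m i (c, d) y \<and> Y = box_columns m y)"
proof -
  have st: "\<And>i j. i < j \<Longrightarrow> j < m \<Longrightarrow> c i < c j"
    using assms by (auto simp: box_states_def)
  have pre1: "prefixes_nonpos (sig i) [{d}] \<longleftrightarrow> d \<noteq> i"
    using prefixes_nonpos_snoc[of "sig i" "[]" "{d}"] by (auto simp: sig_singleton)
  have "colstep i (box_columns m (c, d)) Y \<longleftrightarrow>
      (i \<in> c ` {..<m} \<and> Suc i \<notin> c ` {..<m} \<and> d \<noteq> i \<and> Y = [raise i (c ` {..<m}), {d}]) \<or>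
      (i = d \<and> 0 \<le> sig i (c ` {..<m}) \<and> Y = [c ` {..<m}, raise i {d}])"
    unfolding box_columns_def prod.case colstep_pair pre1
    by (intro arg_cong2[of _ _ _ _ "(\<or>)"]) (auto simp: suffixes_nonneg_Cons)
  also have "\<dots> \<longleftrightarrow> (\<exists>y. box_move m i (c, d) y \<and> Y = box_columns m y)"
  proof
    assume "(i \<in> c ` {..<m} \<and> Suc i \<notin> c ` {..<m} \<and> d \<noteq> i \<and> Y = [raise i (c ` {..<m}), {d}]) \<or>
      (i = d \<and> 0 \<le> sig i (c ` {..<m}) \<and> Y = [c ` {..<m}, raise i {d}])"
    then show "\<exists>y. box_move m i (c, d) y \<and> Y = box_columns m y"
    proof
      assume a: "i \<in> c ` {..<m} \<and> Suc i \<notin> c ` {..<m} \<and> d \<noteq> i \<and> Y = [raise i (c ` {..<m}), {d}]"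
      then obtain j where j: "j < m" "i = c j" by auto
      have "box_move m i (c, d) (c(j := Suc (c j)), d)"
        using a j Suc_notin_image_iff[of m c j, OF st j(1)] by (auto simp: box_move_def)
      moreover have "Y = box_columns m (c(j := Suc (c j)), d)"
        using a j raise_image[of m c j, OF st j(1)] by (simp add: box_columns_def)
      ultimately show ?thesis by blast
    next
      assume a: "i = d \<and> 0 \<le> sig i (c ` {..<m}) \<and> Y = [c ` {..<m}, raise i {d}]"
      then have "box_move m i (c, d) (c, Suc d)" by (auto simp: box_move_def sig_def split: if_splits)
      moreover have "Y = box_columns m (c, Suc d)" using a by (simp add: box_columns_def raise_def)
      ultimately show ?thesis by blast
    qed
  next
    assume "\<exists>y. box_move m i (c, d) y \<and> Y = box_columns m y"
    then obtain y where y: "box_move m i (c, d) y" "Y = box_columns m y" by blast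
    consider (col) j where "j < m" "i = c j" "Suc j < m \<longrightarrow> Suc (c j) < c (Suc j)" "d \<noteq> c j" "y = (c(j := Suc (c j)), d)"
      | (box) "i = d" "Suc d \<in> c ` {..<m} \<longrightarrow> d \<in> c ` {..<m}" "y = (c, Suc d)"
      using y(1) by (auto simp: box_move_def)
    then show "(i \<in> c ` {..<m} \<and> Suc i \<notin> c ` {..<m} \<and> d \<noteq> i \<and> Y = [raise i (c ` {..<m}), {d}]) \<or>
      (i = d \<and> 0 \<le> sig i (c ` {..<m}) \<and> Y = [c ` {..<m}, raise i {d}])"
    proof cases
      case col
      then show ?thesis
        using y(2) Suc_notin_image_iff[of m c j, OF st col(1)] raise_image[of m c j, OF st col(1)] by (auto simp: box_columns_def)
    next
      case box
      then show ?thesis using y(2) by (auto simp: box_columns_def raise_def sig_def)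
    qed
  qed
  finally show ?thesis .
qed

lemma box_move_le:
  assumes "0 < m" "(c, d) \<in> box_states m n" "box_move m i (c, d) y" "i \<in> {1..n}"
  shows "y \<in> box_states m n \<and> box_le m (c, d) y"
proof -
  have st: "\<And>i j. i < j \<Longrightarrow> j < m \<Longrightarrow> c i < c j" "c 0 \<le> d" "d \<le> Suc n" "\<And>j. j < m \<Longrightarrow> c j \<le> Suc n"
    "\<And>j. m \<le> j \<Longrightarrow> c j = 0" "1 \<le> c 0"
    using assms(2) by (auto simp: box_states_def)
  consider (col) j where "j < m" "i = c j" "Suc j < m \<longrightarrow> Suc (c j) < c (Suc j)" "d \<noteq> c j" "y = (c(j := Suc (c j)), d)"
    | (box) "i = d" "Suc d \<in> c ` {..<m} \<longrightarrow> d \<in> c ` {..<m}" "y = (c, Suc d)"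
    using assms(3) by (auto simp: box_move_def)
  then show ?thesis
  proof cases
    case col
    have gt: "Suc (c j) < c l" if "j < l" "l < m" for l
      using strict_mono_le[of m c "Suc j" l] st(1) col(3) that by fastforce
    let ?c = "c(j := Suc (c j))"
    have "?c p < ?c q" if "p < q" "q < m" for p q
      using st(1)[OF that] gt[of q] that by (cases "q = j"; cases "p = j") auto
    moreover have "?c 0 \<le> d" using st(2) col(4) by (cases "j = 0") auto
    ultimately have "y \<in> box_states m n"
      using st col assms(4) by (auto simp: box_states_def)
    moreover have "box_le m (c, d) y"
      using col(4) by (auto simp: box_le_def col(5))
    ultimately show ?thesis by simp
  next
    case box
    have "c (Suc l) \<le> Suc (c l)" if "Suc l < m" "d < c (Suc l)" "c (Suc l) \<le> Suc d" for l
    proof -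
      have e: "c (Suc l) = Suc d" using that by simp
      then have "Suc d \<in> c ` {..<m}" using that(1) by (metis imageI lessThan_iff)
      then obtain p where p: "p < m" "c p = d" using box(2) by auto
      have "p \<le> l"
      proof (rule ccontr)
        assume "\<not> p \<le> l"
        then have "c (Suc l) \<le> c p" using strict_mono_le[of m c "Suc l" p] st(1) p by simp
        then show False using p e by simp
      qed
      then have "c p \<le> c l" using strict_mono_le[of m c p l] st(1) that(1) by simp
      then show ?thesis using p e by simp
    qed
    then show ?thesis using st assms(4) box by (auto simp: box_states_def box_le_def)
  qed
qed

text \<open>Priority of moves: entries that end above \<open>d'\<close>, the lowest in the column
  first; then, if the box must still pass the first entry above \<open>d\<close>, the box, or the
  entry before this one if the box is blocked; then the box in all other cases with
  \<open>d < d'\<close>; last the entries not exceeding \<open>d\<close>.\<close>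

lemma box_le_first_move:
  assumes "0 < m" "(c, d) \<in> box_states m n" "(c', d') \<in> box_states m n" "box_le m (c, d) (c', d')"
    "(c, d) \<noteq> (c', d')"
  shows "\<exists>i y. i \<in> {1..n} \<and> box_move m i (c, d) y \<and> box_le m y (c', d')"
proof -
  have st: "\<And>i j. i < j \<Longrightarrow> j < m \<Longrightarrow> c i < c j" "c 0 \<le> d" "\<And>j. m \<le> j \<Longrightarrow> c j = 0" "1 \<le> c 0"
    using assms(2) by (auto simp: box_states_def)
  have st': "\<And>i j. i < j \<Longrightarrow> j < m \<Longrightarrow> c' i < c' j" "c' 0 \<le> d'" "d' \<le> Suc n" "\<And>j. j < m \<Longrightarrow> c' j \<le> Suc n"
    "\<And>j. m \<le> j \<Longrightarrow> c' j = 0"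
    using assms(3) by (auto simp: box_states_def)
  have le: "\<And>j. j < m \<Longrightarrow> c j \<le> c' j" "d \<le> d'" "\<And>j. j < m \<Longrightarrow> c j \<le> d \<Longrightarrow> c' j \<le> d'"
    "\<And>j. Suc j < m \<Longrightarrow> d < c (Suc j) \<Longrightarrow> c' (Suc j) \<le> d' \<Longrightarrow> c (Suc j) \<le> Suc (c' j)"
    using assms(4) by (auto simp: box_le_def)
  have mono: "c i \<le> c j" "c' i \<le> c' j" if "i \<le> j" "j < m" for i j
    using strict_mono_le[of m c i j] strict_mono_le[of m c' i j] st(1) st'(1) that by auto
  have pos: "1 \<le> c j" if "j < m" for j using mono(1)[of 0 j] st(4) that by simp
  have col: ?thesis if "j < m" "Suc j < m \<Longrightarrow> Suc (c j) < c (Suc j)" "d \<noteq> c j" "c j < c' j"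
    "d < c j \<Longrightarrow> d' < c' j" for j
  proof (intro exI conjI)
    show "c j \<in> {1..n}" using pos[OF that(1)] st'(4)[OF that(1)] that(4) by simp
    show "box_move m (c j) (c, d) (c(j := Suc (c j)), d)" using that(1-3) by (auto simp: box_move_def)
    show "box_le m (c(j := Suc (c j)), d) (c', d')"
      using le that(3-5) by (auto simp: box_le_def split: if_splits)
  qed
  have box: ?thesis if "Suc d \<in> c ` {..<m} \<Longrightarrow> d \<in> c ` {..<m}" "d < d'" "\<And>j. j < m \<Longrightarrow> c j = Suc d \<Longrightarrow> c' j \<le> d'"
  proof (intro exI conjI)
    show "d \<in> {1..n}" using st(2,4) st'(3) that(2) by simp
    show "box_move m d (c, d) (c, Suc d)" using that(1) by (auto simp: box_move_def)
    show "box_le m (c, Suc d) (c', d')" using le that(2,3) by (auto simp: box_le_def le_Suc_eq)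
  qed
  show ?thesis
  proof (cases "\<exists>j<m. d' < c' j \<and> c j < c' j")
    case True
    then obtain j where j: "d' < c' j \<and> c j < c' j" "j < m" "\<And>l. j < l \<Longrightarrow> l < m \<Longrightarrow> \<not> (d' < c' l \<and> c l < c' l)"
      using exists_last[of "\<lambda>j. d' < c' j \<and> c j < c' j" _ m] by blast
    show ?thesis
    proof (rule col[of j])
      assume s: "Suc j < m"
      have "c' j < c' (Suc j)" using st'(1) s by simp
      moreover have "c' (Suc j) \<le> c (Suc j)" using j(1) j(3)[of "Suc j"] s calculation by auto
      ultimately show "Suc (c j) < c (Suc j)" using j(1) by simp
    qed (use j le(3)[of j] in auto)
  next
    case A: False
    then have eq: "c j = c' j" if "j < m" "d' < c' j" for j using le(1)[of j] that by force
    show ?thesis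
    proof (cases "\<exists>j<m. d < c j \<and> c' j \<le> d'")
      case True
      then obtain j1 where j1: "j1 < m" "d < c j1" "c' j1 \<le> d'" by blast
      define j where "j = (LEAST j. d < c j)"
      have j: "d < c j" "j \<le> j1" unfolding j_def using j1(2) by (rule LeastI, rule Least_le)
      have small: "c l \<le> d" if "l < j" for l using not_less_Least[of l] that unfolding j_def by force
      obtain p where p: "j = Suc p" using j(1) st(2) by (cases j) auto
      have jm: "j < m" using j(2) j1(1) by simp
      have c'j: "c' j \<le> d'" using mono(2)[OF j(2) j1(1)] j1(3) by simp
      then have cp: "c j \<le> Suc (c' p)" using le(4)[of p] p jm j(1) by simp
      have cd': "c j \<le> d'" using le(1)[OF jm] c'j by simp
      have cpd: "c p \<le> d" using small p by simp
      have between: "l = j" if "l < m" "c l = Suc d" for l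
      proof (rule ccontr)
        assume "l \<noteq> j"
        then consider "l < j" | "j < l" using nat_neq_iff by blast
        then show False
        proof cases
          case 1
          then show ?thesis using small[of l] that by simp
        next
          case 2
          then show ?thesis using st(1)[of j l] that j(1) by simp
        qed
      qed
      show ?thesis
      proof (cases "Suc d < c j \<or> c p = d")
        case True
        show ?thesis
        proof (rule box)
          assume "Suc d \<in> c ` {..<m}"
          then have "c j = Suc d" using between by force
          then have "c p = d" using True by simp
          then show "d \<in> c ` {..<m}" using p jm by (metis Suc_lessD imageI lessThan_iff)
        qed (use cd' j(1) between c'j in auto)
      next
        case False
        then have "c j = Suc d" "c p < d" using j(1) cpd by auto
        then show ?thesis using cp p jm by (intro col[of p]) auto
      qed
    next
      case B: False
      then have big: "d' < c' j" if "j < m" "d < c j" for j using that by force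
      show ?thesis
      proof (cases "d < d'")
        case True
        have "c j \<noteq> Suc d" if "j < m" for j
          using big[OF that] eq[OF that] True by force
        then have "Suc d \<notin> c ` {..<m}" by (metis imageE lessThan_iff)
        then show ?thesis using True \<open>\<And>j. j < m \<Longrightarrow> c j \<noteq> Suc d\<close> by (intro box) simp_all
      next
        case False
        then have dd: "d' = d" using le(2) by simp
        then have "c \<noteq> c'" using assms(5) by simp
        then obtain j1 where "c j1 \<noteq> c' j1" by blast
        moreover from this have "j1 < m" using st(3) st'(5) by (metis leI)
        ultimately have "c j1 < c' j1" "j1 < m" using le(1)[of j1] by auto
        then obtain j where j: "c j < c' j" "j < m" "\<And>l. j < l \<Longrightarrow> l < m \<Longrightarrow> \<not> c l < c' l"
          using exists_last[of "\<lambda>j. c j < c' j" j1 m] by blast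
        have "c j \<le> d" using big[OF j(2)] eq[OF j(2)] j(1) by force
        moreover from this have "c' j \<le> d" using le(3)[OF j(2)] dd by simp
        ultimately show ?thesis
        proof (intro col[of j])
          assume s: "Suc j < m"
          then show "Suc (c j) < c (Suc j)" using j(3)[of "Suc j"] st'(1)[of j "Suc j"] j(1) by simp
        qed (use j in auto)
      qed
    qed
  qed
qed

text \<open>The first column of the least state above \<open>(c1, d1)\<close> whose entries \<open>j\<close> with \<open>c2 j \<le> d2\<close> do
  not exceed the entry in the second column.\<close>

definition box_lift :: "nat \<Rightarrow> (nat \<Rightarrow> nat) \<Rightarrow> nat \<Rightarrow> (nat \<Rightarrow> nat) \<Rightarrow> nat \<Rightarrow> nat \<Rightarrow> nat" where
  "box_lift m c1 d1 c2 d2 j =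
     (if Suc j < m \<and> d1 < c1 (Suc j) \<and> c2 (Suc j) \<le> d2 then c1 (Suc j) - 1 else c1 j)"

text \<open>An index is \<open>low\<close> if its entry is at most the box in one of the states;
  then this must hold in every common upper bound. The first column is the entrywise maximum of the
  lifts, and the box is the least value compatible with the low indices.\<close>

lemma box_join:
  assumes "0 < m" "(c1, d1) \<in> box_states m n" "(c2, d2) \<in> box_states m n"
  shows "\<exists>z\<in>box_states m n. box_le m (c1, d1) z \<and> box_le m (c2, d2) z \<and>
    (\<forall>w\<in>box_states m n. box_le m (c1, d1) w \<and> box_le m (c2, d2) w \<longrightarrow> box_le m z w)"
proof -
  have st1: "\<And>i j. i < j \<Longrightarrow> j < m \<Longrightarrow> c1 i < c1 j" "c1 0 \<le> d1" "d1 \<le> Suc n" "1 \<le> c1 0" "\<And>j. j < m \<Longrightarrow> c1 j \<le> Suc n"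
    using assms(2) by (auto simp: box_states_def)
  have st2: "\<And>i j. i < j \<Longrightarrow> j < m \<Longrightarrow> c2 i < c2 j" "c2 0 \<le> d2" "d2 \<le> Suc n" "1 \<le> c2 0" "\<And>j. j < m \<Longrightarrow> c2 j \<le> Suc n"
    using assms(3) by (auto simp: box_states_def)
  have mono: "c1 i \<le> c1 j" "c2 i \<le> c2 j" if "i \<le> j" "j < m" for i j
    using strict_mono_le[of m c1 i j] strict_mono_le[of m c2 i j] st1(1) st2(1) that by auto
  define g1 where "g1 = box_lift m c1 d1 c2 d2"
  define g2 where "g2 = box_lift m c2 d2 c1 d1"
  have lift: "c1 j \<le> box_lift m c1 d1 c2 d2 j" "Suc j < m \<Longrightarrow> box_lift m c1 d1 c2 d2 j < c1 (Suc j)"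
    "box_lift m c1 d1 c2 d2 j \<le> Suc n"
    if "j < m" "\<And>i j. i < j \<Longrightarrow> j < m \<Longrightarrow> c1 i < c1 j" "\<And>j. j < m \<Longrightarrow> c1 j \<le> Suc n" for c1 c2 d1 d2 j
    using that(2)[of j "Suc j"] that(1) that(3)[of j] that(3)[of "Suc j"] by (auto simp: box_lift_def)
  have g: "c1 j \<le> g1 j" "c2 j \<le> g2 j" "g1 j \<le> Suc n" "g2 j \<le> Suc n" if "j < m" for j
    unfolding g1_def g2_def using lift that st1(1,5) st2(1,5) by blast+
  have gS: "g1 j < c1 (Suc j)" "g2 j < c2 (Suc j)" if "Suc j < m" for j
    unfolding g1_def g2_def using lift(2)[of j c1] lift(2)[of j c2] that st1(1,5) st2(1,5) by simp_all
  define low where "low j \<longleftrightarrow> c1 j \<le> d1 \<or> c2 j \<le> d2" for j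
  define zc where "zc j = (if j < m then max (g1 j) (g2 j) else 0)" for j
  \<comment> \<open>These are the lower bounds for the box. Using \<open>c1\<close> and
    \<open>c2\<close> instead of the lifts suffices, because a lift at \<open>j\<close> differs from
    the original entry only if \<open>j + 1\<close> is low, and then it stays below the entry at
    \<open>j + 1\<close>.\<close>
  define L where "L = {d1, d2} \<union> (\<lambda>j. max (c1 j) (c2 j)) ` {j. j < m \<and> low j}"
  define zd where "zd = Max L"
  have finL: "finite L" "L \<noteq> {}" by (auto simp: L_def)
  have zd: "d1 \<le> zd" "d2 \<le> zd" "\<And>j. j < m \<Longrightarrow> low j \<Longrightarrow> c1 j \<le> zd \<and> c2 j \<le> zd"
  proof -
    have *: "x \<le> zd" if "x \<in> L" for x unfolding zd_def using finL(1) that by (rule Max_ge)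
    show "d1 \<le> zd" "d2 \<le> zd" using * by (simp_all add: L_def)
    fix j assume "j < m" "low j"
    then have "max (c1 j) (c2 j) \<in> L" by (auto simp: L_def)
    then show "c1 j \<le> zd \<and> c2 j \<le> zd" using * by fastforce
  qed
  have zd_le: "zd \<le> d" if "d1 \<le> d" "d2 \<le> d" "\<And>j. j < m \<Longrightarrow> low j \<Longrightarrow> c1 j \<le> d \<and> c2 j \<le> d" for d
    unfolding zd_def using finL that by (subst Max_le_iff) (auto simp: L_def)
  have zd_less: "zd < d" if "d1 < d" "d2 < d" "\<And>j. j < m \<Longrightarrow> low j \<Longrightarrow> c1 j < d \<and> c2 j < d" for d
    unfolding zd_def using finL that by (subst Max_less_iff) (auto simp: L_def)
  have zc_ge: "c1 j \<le> zc j" "c2 j \<le> zc j" if "j < m" for j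
    using g[OF that] that by (simp_all add: zc_def le_max_iff_disj)
  have low_Suc: "low l" if "low j" "l \<le> j" "j < m" for l j
    using that mono[of l j] by (auto simp: low_def)
  have small: "zc j \<le> zd \<longleftrightarrow> low j" if "j < m" for j
  proof
    assume l: "low j"
    have "g1 j \<le> zd" "g2 j \<le> zd"
      using zd(3)[OF that l] zd(3)[of "Suc j"] by (auto simp: g1_def g2_def box_lift_def low_def)
    then show "zc j \<le> zd" using that by (simp add: zc_def)
  next
    assume z: "zc j \<le> zd"
    show "low j"
    proof (rule ccontr)
      assume nl: "\<not> low j"
      have "zd < zc j"
      proof (rule zd_less)
        show "d1 < zc j" "d2 < zc j" using nl zc_ge[OF that] by (auto simp: low_def)
        fix l assume l: "l < m" "low l"
        have "l < j" using low_Suc[of l j] nl l by (meson leI)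
        then show "c1 l < zc j \<and> c2 l < zc j"
          using st1(1)[of l j] st2(1)[of l j] that zc_ge[OF that] by simp
      qed
      then show False using z by simp
    qed
  qed
  have low0: "low 0" using st1(2) by (simp add: low_def)
  have "(zc, zd) \<in> box_states m n"
    unfolding box_states_def
  proof (clarify, intro conjI allI impI)
    fix i j assume ij: "i < j" "j < m"
    then have "g1 i < c1 (Suc i)" "g2 i < c2 (Suc i)" using gS by simp_all
    moreover have "c1 (Suc i) \<le> c1 j" "c2 (Suc i) \<le> c2 j" using mono[of "Suc i" j] ij by simp_all
    ultimately have "g1 i < zc j" "g2 i < zc j" using zc_ge[OF ij(2)] by simp_all
    then show "zc i < zc j" using ij by (subst zc_def) simp
  next
    show "1 \<le> zc 0" using zc_ge(1)[of 0] st1(4) assms(1) by simp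
    show "zc 0 \<le> zd" using small[of 0] low0 assms(1) by simp
    show "zd \<le> Suc n" using st1(3,5) st2(3,5) by (intro zd_le) auto
  qed (use g in \<open>simp_all add: zc_def\<close>)
  moreover have "box_le m (c1, d1) (zc, zd)"
  proof -
    have "c1 (Suc j) \<le> Suc (zc j)" if "Suc j < m" "d1 < c1 (Suc j)" "zc (Suc j) \<le> zd" for j
    proof -
      have "c2 (Suc j) \<le> d2" using small[OF that(1)] that(2,3) by (auto simp: low_def)
      then have "c1 (Suc j) \<le> Suc (g1 j)" using that by (simp add: g1_def box_lift_def)
      then show ?thesis using that(1) by (simp add: zc_def)
    qed
    then show ?thesis using zc_ge zd(1) small by (simp add: box_le_def low_def)
  qed
  moreover have "box_le m (c2, d2) (zc, zd)"
  proof -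
    have "c2 (Suc j) \<le> Suc (zc j)" if "Suc j < m" "d2 < c2 (Suc j)" "zc (Suc j) \<le> zd" for j
    proof -
      have "c1 (Suc j) \<le> d1" using small[OF that(1)] that(2,3) by (auto simp: low_def)
      then have "c2 (Suc j) \<le> Suc (g2 j)" using that by (simp add: g2_def box_lift_def)
      then show ?thesis using that(1) by (simp add: zc_def)
    qed
    then show ?thesis using zc_ge zd(2) small by (simp add: box_le_def low_def)
  qed
  moreover have "box_le m (zc, zd) (c, d)"
    if U1: "box_le m (c1, d1) (c, d)" and U2: "box_le m (c2, d2) (c, d)" for c d
  proof -
    have u1: "\<And>j. j < m \<Longrightarrow> c1 j \<le> c j" "d1 \<le> d" "\<And>j. j < m \<Longrightarrow> c1 j \<le> d1 \<Longrightarrow> c j \<le> d"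
      "\<And>j. Suc j < m \<Longrightarrow> d1 < c1 (Suc j) \<Longrightarrow> c (Suc j) \<le> d \<Longrightarrow> c1 (Suc j) \<le> Suc (c j)"
      using U1 by (auto simp: box_le_def)
    have u2: "\<And>j. j < m \<Longrightarrow> c2 j \<le> c j" "d2 \<le> d" "\<And>j. j < m \<Longrightarrow> c2 j \<le> d2 \<Longrightarrow> c j \<le> d"
      "\<And>j. Suc j < m \<Longrightarrow> d2 < c2 (Suc j) \<Longrightarrow> c (Suc j) \<le> d \<Longrightarrow> c2 (Suc j) \<le> Suc (c j)"
      using U2 by (auto simp: box_le_def)
    have lowd: "c j \<le> d" if "j < m" "low j" for j
      using u1(3) u2(3) that by (auto simp: low_def)
    have "g1 j \<le> c j" if "j < m" for j
      using u1(1)[OF that] u1(4)[of j] u2(3)[of "Suc j"] by (auto simp: g1_def box_lift_def)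
    moreover have "g2 j \<le> c j" if "j < m" for j
      using u2(1)[OF that] u2(4)[of j] u1(3)[of "Suc j"] by (auto simp: g2_def box_lift_def)
    ultimately have 1: "zc j \<le> c j" if "j < m" for j using that by (simp add: zc_def)
    have 2: "zd \<le> d"
    proof (rule zd_le)
      fix j assume "j < m" "low j"
      then show "c1 j \<le> d \<and> c2 j \<le> d" using lowd[of j] u1(1)[of j] u2(1)[of j] by simp
    qed (use u1(2) u2(2) in auto)
    have 3: "c j \<le> d" if "j < m" "zc j \<le> zd" for j using small lowd that by simp
    have 4: "zc (Suc j) \<le> Suc (c j)" if "Suc j < m" "zd < zc (Suc j)" "c (Suc j) \<le> d" for j
    proof -
      have nl: "d1 < c1 (Suc j)" "d2 < c2 (Suc j)" using small[OF that(1)] that(2) by (auto simp: low_def)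
      then have "\<not> c1 (Suc (Suc j)) \<le> d1" "\<not> c2 (Suc (Suc j)) \<le> d2" if "Suc (Suc j) < m"
        using mono[of "Suc j" "Suc (Suc j)"] that by simp_all
      then have "g1 (Suc j) = c1 (Suc j)" "g2 (Suc j) = c2 (Suc j)"
        by (auto simp: g1_def g2_def box_lift_def)
      then show ?thesis using u1(4)[OF that(1) nl(1) that(3)] u2(4)[OF that(1) nl(2) that(3)] that(1)
        by (simp add: zc_def)
    qed
    show ?thesis using 1 2 3 4 by (simp add: box_le_def)
  qed
  ultimately show ?thesis by (intro bexI[of _ "(zc, zd)"]) auto
qed

lemma box_le_trans: "box_le m x y \<Longrightarrow> box_le m y z \<Longrightarrow> box_le m x z"
  unfolding box_le_def
proof (clarsimp, intro conjI allI impI)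
  fix c d c1 d1 c2 d2 j
  assume 1: "\<forall>j<m. c j \<le> c1 j" "d \<le> d1" "\<forall>j<m. c j \<le> d \<longrightarrow> c1 j \<le> d1"
    "\<forall>j. Suc j < m \<longrightarrow> d < c (Suc j) \<longrightarrow> c1 (Suc j) \<le> d1 \<longrightarrow> c (Suc j) \<le> Suc (c1 j)"
    and 2: "\<forall>j<m. c1 j \<le> c2 j" "d1 \<le> d2" "\<forall>j<m. c1 j \<le> d1 \<longrightarrow> c2 j \<le> d2"
    "\<forall>j. Suc j < m \<longrightarrow> d1 < c1 (Suc j) \<longrightarrow> c2 (Suc j) \<le> d2 \<longrightarrow> c1 (Suc j) \<le> Suc (c2 j)"
    and j: "Suc j < m" "d < c (Suc j)" "c2 (Suc j) \<le> d2"
  show "c (Suc j) \<le> Suc (c2 j)"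
  proof (cases "c1 (Suc j) \<le> d1")
    case True
    then have "c (Suc j) \<le> Suc (c1 j)" using 1(4) j by blast
    moreover have "c1 j \<le> c2 j" using 2(1) j(1) by simp
    ultimately show ?thesis by simp
  next
    case False
    then have "c1 (Suc j) \<le> Suc (c2 j)" using 2(4) j by simp
    moreover have "c (Suc j) \<le> c1 (Suc j)" using 1(1) j(1) by simp
    ultimately show ?thesis by simp
  qed
qed (meson order_trans le_trans)+

lemma box_columns_inj: "inj_on (box_columns m) (box_states m n)"
proof (rule inj_onI, clarify)
  fix c d c' d' assume st: "(c, d) \<in> box_states m n" "(c', d') \<in> box_states m n"
    and e: "box_columns m (c, d) = box_columns m (c', d')"
  have sl: "sorted_list_of_set (c ` {..<m}) = map c [0..<m]" if "(c, d) \<in> box_states m n" for c d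
  proof (rule sorted_distinct_set_unique)
    have "sorted_wrt (<) (map c [0..<m])"
      using that by (auto simp: sorted_wrt_iff_nth_less box_states_def)
    then show "sorted (map c [0..<m])" "distinct (map c [0..<m])" by (simp_all add: strict_sorted_iff)
  qed auto
  have "c ` {..<m} = c' ` {..<m}" using e by (simp add: box_columns_def)
  from arg_cong[OF this, of sorted_list_of_set] have "map c [0..<m] = map c' [0..<m]"
    by (simp only: sl[OF st(1)] sl[OF st(2)])
  then have "\<forall>j\<in>set [0..<m]. c j = c' j" by (simp only: map_eq_conv)
  then have "c j = c' j" if "j < m" for j using that by auto
  moreover have "c j = c' j" if "m \<le> j" for j using st that by (simp add: box_states_def)
  ultimately have "c j = c' j" for j by (cases "j < m") simp_all
  then have "c = c'" by (rule ext)
  moreover have "d = d'" using e by (simp add: box_columns_def)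
  ultimately show "c = c' \<and> d = d'" by simp
qed

lemma column_lattice_box:
  assumes "0 < m" "m \<le> Suc n"
  shows "column_lattice [m, 1] n"
proof (rule column_lattice_model[where S = "box_states m n" and emb = "box_columns m" and R = "box_le m"
      and b = "(\<lambda>j. if j < m then Suc j else 0, 1)"])
  show "sorted_wrt (\<ge>) [m, 1]" "\<forall>h\<in>set [m, 1]. h \<le> Suc n" using assms by auto
  show "(\<lambda>j. if j < m then Suc j else 0, 1) \<in> box_states m n" using assms by (auto simp: box_states_def)
  have "(\<lambda>j. if j < m then Suc j else 0) ` {..<m} = {1..m}"
  proof -
    have "(\<lambda>j. if j < m then Suc j else 0) ` {..<m} = Suc ` {..<m}" by (rule image_cong) simp_all
    also have "\<dots> = {1..m}" by (simp add: lessThan_atLeast0 image_Suc_atLeastLessThan atLeastLessThanSuc_atLeastAtMost)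
    finally show ?thesis .
  qed
  then show "box_columns m (\<lambda>j. if j < m then Suc j else 0, 1) = highest [m, 1]"
    by (simp add: box_columns_def highest_def)
  show "box_le m (\<lambda>j. if j < m then Suc j else 0, 1) x" if "x \<in> box_states m n" for x
  proof -
    obtain c d where x: "x = (c, d)" by fastforce
    have st: "\<And>i j. i < j \<Longrightarrow> j < m \<Longrightarrow> c i < c j" "1 \<le> c 0" "c 0 \<le> d" using that x by (auto simp: box_states_def)
    have "Suc j \<le> c j" if "j < m" for j
      using that
    proof (induction j)
      case (Suc j)
      then show ?case using st(1)[of j "Suc j"] by simp
    qed (use st in simp)
    then show ?thesis using st by (auto simp: x box_le_def)
  qed
  show "inj_on (box_columns m) (box_states m n)" by (rule box_columns_inj)
  show "box_le m x x" for x by (auto simp: box_le_def)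
  show "box_le m x z" if "box_le m x y" "box_le m y z" for x y z using that by (rule box_le_trans)
  show "\<exists>y\<in>box_states m n. Y = box_columns m y \<and> box_le m x y"
    if "x \<in> box_states m n" "i \<in> {1..n}" "colstep i (box_columns m x) Y" for x i Y
    using box_colstep_iff[of "fst x" "snd x" m n i Y] box_move_le[OF assms(1), of "fst x" "snd x" n i] that by auto
  show "\<exists>i\<in>{1..n}. \<exists>z\<in>box_states m n. colstep i (box_columns m x) (box_columns m z) \<and> box_le m z y"
    if xy: "x \<in> box_states m n" "y \<in> box_states m n" "box_le m x y" "x \<noteq> y" for x y
  proof -
    obtain i z where z: "i \<in> {1..n}" "box_move m i x z" "box_le m z y"
      using box_le_first_move[OF assms(1), of "fst x" "snd x" n "fst y" "snd y"] xy by auto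
    obtain c d where x: "x = (c, d)" by fastforce
    have "colstep i (box_columns m x) (box_columns m z)"
      using box_colstep_iff[of c d m n i "box_columns m z"] xy(1) z(2) unfolding x by blast
    moreover have "z \<in> box_states m n" using box_move_le[OF assms(1), of c d n i z] xy(1) z x by blast
    ultimately show ?thesis using z by blast
  qed
  show "\<exists>z\<in>box_states m n. box_le m x z \<and> box_le m y z \<and>
      (\<forall>w\<in>box_states m n. box_le m x w \<and> box_le m y w \<longrightarrow> box_le m z w)"
    if "x \<in> box_states m n" "y \<in> box_states m n" for x y
    using box_join[OF assms(1), of "fst x" "snd x" n "fst y" "snd y"] that by simp
qed

section \<open>Rank two\<close>

text \<open>Prepending nonpositive weights can only decrease the sum, so the total is the worst
  suffix that begins in \<open>X\<close>.\<close>

lemma suffixes_nonneg_append_nonpos: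
  assumes "\<And>x. x \<in> set X \<Longrightarrow> f x \<le> 0" "suffixes_nonneg f Y" "0 \<le> wsum f X + wsum f Y"
  shows "suffixes_nonneg f (X @ Y)"
  using assms
proof (induction X)
  case (Cons x X)
  have "f x \<le> 0" using Cons.prems(1) by simp
  then have "0 \<le> wsum f X + wsum f Y" using Cons.prems(3) by simp
  then have "suffixes_nonneg f (X @ Y)" using Cons.prems(1,2) by (intro Cons.IH) auto
  then show ?case using Cons.prems(3) by (simp add: suffixes_nonneg_Cons)
qed simp

lemma prefixes_nonpos_append_nonneg:
  assumes "\<And>x. x \<in> set Y \<Longrightarrow> 0 \<le> f x" "prefixes_nonpos f X" "wsum f X + wsum f Y \<le> 0"
  shows "prefixes_nonpos f (X @ Y)"
  using assms
proof (induction Y rule: rev_induct)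
  case (snoc y Y)
  have "0 \<le> f y" using snoc.prems(1) by simp
  then have "wsum f X + wsum f Y \<le> 0" using snoc.prems(3) by simp
  then have "prefixes_nonpos f (X @ Y)" using snoc.prems(1,2) by (intro snoc.IH) auto
  then show ?case using snoc.prems(3) prefixes_nonpos_snoc[of f "X @ Y" y] by simp
qed simp

text \<open>For \<open>n = 2\<close> a list of columns of heights 2 and 1 is determined by six
  multiplicities. Since \<open>{2, 3}\<close> does not dominate \<open>{1}\<close>, in a
  semistandard list \<open>c\<close> or \<open>d\<close> is 0.\<close>

definition blocks :: "nat \<Rightarrow> nat \<Rightarrow> nat \<Rightarrow> nat \<Rightarrow> nat \<Rightarrow> nat \<Rightarrow> nat set list" where
  "blocks a b c d e f = replicate a {1, 2} @ replicate b {1, 3} @ replicate c {2, 3} @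
     replicate d {1} @ replicate e {2} @ replicate f {3}"

lemma sig_small:
  "sig (Suc 0) {Suc 0, 2} = 0" "sig (Suc 0) {Suc 0, 3} = 1" "sig (Suc 0) {2, 3} = -1"
  "sig (Suc 0) {Suc 0} = 1" "sig (Suc 0) {2} = -1" "sig (Suc 0) {3} = 0"
  "sig 2 {Suc 0, 2} = 1" "sig 2 {Suc 0, 3} = -1" "sig 2 {2, 3} = 0"
  "sig 2 {Suc 0} = 0" "sig 2 {2} = 1" "sig 2 {3} = -1"
  by (simp_all add: sig_def)

lemma raise_small:
  "raise 1 {1, 3} = {2, 3}" "raise 1 {1} = {2}" "raise 2 {2} = {3}" "raise 2 {1, 2} = {1, 3}"
  by (auto simp: raise_def)

lemma blocks_step_1:
  "colstep 1 (blocks a (Suc b) c 0 e f) (blocks a b (Suc c) 0 e f)"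
  "colstep 1 (blocks a b 0 (Suc d) e f) (blocks a b 0 d (Suc e) f)"
proof -
  have "colstep 1 ((replicate a {1, 2} @ replicate b {1, 3}) @ {1, 3} # (replicate c {2, 3} @ replicate e {2} @ replicate f {3}))
     ((replicate a {1, 2} @ replicate b {1, 3}) @ raise 1 {1, 3} # (replicate c {2, 3} @ replicate e {2} @ replicate f {3}))"
    by (intro colstepI suffixes_nonnegI prefixes_nonposI) (auto simp: sig_small)
  then show "colstep 1 (blocks a (Suc b) c 0 e f) (blocks a b (Suc c) 0 e f)"
    by (simp add: blocks_def raise_small[simplified] replicate_append_same[symmetric] del: replicate_append_same)
      (simp add: replicate_app_Cons_same)
  have "colstep 1 ((replicate a {1, 2} @ replicate b {1, 3} @ replicate d {1}) @ {1} # (replicate e {2} @ replicate f {3}))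
     ((replicate a {1, 2} @ replicate b {1, 3} @ replicate d {1}) @ raise 1 {1} # (replicate e {2} @ replicate f {3}))"
    by (intro colstepI suffixes_nonnegI prefixes_nonposI) (auto simp: sig_small)
  then show "colstep 1 (blocks a b 0 (Suc d) e f) (blocks a b 0 d (Suc e) f)"
    by (simp add: blocks_def raise_small[simplified] replicate_app_Cons_same)
qed

text \<open>The \<open>b\<close> columns \<open>{1, 3}\<close> cancel \<open>b\<close> of the
  columns \<open>{2}\<close>. If more than \<open>b\<close> of the latter are present, the prefix
  sums attain their maximum first at the last \<open>{2}\<close>; otherwise they attain it at the
  last \<open>{1, 2}\<close>, if there is one.\<close>

lemma blocks_step_2:
  assumes "b \<le> e"
  shows "colstep 2 (blocks a b c d (Suc e) f) (blocks a b c d e (Suc f))"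
proof -
  have s: "suffixes_nonneg (sig 2) (replicate a {1, 2} @ (replicate b {1, 3} @ replicate c {2, 3} @ replicate d {1}) @ replicate e {2})"
    using assms
    by (intro suffixes_nonneg_append[of _ "replicate a {1, 2}"] suffixes_nonneg_append_nonpos)
      (auto intro!: suffixes_nonnegI simp: sig_small sum_list_replicate)
  have "colstep 2 ((replicate a {1, 2} @ (replicate b {1, 3} @ replicate c {2, 3} @ replicate d {1}) @ replicate e {2}) @ {2} # replicate f {3})
     ((replicate a {1, 2} @ (replicate b {1, 3} @ replicate c {2, 3} @ replicate d {1}) @ replicate e {2}) @ raise 2 {2} # replicate f {3})"
    by (intro colstepI s prefixes_nonposI) (auto simp: sig_small)
  then show ?thesis
    by (simp add: blocks_def raise_small replicate_app_Cons_same)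
qed

lemma blocks_tail_prefixes:
  assumes "e \<le> b"
  shows "prefixes_nonpos (sig 2) (replicate b {1, 3} @ replicate c {2, 3} @ replicate d {1} @ replicate e {2} @ replicate f {3})"
proof -
  have "prefixes_nonpos (sig 2) ((replicate b {1, 3} @ replicate c {2, 3} @ replicate d {1}) @ replicate e {2})"
    using assms by (intro prefixes_nonpos_append_nonneg) (auto intro!: prefixes_nonposI simp: sig_small sum_list_replicate)
  then have "prefixes_nonpos (sig 2) (((replicate b {1, 3} @ replicate c {2, 3} @ replicate d {1}) @ replicate e {2}) @ replicate f {3})"
    by (rule prefixes_nonpos_append) (auto intro!: prefixes_nonposI simp: sig_small)
  then show ?thesis by simp
qed

lemma blocks_step_2':
  assumes "e \<le> b"
  shows "colstep 2 (blocks (Suc a) b c d e f) (blocks a (Suc b) c d e f)"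
proof -
  have "colstep 2 (replicate a {1, 2} @ {1, 2} # (replicate b {1, 3} @ replicate c {2, 3} @ replicate d {1} @ replicate e {2} @ replicate f {3}))
     (replicate a {1, 2} @ raise 2 {1, 2} # (replicate b {1, 3} @ replicate c {2, 3} @ replicate d {1} @ replicate e {2} @ replicate f {3}))"
    by (intro colstepI blocks_tail_prefixes assms suffixes_nonnegI) (auto simp: sig_small)
  then show ?thesis
    by (simp add: blocks_def raise_small[simplified] replicate_app_Cons_same)
qed

lemma blocks_no_step:
  "\<not> colstep 1 (blocks a 0 c 0 e f) Y"
  "e \<le> b \<Longrightarrow> \<not> colstep 2 (blocks 0 b c d e f) Y"
proof -
  have "prefixes_nonpos (sig 1) (blocks a 0 c 0 e f)"
    by (intro prefixes_nonposI) (auto simp: blocks_def sig_small)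
  then show "\<not> colstep 1 (blocks a 0 c 0 e f) Y" using colstep_not_prefixes_nonpos by blast
  show "\<not> colstep 2 (blocks 0 b c d e f) Y" if "e \<le> b"
    using blocks_tail_prefixes[OF that, of c d f] colstep_not_prefixes_nonpos[of 2 "blocks 0 b c d e f" Y]
    by (auto simp: blocks_def)
qed

lemma blocks_inj:
  assumes "blocks a b c d e f = blocks a' b' c' d' e' f'"
  shows "a = a' \<and> b = b' \<and> c = c' \<and> d = d' \<and> e = e' \<and> f = f'"
proof -
  have n: "length (filter ((=) K) (blocks a b c d e f)) = length (filter ((=) K) (blocks a' b' c' d' e' f'))" for K
    using assms by simp
  have ne: "{1, 2} \<noteq> {1, 3::nat}" "{1, 2} \<noteq> {2, 3::nat}" "{1, 3} \<noteq> {2, 3::nat}"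
    "{1, 2} \<noteq> {1::nat}" "{1, 2} \<noteq> {2::nat}" "{1, 2} \<noteq> {3::nat}"
    "{1, 3} \<noteq> {1::nat}" "{1, 3} \<noteq> {2::nat}" "{1, 3} \<noteq> {3::nat}"
    "{2, 3} \<noteq> {1::nat}" "{2, 3} \<noteq> {2::nat}" "{2, 3} \<noteq> {3::nat}"
    by (auto simp: doubleton_eq_iff)
  have d: "length (filter ((=) K) (blocks a b c d e f)) =
      (if K = {1, 2} then a else 0) + (if K = {1, 3} then b else 0) + (if K = {2, 3} then c else 0) +
      (if K = {1} then d else 0) + (if K = {2} then e else 0) + (if K = {3} then f else 0)" for K a b c d e f
    by (simp add: blocks_def filter_replicate)
  note ne' = ne ne[symmetric]
  show ?thesis
    using n[of "{1, 2}"] n[of "{1, 3}"] n[of "{2, 3}"] n[of "{1}"] n[of "{2}"] n[of "{3}"]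
    unfolding d by (simp add: ne'[simplified])
qed

text \<open>The state \<open>(p, q, r)\<close> is the Gelfand--Tsetlin pattern below the top row \<open>A \<ge> B \<ge> 0\<close>:
  \<open>p\<close> and \<open>q\<close> are the numbers of entries at most 2 in the first and second row,
  and \<open>r\<close> is the number of entries 1.\<close>

definition gt_states :: "nat \<Rightarrow> nat \<Rightarrow> (nat \<times> nat \<times> nat) set" where
  "gt_states A B = {(p, q, r). B \<le> p \<and> p \<le> A \<and> q \<le> B \<and> q \<le> r \<and> r \<le> p}"

definition gt_columns :: "nat \<Rightarrow> nat \<Rightarrow> nat \<times> nat \<times> nat \<Rightarrow> nat set list" where
  "gt_columns A B = (\<lambda>(p, q, r). blocks q (min r B - q) (B - r) (r - B) (p - max r B) (A - p))"

text \<open>Steps decrease the coordinates. The last decrease of \<open>p\<close> requires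
  \<open>r + B < p + q\<close> at that moment, and the first decrease of \<open>q\<close> requires
  \<open>p + q \<le> r + B\<close>; monotonicity of the other coordinates turns these into the two
  conditional inequalities.\<close>

definition gt_le :: "nat \<Rightarrow> nat \<times> nat \<times> nat \<Rightarrow> nat \<times> nat \<times> nat \<Rightarrow> bool" where
  "gt_le B = (\<lambda>(p, q, r) (p', q', r'). p' \<le> p \<and> q' \<le> q \<and> r' \<le> r \<and>
     (p' < p \<longrightarrow> r' + B \<le> p' + q) \<and> (q' < q \<longrightarrow> p' + q \<le> r + B))"

text \<open>Since \<open>min r B + max r B = r + B\<close>, the number of columns \<open>{2}\<close>
  exceeds that of columns \<open>{1, 3}\<close> by \<open>p + q - (r + B)\<close>; its sign decides
  whether the operator 2 decreases \<open>p\<close> or \<open>q\<close>.\<close>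

lemma gt_step:
  assumes "(p, q, r) \<in> gt_states A B"
  shows "q < r \<Longrightarrow> colstep 1 (gt_columns A B (p, q, r)) (gt_columns A B (p, q, r - 1))"
    and "r + B < p + q \<Longrightarrow> colstep 2 (gt_columns A B (p, q, r)) (gt_columns A B (p - 1, q, r))"
    and "p + q \<le> r + B \<Longrightarrow> 0 < q \<Longrightarrow> colstep 2 (gt_columns A B (p, q, r)) (gt_columns A B (p, q - 1, r))"
    and "r = q \<Longrightarrow> \<not> colstep 1 (gt_columns A B (p, q, r)) Y"
    and "p + q \<le> r + B \<Longrightarrow> q = 0 \<Longrightarrow> \<not> colstep 2 (gt_columns A B (p, q, r)) Y"
proof -
  have st: "B \<le> p" "p \<le> A" "q \<le> B" "q \<le> r" "r \<le> p" using assms by (auto simp: gt_states_def)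
  show "colstep 1 (gt_columns A B (p, q, r)) (gt_columns A B (p, q, r - 1))" if "q < r"
  proof (cases "r \<le> B")
    case True
    then have "gt_columns A B (p, q, r) = blocks q (Suc (r - 1 - q)) (B - r) 0 (p - B) (A - p)"
      "gt_columns A B (p, q, r - 1) = blocks q (r - 1 - q) (Suc (B - r)) 0 (p - B) (A - p)"
      using that by (simp_all add: gt_columns_def Suc_diff_le min_absorb1 max_absorb2 Suc_diff_Suc)
    then show ?thesis using blocks_step_1(1) by (simp only:)
  next
    case False
    then have "gt_columns A B (p, q, r) = blocks q (B - q) 0 (Suc (r - 1 - B)) (p - r) (A - p)"
      "gt_columns A B (p, q, r - 1) = blocks q (B - q) 0 (r - 1 - B) (Suc (p - r)) (A - p)"
      using st by (simp_all add: gt_columns_def min_absorb2 max_absorb1 Suc_diff_Suc Suc_diff_le)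
    then show ?thesis using blocks_step_1(2) by (simp only:)
  qed
  show "colstep 2 (gt_columns A B (p, q, r)) (gt_columns A B (p - 1, q, r))" if "r + B < p + q"
  proof -
    have "max r B < p" using that st by (simp add: max_def)
    then have "gt_columns A B (p, q, r) = blocks q (min r B - q) (B - r) (r - B) (Suc (p - 1 - max r B)) (A - p)"
      "gt_columns A B (p - 1, q, r) = blocks q (min r B - q) (B - r) (r - B) (p - 1 - max r B) (Suc (A - p))"
      using st by (simp_all add: gt_columns_def Suc_diff_Suc Suc_diff_le)
    moreover have "min r B - q \<le> p - 1 - max r B"
    proof (cases "r \<le> B")
      case True
      have "B < p" using that st True by linarith
      then obtain u v where "r = q + u" "p = Suc B + v" using st(4) by (metis Suc_leI le_Suc_ex)
      then show ?thesis using that True by simp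
    next
      case False
      have "r < p" using that st False by linarith
      then obtain u v where "B = q + u" "p = Suc r + v" using st(3) by (metis Suc_leI le_Suc_ex)
      then show ?thesis using that False by simp
    qed
    ultimately show ?thesis using blocks_step_2 by (simp only:)
  qed
  show "colstep 2 (gt_columns A B (p, q, r)) (gt_columns A B (p, q - 1, r))" if "p + q \<le> r + B" "0 < q"
  proof -
    have "gt_columns A B (p, q, r) = blocks (Suc (q - 1)) (min r B - q) (B - r) (r - B) (p - max r B) (A - p)"
      "gt_columns A B (p, q - 1, r) = blocks (q - 1) (Suc (min r B - q)) (B - r) (r - B) (p - max r B) (A - p)"
      using st that by (simp_all add: gt_columns_def Suc_diff_le[symmetric])
    moreover have "p - max r B \<le> min r B - q"
    proof (cases "r \<le> B")
      case True
      obtain u where "r = q + u" using st(4) by (metis le_Suc_ex)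
      then show ?thesis using that True by simp
    next
      case False
      obtain u where "B = q + u" using st(3) by (metis le_Suc_ex)
      then show ?thesis using that False by simp
    qed
    ultimately show ?thesis using blocks_step_2' by (simp only:)
  qed
  show "\<not> colstep 1 (gt_columns A B (p, q, r)) Y" if "r = q"
    using blocks_no_step(1) that st by (simp add: gt_columns_def)
  show "\<not> colstep 2 (gt_columns A B (p, q, r)) Y" if "p + q \<le> r + B" "q = 0"
  proof -
    have "p - max r B \<le> min r B" using that st by (simp add: min_def max_def le_diff_conv)
    then show ?thesis using blocks_no_step(2) that(2) by (simp add: gt_columns_def)
  qed
qed

text \<open>Going up means decreasing coordinates, so the join wants the largest admissible values.
  They can be chosen greedily: \<open>q\<close> is the minimum, the constraints on \<open>p\<close>
  depend only on \<open>q\<close> and the given states, and those on \<open>r\<close> only on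
  \<open>p\<close> and the given states.\<close>

lemma gt_join:
  assumes "x \<in> gt_states A B" "y \<in> gt_states A B"
  shows "\<exists>z\<in>gt_states A B. gt_le B x z \<and> gt_le B y z \<and>
    (\<forall>w\<in>gt_states A B. gt_le B x w \<and> gt_le B y w \<longrightarrow> gt_le B z w)"
proof -
  obtain p1 q1 r1 p2 q2 r2 where xy: "x = (p1, q1, r1)" "y = (p2, q2, r2)" by (cases x, cases y) auto
  have st: "B \<le> p1" "p1 \<le> A" "q1 \<le> B" "q1 \<le> r1" "r1 \<le> p1" "B \<le> p2" "p2 \<le> A" "q2 \<le> B" "q2 \<le> r2" "r2 \<le> p2"
    using assms by (auto simp: gt_states_def xy)
  define q where "q = min q1 q2"
  define p where "p = min (min p1 p2) (min (if q < q1 then r1 + B - q1 else p1) (if q < q2 then r2 + B - q2 else p2))"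
  define r where "r = min (min r1 r2) (min (if p < p1 then p + q1 - B else r1) (if p < p2 then p + q2 - B else r2))"
  have q: "q \<le> q1" "q \<le> q2" "q = q1 \<or> q = q2" by (auto simp: q_def)
  have p: "p \<le> p1" "p \<le> p2" "q < q1 \<Longrightarrow> p + q1 \<le> r1 + B" "q < q2 \<Longrightarrow> p + q2 \<le> r2 + B" "B \<le> p"
    using st q by (auto simp: p_def)
  have pmax: "p' \<le> p" if "p' \<le> p1" "p' \<le> p2" "q < q1 \<Longrightarrow> p' + q1 \<le> r1 + B" "q < q2 \<Longrightarrow> p' + q2 \<le> r2 + B" for p'
    using that by (auto simp: p_def)
  have r: "r \<le> r1" "r \<le> r2" "p < p1 \<Longrightarrow> r + B \<le> p + q1" "p < p2 \<Longrightarrow> r + B \<le> p + q2"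
    using p(5) by (auto simp: r_def)
  have rmax: "r' \<le> r" if "r' \<le> r1" "r' \<le> r2" "p < p1 \<Longrightarrow> r' + B \<le> p + q1" "p < p2 \<Longrightarrow> r' + B \<le> p + q2" for r'
    using that by (auto simp: r_def)
  have rcases: "r = r1 \<or> r = r2 \<or> r + B = p + q1 \<or> r + B = p + q2"
    using p(5) by (auto simp: r_def min_def)
  have "q \<le> r" using st q p(5) by (intro rmax) auto
  moreover have "r \<le> p"
  proof (cases "p < p1")
    case True
    then show ?thesis using r(3) st(3) by simp
  next
    case False
    then show ?thesis using p(1) r(1) st(5) by simp
  qed
  ultimately have z: "(p, q, r) \<in> gt_states A B" using p q st by (simp add: gt_states_def)
  have "gt_le B (p1, q1, r1) (p, q, r)" "gt_le B (p2, q2, r2) (p, q, r)"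
    using p q r by (auto simp: gt_le_def)
  moreover have "gt_le B (p, q, r) (p', q', r')"
    if "gt_le B (p1, q1, r1) (p', q', r')" "gt_le B (p2, q2, r2) (p', q', r')" for p' q' r'
  proof -
    have 1: "p' \<le> p1" "q' \<le> q1" "r' \<le> r1" "p' < p1 \<Longrightarrow> r' + B \<le> p' + q1" "q' < q1 \<Longrightarrow> p' + q1 \<le> r1 + B"
      and 2: "p' \<le> p2" "q' \<le> q2" "r' \<le> r2" "p' < p2 \<Longrightarrow> r' + B \<le> p' + q2" "q' < q2 \<Longrightarrow> p' + q2 \<le> r2 + B"
      using that by (auto simp: gt_le_def)
    have q': "q' \<le> q" using 1(2) 2(2) by (simp add: q_def)
    have p': "p' \<le> p" using 1 2 q' by (intro pmax) auto
    have r': "r' \<le> r"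
    proof (rule rmax)
      show "r' + B \<le> p + q1" if "p < p1" using 1(4) p' that by simp
      show "r' + B \<le> p + q2" if "p < p2" using 2(4) p' that by simp
    qed (use 1 2 in auto)
    have "r' + B \<le> p' + q" if "p' < p"
      using q(3) 1(4) 2(4) that p(1,2) by auto
    moreover have "p' + q \<le> r + B" if "q' < q"
    proof -
      have "p' + q1 \<le> r1 + B" "p' + q2 \<le> r2 + B" using 1(5) 2(5) that q(1,2) by auto
      then show ?thesis using rcases q(1,2) p' by auto
    qed
    ultimately show ?thesis using p' q' r' by (simp add: gt_le_def)
  qed
  ultimately show ?thesis using z xy by (intro bexI[of _ "(p, q, r)"]) auto
qed

lemma column_lattice_rank_two: "column_lattice (replicate B 2 @ replicate Q 1) 2"
proof (rule column_lattice_model[where S = "gt_states (B + Q) B" and emb = "gt_columns (B + Q) B" and R = "gt_le B"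
      and b = "(B + Q, B, B + Q)"])
  let ?S = "gt_states (B + Q) B" and ?e = "gt_columns (B + Q) B"
  show "sorted_wrt (\<ge>) (replicate B 2 @ replicate Q (1::nat))"
    by (auto simp: sorted_wrt_iff_nth_less nth_append)
  show "\<forall>h\<in>set (replicate B 2 @ replicate Q 1). h \<le> Suc 2" by auto
  show "(B + Q, B, B + Q) \<in> ?S" by (simp add: gt_states_def)
  have "{1..2} = {1, 2::nat}" by auto
  then show "?e (B + Q, B, B + Q) = highest (replicate B 2 @ replicate Q 1)"
    by (simp add: gt_columns_def highest_def blocks_def)
  show "gt_le B (B + Q, B, B + Q) x" if "x \<in> ?S" for x
    using that by (cases x) (auto simp: gt_states_def gt_le_def)
  show "inj_on ?e ?S"
  proof (rule inj_onI)
    fix x y assume xy: "x \<in> ?S" "y \<in> ?S" "?e x = ?e y"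
    obtain p q r p' q' r' where xe: "x = (p, q, r)" "y = (p', q', r')" by (cases x, cases y) auto
    note st = xy(1,2)[unfolded xe] and e = xy(3)[unfolded xe]
    have "q = q' \<and> B - r = B - r' \<and> r - B = r' - B \<and> B + Q - p = B + Q - p'"
      using e unfolding gt_columns_def prod.case by (blast dest: blocks_inj)
    then show "x = y" using st by (auto simp: gt_states_def xe)
  qed
  show "gt_le B x x" for x by (cases x) (simp add: gt_le_def)
  show "gt_le B x z" if "gt_le B x y" "gt_le B y z" for x y z
    using that by (cases x, cases y, cases z) (fastforce simp: gt_le_def)
  have two: "i \<in> {1..2::nat} \<longleftrightarrow> i = 1 \<or> i = 2" for i by auto
  show "\<exists>y\<in>?S. Y = ?e y \<and> gt_le B x y" if x: "x \<in> ?S" and i: "i \<in> {1..2}" and Y: "colstep i (?e x) Y" for x i Y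
  proof -
    obtain p q r where xe: "x = (p, q, r)" by (cases x) auto
    note st = x[unfolded xe]
    have st': "B \<le> p" "p \<le> B + Q" "q \<le> B" "q \<le> r" "r \<le> p" using st by (auto simp: gt_states_def)
    note g = gt_step[OF st]
    have "\<exists>y\<in>?S. colstep i (?e x) (?e y) \<and> gt_le B x y"
    proof (cases "i = 1")
      case True
      then have "q < r" using g(4) Y st' xe by (cases "r = q") auto
      then show ?thesis using g(1) True st' by (intro bexI[of _ "(p, q, r - 1)"]) (auto simp: xe gt_le_def gt_states_def)
    next
      case False
      then have i2: "i = 2" using i by simp
      show ?thesis
      proof (cases "r + B < p + q")
        case True
        then show ?thesis using g(2) i2 st'
          by (intro bexI[of _ "(p - 1, q, r)"]) (auto simp: xe gt_le_def gt_states_def)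
      next
        case False
        then have "0 < q" using g(5) Y i2 xe by (cases q) auto
        then show ?thesis using g(3) False i2 st'
          by (intro bexI[of _ "(p, q - 1, r)"]) (auto simp: xe gt_le_def gt_states_def)
      qed
    qed
    then show ?thesis using Y colstep_unique by blast
  qed
  show "\<exists>i\<in>{1..2}. \<exists>z\<in>?S. colstep i (?e x) (?e z) \<and> gt_le B z y"
    if xy: "x \<in> ?S" "y \<in> ?S" "gt_le B x y" "x \<noteq> y" for x y
  proof -
    obtain p q r p' q' r' where e: "x = (p, q, r)" "y = (p', q', r')" by (cases x, cases y) auto
    note g = gt_step[OF xy(1)[unfolded e]]
    have st: "B \<le> p" "p \<le> B + Q" "q \<le> B" "q \<le> r" "r \<le> p" "B \<le> p'" "p' \<le> B + Q" "q' \<le> B" "q' \<le> r'" "r' \<le> p'"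
      using xy(1,2) by (auto simp: gt_states_def e)
    have le: "p' \<le> p" "q' \<le> q" "r' \<le> r" "p' < p \<Longrightarrow> r' + B \<le> p' + q" "q' < q \<Longrightarrow> p' + q \<le> r + B"
      using xy(3) by (auto simp: gt_le_def e)
    \<comment> \<open>If \<open>p\<close> must still decrease but \<open>p + q \<le> r + B\<close>
      blocks it, then \<open>r\<close> must decrease too and can do so without violating the
      constraint for \<open>q\<close>. If \<open>p\<close> is final, a pending \<open>q\<close>
      comes first, since its condition \<open>p + q \<le> r + B\<close> could be lost by decreasing
      \<open>r\<close>.\<close>
    consider (p) "p' < p" "r + B < p + q" | (r) "r' < r" "q < r" "q' < q \<Longrightarrow> p' + q < r + B" | (q) "q' < q" "p' = p" "p + q \<le> r + B"
      using le st xy(4) e by (cases "p' < p"; cases "r + B < p + q"; cases "q' < q") auto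
    then show ?thesis
    proof cases
      case p
      then show ?thesis using g(2) st le
        by (intro bexI[of _ 2] bexI[of _ "(p - 1, q, r)"]) (auto simp: e gt_le_def gt_states_def)
    next
      case r
      then show ?thesis using g(1) st le
        by (intro bexI[of _ 1] bexI[of _ "(p, q, r - 1)"]) (auto simp: e gt_le_def gt_states_def)
    next
      case q
      then show ?thesis using g(3) st le
        by (intro bexI[of _ 2] bexI[of _ "(p, q - 1, r)"]) (auto simp: e gt_le_def gt_states_def)
    qed
  qed
  show "\<exists>z\<in>?S. gt_le B x z \<and> gt_le B y z \<and> (\<forall>w\<in>?S. gt_le B x w \<and> gt_le B y w \<longrightarrow> gt_le B z w)"
    if "x \<in> ?S" "y \<in> ?S" for x y using gt_join that by blast
qed

section \<open>The shape (3, 2, 1) in rank three\<close>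

lemma colstep_triple:
  "colstep i [C, D, E] Y \<longleftrightarrow>
    (sig i C = 1 \<and> sig i D \<le> 0 \<and> sig i D + sig i E \<le> 0 \<and> Y = [raise i C, D, E]) \<or>
    (sig i D = 1 \<and> 0 \<le> sig i C \<and> sig i E \<le> 0 \<and> Y = [C, raise i D, E]) \<or>
    (sig i E = 1 \<and> 0 \<le> sig i D \<and> 0 \<le> sig i C + sig i D \<and> Y = [C, D, raise i E])"
proof -
  have split: "[C, D, E] = A @ K # B \<longleftrightarrow> A = [] \<and> K = C \<and> B = [D, E] \<or> A = [C] \<and> K = D \<and> B = [E] \<or>
      A = [C, D] \<and> K = E \<and> B = []" for A K B
    by (auto simp: Cons_eq_append_conv append_eq_Cons_conv)
  have pre: "prefixes_nonpos f [x] \<longleftrightarrow> f x \<le> 0" "prefixes_nonpos f [x, y] \<longleftrightarrow> f x \<le> 0 \<and> f x + f y \<le> 0"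
    for f :: "nat set \<Rightarrow> int" and x y
    using prefixes_nonpos_snoc[of f "[]" x] prefixes_nonpos_snoc[of f "[x]" y] by auto
  show ?thesis
    unfolding colstep_def split
    by (simp add: conj_disj_distribR ex_disj_distrib pre suffixes_nonneg_Cons sig_eq_1) blast
qed

definition list_sig :: "nat \<Rightarrow> nat list \<Rightarrow> int" where
  "list_sig i c = (if i \<in> set c then 1 else 0) - (if Suc i \<in> set c then 1 else 0)"

definition list_raise :: "nat \<Rightarrow> nat list \<Rightarrow> nat list" where
  "list_raise i c = map (\<lambda>x. if x = i then Suc i else x) c"

text \<open>An executable copy of \<open>colstep\<close>, with columns as lists. The three cases
  exclude each other, so they can be tested one after the other.\<close>

definition triple_step ::
    "nat \<Rightarrow> nat list \<times> nat list \<times> nat list \<Rightarrow> (nat list \<times> nat list \<times> nat list) option" where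
  "triple_step i = (\<lambda>(c, d, e).
     if list_sig i c = 1 \<and> list_sig i d \<le> 0 \<and> list_sig i d + list_sig i e \<le> 0 then Some (list_raise i c, d, e)
     else if list_sig i d = 1 \<and> 0 \<le> list_sig i c \<and> list_sig i e \<le> 0 then Some (c, list_raise i d, e)
     else if list_sig i e = 1 \<and> 0 \<le> list_sig i d \<and> 0 \<le> list_sig i c + list_sig i d then Some (c, d, list_raise i e)
     else None)"

definition triple_columns :: "nat list \<times> nat list \<times> nat list \<Rightarrow> nat set list" where
  "triple_columns = (\<lambda>(c, d, e). [set c, set d, set e])"

lemma list_sig_eq: "list_sig i c = sig i (set c)"
  by (simp add: list_sig_def sig_def)

lemma set_list_raise: "sig i (set c) = 1 \<Longrightarrow> set (list_raise i c) = raise i (set c)"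
  by (auto simp: list_raise_def raise_def sig_eq_1)

lemma colstep_triple_iff:
  "colstep i (triple_columns x) Y \<longleftrightarrow> (\<exists>y. triple_step i x = Some y \<and> Y = triple_columns y)"
proof -
  obtain c d e where x: "x = (c, d, e)" by (cases x)
  show ?thesis
    unfolding x triple_columns_def prod.case colstep_triple triple_step_def list_sig_eq
    by (auto simp: set_list_raise)
qed

text \<open>The numbering lets every edge lead to a larger index, which makes induction on
  \<open>64 - k\<close> possible. Completeness of the list is not assumed: it follows because the
  list contains the highest element and is closed under the operators.\<close>

definition triples :: "(nat list \<times> nat list \<times> nat list) list" where
  "triples =
   [([1, 2, 3], [1, 2], [1]), ([1, 2, 3], [1, 2], [2]), ([1, 2, 3], [1, 3], [1]), ([1, 2, 4], [1, 2], [1]),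
    ([1, 2, 3], [1, 2], [3]), ([1, 2, 4], [1, 2], [2]), ([1, 2, 3], [1, 3], [2]), ([1, 2, 3], [1, 4], [1]),
    ([1, 2, 4], [1, 3], [1]), ([1, 2, 3], [1, 3], [3]), ([1, 2, 3], [1, 2], [4]), ([1, 2, 4], [1, 2], [3]),
    ([1, 2, 3], [2, 3], [2]), ([1, 2, 3], [1, 4], [2]), ([1, 2, 4], [1, 4], [1]), ([1, 2, 4], [1, 3], [2]),
    ([1, 3, 4], [1, 3], [1]), ([1, 2, 3], [2, 3], [3]), ([1, 2, 3], [1, 3], [4]), ([1, 2, 4], [1, 2], [4]),
    ([1, 2, 4], [1, 3], [3]), ([1, 2, 3], [2, 4], [2]), ([1, 2, 3], [1, 4], [3]), ([1, 2, 4], [1, 4], [2]),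
    ([1, 3, 4], [1, 4], [1]), ([1, 2, 4], [2, 3], [2]), ([1, 3, 4], [1, 3], [2]), ([1, 2, 3], [2, 3], [4]),
    ([1, 2, 3], [1, 4], [4]), ([1, 2, 4], [1, 3], [4]), ([1, 2, 4], [2, 3], [3]), ([1, 3, 4], [1, 3], [3]),
    ([1, 2, 3], [2, 4], [3]), ([1, 2, 4], [2, 4], [2]), ([1, 2, 4], [1, 4], [3]), ([1, 3, 4], [1, 4], [2]),
    ([1, 3, 4], [2, 3], [2]), ([1, 2, 3], [2, 4], [4]), ([1, 2, 4], [1, 4], [4]), ([1, 2, 4], [2, 3], [4]),
    ([1, 3, 4], [1, 3], [4]), ([1, 3, 4], [2, 3], [3]), ([1, 2, 3], [3, 4], [3]), ([1, 2, 4], [2, 4], [3]),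
    ([1, 3, 4], [1, 4], [3]), ([1, 3, 4], [2, 4], [2]), ([2, 3, 4], [2, 3], [2]), ([1, 2, 3], [3, 4], [4]),
    ([1, 2, 4], [2, 4], [4]), ([1, 3, 4], [1, 4], [4]), ([1, 3, 4], [2, 3], [4]), ([2, 3, 4], [2, 3], [3]),
    ([1, 2, 4], [3, 4], [3]), ([1, 3, 4], [2, 4], [3]), ([2, 3, 4], [2, 4], [2]), ([1, 2, 4], [3, 4], [4]),
    ([1, 3, 4], [2, 4], [4]), ([2, 3, 4], [2, 3], [4]), ([1, 3, 4], [3, 4], [3]), ([2, 3, 4], [2, 4], [3]),
    ([1, 3, 4], [3, 4], [4]), ([2, 3, 4], [2, 4], [4]), ([2, 3, 4], [3, 4], [3]), ([2, 3, 4], [3, 4], [4])]"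

text \<open>Entry \<open>k\<close> lists the pairs \<open>(i, j)\<close> such that the operator \<open>i\<close> maps the state \<open>k\<close> to the state \<open>j\<close>.\<close>

definition triple_edges :: "(nat \<times> nat) list list" where
  "triple_edges =
   [[(1, 1), (2, 2), (3, 3)], [(2, 4), (3, 5)], [(1, 6), (3, 7)], [(1, 5), (2, 8)], [(2, 9), (3, 10)],
    [(2, 11)], [(1, 12), (3, 13)], [(1, 13), (3, 14)], [(1, 15), (2, 16)], [(1, 17), (3, 18)],
    [(2, 18), (3, 19)], [(2, 20)], [(2, 17), (3, 21)], [(1, 21), (2, 22), (3, 23)], [(1, 23), (2, 24)],
    [(1, 25), (2, 26)], [(1, 26), (3, 24)], [(3, 27)], [(1, 27), (3, 28)], [(2, 29)],
    [(1, 30), (2, 31), (3, 29)], [(2, 32), (3, 33)], [(1, 32), (3, 34)], [(1, 33), (2, 34)], [(1, 35)],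
    [(2, 30)], [(1, 36), (3, 35)], [(3, 37)], [(1, 37), (3, 38)], [(1, 39), (2, 40)],
    [(2, 41), (3, 39)], [(1, 41), (3, 40)], [(2, 42), (3, 43)], [(2, 43)], [(1, 43), (2, 44)],
    [(1, 45)], [(1, 46), (3, 45)], [(2, 47), (3, 48)], [(1, 48), (2, 49)], [(2, 50)],
    [(1, 50), (3, 49)], [(1, 51), (3, 50)], [(3, 47)], [(2, 52)], [(1, 53)],
    [(1, 54), (2, 53)], [(2, 51), (3, 54)], [(3, 55)], [(2, 55)], [(1, 56)],
    [(1, 57), (3, 56)], [(3, 57)], [(2, 58)], [(1, 59)], [(2, 59)],
    [(2, 60)], [(1, 61)], [(3, 61)], [(1, 62), (3, 60)], [(2, 62)],
    [(1, 63)], [(2, 63)], [(3, 63)], []]"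

text \<open>Entry \<open>k\<close> is the up-set of the state \<open>k\<close> as a bit mask.\<close>

definition triple_ups :: "int list" where
  "triple_ups =
   [18446744073709551615, 12938705256717356594, 15920713067946733764, 16964606354714102056,
    12936451254658139664, 11749332329906047008, 15902663450688630848, 15920431455396716672,
    16964042302563647744, 12791208516870603264, 12936451254658008064, 11749332329906046976,
    15317177889751961600, 15902381838138613760, 15884257518541619200, 16964042302546804736,
    16890856058732478464, 10412744688518955008, 12791208516870471680, 11747078327847354368,
    11749332329906044928, 15316896277201944576, 15902381829538185216, 15866207901283516416,
    14438575624098414592, 11748768277789147136, 16890856058715635712, 10412744688518823936,
    12791208516735991808, 11747078327846830080, 11748768277755592704, 11749331778538569728,
    15316896268609912832, 15280722340351049728, 15866207892685193216, 14438575624081637376,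
    16890856024288788480, 10412744688384606208, 12791067641540247552, 11746514277844910080,
    11747077777554145280, 11748767726926036992, 10412467474015453184, 15280722331761115136,
    14420543599026372608, 14438575589721899008, 16881813571942481920, 10412463075968942080,
    10412603813457297408, 11601835590059819008, 11746513728089096192, 11675582033958010880,
    15280713535668092928, 14420526006840328192, 14429533206095069184, 10412322338480586752,
    11601272640106397696, 11673330234144325632, 15276209936040722432, 14411518807585587200,
    10376293541461622784, 11529215046068469760, 13835058055282163712, 9223372036854775808]"

lemma triple_edges_correct:
  "\<forall>k\<in>set [0..<64]. \<forall>i\<in>set [1, 2, 3].
     triple_step i (triples ! k) = map_option ((!) triples) (map_of (triple_edges ! k) i)"
  by code_simp

lemma triple_edges_increasing:
  "\<forall>k\<in>set [0..<64]. \<forall>(i, j)\<in>set (triple_edges ! k). i \<in> set [1, 2, 3] \<and> k < j \<and> j < 64"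
  by code_simp

lemma triple_ups_correct:
  "\<forall>k\<in>set [0..<64]. triple_ups ! k = foldr (\<lambda>(i, j) u. or (triple_ups ! j) u) (triple_edges ! k) (2 ^ k)"
  by code_simp

lemma triple_ups_bottom: "triple_ups ! 0 = 2 ^ 64 - 1"
  by code_simp

text \<open>Two states have a join exactly if the intersection of their up-sets is the up-set of a
  single state, which becomes a lookup of a bit mask.\<close>

lemma triple_ups_joins:
  "\<forall>k\<in>set [0..<64]. \<forall>(i, a)\<in>set (triple_edges ! k). \<forall>(i', b)\<in>set (triple_edges ! k).
     i < i' \<longrightarrow> and (triple_ups ! a) (triple_ups ! b) \<in> set triple_ups"
  by code_simp

lemma triples_distinct:
  "distinct triples" "length triples = 64" "length triple_ups = 64"
  "\<forall>(c, d, e)\<in>set triples. sorted_wrt (<) c \<and> sorted_wrt (<) d \<and> sorted_wrt (<) e"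
  "\<forall>k\<in>set [0..<64]. distinct (map fst (triple_edges ! k))"
  by code_simp+

definition triple_le :: "nat \<Rightarrow> nat \<Rightarrow> bool" where
  "triple_le k j \<longleftrightarrow> bit (triple_ups ! k) j"

lemma bit_foldr_or:
  "bit (foldr (\<lambda>(i, l) u. or (f l) u) es (w :: int)) j \<longleftrightarrow> bit w j \<or> (\<exists>(i, l)\<in>set es. bit (f l) j)"
  by (induction es) (auto simp: bit_or_iff)

lemma triple_le_iff:
  assumes "k < 64"
  shows "triple_le k j \<longleftrightarrow> j = k \<or> (\<exists>(i, l)\<in>set (triple_edges ! k). triple_le l j)"
proof -
  have "triple_ups ! k = foldr (\<lambda>(i, j) u. or (triple_ups ! j) u) (triple_edges ! k) (2 ^ k)"
    using triple_ups_correct assms by simp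
  then show ?thesis unfolding triple_le_def by (auto simp: bit_foldr_or bit_exp_iff)
qed

lemma triple_edges_increasingD:
  assumes "k < 64" "(i, j) \<in> set (triple_edges ! k)"
  shows "i \<in> {1..3}" "k < j" "j < 64"
  using triple_edges_increasing[rule_format, of k "(i, j)"] assms by auto

lemma triple_le_trans:
  assumes "triple_le k j" "triple_le j l" "k < 64"
  shows "triple_le k l"
  using assms(1,3)
proof (induction "64 - k" arbitrary: k rule: less_induct)
  case less
  show ?case
  proof (cases "j = k")
    case False
    then obtain i k' where k': "(i, k') \<in> set (triple_edges ! k)" "triple_le k' j"
      using less.prems triple_le_iff by auto
    then have "triple_le k' l"
      using triple_edges_increasingD[OF less.prems(2) k'(1)] by (intro less.hyps) auto
    then show ?thesis using triple_le_iff[OF less.prems(2)] k'(1) by auto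
  qed (use assms(2) in simp)
qed

text \<open>A join of two states above \<open>k\<close> is obtained by joining two successors of \<open>k\<close>, so that
  only pairs of successors have to be checked by computation.\<close>

lemma triple_join:
  assumes "k < 64" "triple_le k x" "triple_le k y" "x < 64" "y < 64"
  shows "\<exists>z<64. \<forall>j. triple_le z j \<longleftrightarrow> triple_le x j \<and> triple_le y j"
  using assms
proof (induction "64 - k" arbitrary: k x y rule: less_induct)
  case less
  note k = less.prems(1) and le = less.prems(2,3) and lt = less.prems(4,5)
  show ?case
  proof (cases "x = k \<or> y = k")
    case True
    then show ?thesis
    proof
      assume "x = k"
      then have "\<forall>j. triple_le y j \<longleftrightarrow> triple_le x j \<and> triple_le y j" using le lt triple_le_trans k by blast
      then show ?thesis using lt by blast
    next
      assume "y = k"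
      then have "\<forall>j. triple_le x j \<longleftrightarrow> triple_le x j \<and> triple_le y j" using le lt triple_le_trans k by blast
      then show ?thesis using lt by blast
    qed
  next
    case False
    obtain i a where a: "(i, a) \<in> set (triple_edges ! k)" "triple_le a x" using le(1) False triple_le_iff[OF k] by auto
    obtain i' b where b: "(i', b) \<in> set (triple_edges ! k)" "triple_le b y" using le(2) False triple_le_iff[OF k] by auto
    have meas: "64 - l < 64 - k" if "k < l" for l using that k by (simp add: diff_less_mono2)
    note a' = triple_edges_increasingD[OF k a(1)] and b' = triple_edges_increasingD[OF k b(1)]
    show ?thesis
    proof (cases "a = b")
      case True
      then show ?thesis using less.hyps[of a x y] a b a' lt by simp
    next
      case False
      have "distinct (map fst (triple_edges ! k))" using triples_distinct(5) k by simp
      then have "i \<noteq> i'" using False a(1) b(1) map_of_is_SomeI[of "triple_edges ! k"] by fastforce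
      have "and (triple_ups ! a) (triple_ups ! b) \<in> set triple_ups"
      proof (cases "i < i'")
        case True
        then show ?thesis using triple_ups_joins k a(1) b(1) by fastforce
      next
        case False
        then have "i' < i" using \<open>i \<noteq> i'\<close> by simp
        then have "and (triple_ups ! b) (triple_ups ! a) \<in> set triple_ups"
          using triple_ups_joins k a(1) b(1) by fastforce
        then show ?thesis by (simp add: and.commute)
      qed
      \<comment> \<open>Here \<open>z\<close> is the join of the successors \<open>a\<close> and
        \<open>b\<close>. Then \<open>u\<close> joins \<open>x\<close> and \<open>z\<close>, both
        above \<open>a\<close>, and \<open>w\<close> joins \<open>u\<close> and \<open>y\<close>,
        both above \<open>b\<close>. Since any common upper bound of \<open>x\<close> and
        \<open>y\<close> is above \<open>z\<close>, \<open>w\<close> is the join of \<open>x\<close>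
        and \<open>y\<close>.\<close>
      then obtain z where z: "z < 64" "triple_ups ! z = and (triple_ups ! a) (triple_ups ! b)"
        using triples_distinct(3) by (auto simp: in_set_conv_nth)
      then have zab: "triple_le z j \<longleftrightarrow> triple_le a j \<and> triple_le b j" for j
        by (simp add: triple_le_def bit_and_iff)
      have zz: "triple_le z z" using triple_le_iff[OF z(1)] by simp
      obtain u where u: "u < 64" "\<And>j. triple_le u j \<longleftrightarrow> triple_le x j \<and> triple_le z j"
        using less.hyps[OF meas[OF a'(2)] a'(3) a(2) _ lt(1) z(1)] zz zab by auto
      have "triple_le z u" using u triple_le_iff[OF u(1)] by blast
      then obtain w where w: "w < 64" "\<And>j. triple_le w j \<longleftrightarrow> triple_le u j \<and> triple_le y j"
        using less.hyps[OF meas[OF b'(2)] b'(3) _ b(2) u(1) lt(2)] zab by auto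
      have "triple_le w j \<longleftrightarrow> triple_le x j \<and> triple_le y j" for j
        using w u zab triple_le_trans[OF a(2) _ a'(3)] triple_le_trans[OF b(2) _ b'(3)] by blast
      then show ?thesis using w(1) by blast
    qed
  qed
qed

lemma column_lattice_321: "column_lattice [3, 2, 1] 3"
proof (rule column_lattice_model[where S = "{..<64}" and emb = "\<lambda>k. triple_columns (triples ! k)"
      and R = triple_le and b = 0])
  show "sorted_wrt (\<ge>) [3, 2, 1 :: nat]" "\<forall>h\<in>set [3, 2, 1]. h \<le> Suc 3" by auto
  have "triples ! 0 = ([1, 2, 3], [1, 2], [1])" by (simp add: triples_def)
  moreover have "{1..3} = {1, 2, 3 :: nat}" "{1..2} = {1, 2 :: nat}" by auto
  ultimately show "triple_columns (triples ! 0) = highest [3, 2, 1]"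
    by (simp add: triple_columns_def highest_def)
  show bot: "triple_le 0 k" if "k \<in> {..<64}" for k
    using that bit_mask_iff[of 64 k, where 'a = int] by (simp add: triple_le_def triple_ups_bottom mask_eq_exp_minus_1)
  show "inj_on (\<lambda>k. triple_columns (triples ! k)) {..<64}"
  proof (rule inj_onI)
    fix k l assume k: "k \<in> {..<64}" "l \<in> {..<64}" and e: "triple_columns (triples ! k) = triple_columns (triples ! l)"
    obtain c d f c' d' f' where t: "triples ! k = (c, d, f)" "triples ! l = (c', d', f')"
      by (cases "triples ! k", cases "triples ! l")
    have "(c, d, f) \<in> set triples" "(c', d', f') \<in> set triples"
      using k triples_distinct(2) t nth_mem by (metis lessThan_iff)+
    then have s: "sorted_wrt (<) c \<and> sorted_wrt (<) d \<and> sorted_wrt (<) f"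
      "sorted_wrt (<) c' \<and> sorted_wrt (<) d' \<and> sorted_wrt (<) f'"
      using triples_distinct(4) by fastforce+
    have "c = c' \<and> d = d' \<and> f = f'"
      using s e t by (auto simp: triple_columns_def strict_sorted_iff intro!: sorted_distinct_set_unique)
    then have "triples ! k = triples ! l" using t by simp
    then show "k = l" using k triples_distinct(1,2) by (simp add: nth_eq_iff_index_eq)
  qed
  show "triple_le x x" if "x \<in> {..<64}" for x using that triple_le_iff by simp
  show "triple_le x z" if "x \<in> {..<64}" "triple_le x y" "triple_le y z" for x y z
    using that triple_le_trans by simp
  have step: "triple_step i (triples ! k) = map_option ((!) triples) (map_of (triple_edges ! k) i)"
    if "k < 64" "i \<in> {1..3}" for k i
  proof -
    have "i \<in> set [1, 2, 3]" using that(2) by auto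
    then show ?thesis using triple_edges_correct that(1) by (metis atLeastLessThan_iff le0 set_upt)
  qed
  show "\<exists>l\<in>{..<64}. Y = triple_columns (triples ! l) \<and> triple_le k l"
    if k: "k \<in> {..<64}" and i: "i \<in> {1..3}" and Y: "colstep i (triple_columns (triples ! k)) Y" for k i Y
  proof -
    obtain y where y: "triple_step i (triples ! k) = Some y" "Y = triple_columns y"
      using Y colstep_triple_iff by blast
    then have "map_option ((!) triples) (map_of (triple_edges ! k) i) = Some y"
      using step[of k i] k i by simp
    then obtain l where l: "map_of (triple_edges ! k) i = Some l" "Y = triple_columns (triples ! l)"
      using y(2) by auto
    then have e: "(i, l) \<in> set (triple_edges ! k)" by (simp add: map_of_SomeD)
    then have "l < 64" using triple_edges_increasingD k by blast
    moreover from this have "triple_le k l" using e k triple_le_iff[of k l] triple_le_iff[of l l] by auto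
    ultimately show ?thesis using l by auto
  qed
  show "\<exists>i\<in>{1..3}. \<exists>l\<in>{..<64}. colstep i (triple_columns (triples ! x)) (triple_columns (triples ! l)) \<and> triple_le l y"
    if xy: "x \<in> {..<64}" "y \<in> {..<64}" "triple_le x y" "x \<noteq> y" for x y
  proof -
    obtain i l where l: "(i, l) \<in> set (triple_edges ! x)" "triple_le l y" using xy triple_le_iff[of x y] by auto
    note l' = triple_edges_increasingD[OF _ l(1)]
    have "distinct (map fst (triple_edges ! x))" using triples_distinct(5) xy(1) by simp
    then have "map_of (triple_edges ! x) i = Some l" using l(1) by simp
    then have "triple_step i (triples ! x) = Some (triples ! l)" using step[of x i] xy(1) l' by simp
    then have "colstep i (triple_columns (triples ! x)) (triple_columns (triples ! l))"
      using colstep_triple_iff by blast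
    then show ?thesis using l l' xy(1) by auto
  qed
  show "\<exists>z\<in>{..<64}. triple_le x z \<and> triple_le y z \<and> (\<forall>w\<in>{..<64}. triple_le x w \<and> triple_le y w \<longrightarrow> triple_le z w)"
    if xy: "x \<in> {..<64}" "y \<in> {..<64}" for x y
  proof -
    obtain z where "z < 64" "\<And>j. triple_le z j \<longleftrightarrow> triple_le x j \<and> triple_le y j"
      using triple_join[of 0 x y] bot xy by auto
    then show ?thesis using triple_le_iff[of z z] by (intro bexI[of _ z]) auto
  qed
qed simp_all

section \<open>Conjugate partitions\<close>

lemma width_simps [simp]: "width [] = 0" "width (x # xs) = x"
  by (simp_all add: width_def)

lemma height_le_length: "height lam j \<le> length lam"
  by (simp add: height_def)

lemma height_antimono: "j \<le> j' \<Longrightarrow> height lam j' \<le> height lam j"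
  unfolding height_def by (induction lam) auto

lemma conjugate_props:
  assumes "is_partition lam"
  shows "sorted_wrt (\<ge>) (conjugate lam)" "\<forall>h\<in>set (conjugate lam). 1 \<le> h \<and> h \<le> length lam"
proof -
  show "sorted_wrt (\<ge>) (conjugate lam)"
    by (auto simp: conjugate_def sorted_wrt_iff_nth_less height_antimono)
  have "1 \<le> height lam j" if "j < width lam" for j
    using that by (cases lam) (auto simp: width_def height_def)
  then show "\<forall>h\<in>set (conjugate lam). 1 \<le> h \<and> h \<le> length lam"
    by (auto simp: conjugate_def height_le_length)
qed

lemma conjugate_conjugate:
  assumes "is_partition lam"
  shows "conjugate (conjugate lam) = lam"
proof (rule nth_equalityI)
  have sorted: "sorted_wrt (\<ge>) lam" and pos: "\<forall>x\<in>set lam. 0 < x" using assms by (auto simp: is_partition_def)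
  have w: "width (conjugate lam) = length lam"
  proof (cases "width lam = 0")
    case True
    then show ?thesis using pos by (cases lam) (auto simp: width_def conjugate_def)
  next
    case False
    then have "width (conjugate lam) = height lam 0" by (simp add: conjugate_def upt_conv_Cons)
    also have "\<dots> = length lam" using pos by (simp add: height_def filter_id_conv)
    finally show ?thesis .
  qed
  then show "length (conjugate (conjugate lam)) = length lam" by (simp add: conjugate_def)
  fix i assume "i < length (conjugate (conjugate lam))"
  then have i: "i < length lam" using w by (simp add: conjugate_def)
  have "j < height (conjugate lam) i \<longleftrightarrow> j < lam ! i" for j
  proof -
    have "j < height (conjugate lam) i \<longleftrightarrow> j < width lam \<and> i < height lam j"
      using less_height_iff[OF conjugate_props(1)[OF assms], of j i] by (auto simp: cells_def conjugate_def)
    also have "\<dots> \<longleftrightarrow> (i, j) \<in> cells lam" using less_height_iff[OF sorted] cells_width[OF sorted] by auto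
    finally show ?thesis using i by (simp add: cells_def)
  qed
  then have "height (conjugate lam) i = lam ! i" by (metis linorder_neqE_nat less_irrefl)
  then show "conjugate (conjugate lam) ! i = lam ! i" using i w by (simp add: conjugate_def)
qed

lemma conjugate_eq_iff:
  assumes "is_partition lam" "is_partition mu" "conjugate mu = nu"
  shows "lam = nu \<longleftrightarrow> conjugate lam = mu"
  using assms conjugate_conjugate by metis

lemma sorted_wrt_replicate: "sorted_wrt (\<ge>) (replicate k (x :: nat))"
  by (simp add: sorted_wrt_iff_nth_less)

lemma conjugate_shapes:
  "conjugate [] = []"
  "0 < m \<Longrightarrow> conjugate [m] = replicate m 1"
  "conjugate [Suc m, 1] = 2 # replicate m 1"
  "0 < m \<Longrightarrow> m < n \<Longrightarrow> conjugate [n, n - m] = replicate (n - m) 2 @ replicate m 1"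
  "0 < k \<Longrightarrow> conjugate (replicate k 1) = [k]"
  "0 < k \<Longrightarrow> conjugate (replicate k n) = replicate n k"
  "0 < k \<Longrightarrow> conjugate (2 # replicate (k - 1) 1) = [k, 1]"
  "conjugate [3, 2, 1] = [3, 2, 1]"
proof -
  show "conjugate [] = []" by (simp add: conjugate_def width_def)
  show "conjugate [m] = replicate m 1" if "0 < m"
    using that by (intro nth_equalityI) (auto simp: conjugate_def width_def height_def)
  show "conjugate [Suc m, 1] = 2 # replicate m 1"
    by (intro nth_equalityI) (auto simp: conjugate_def width_def height_def nth_Cons' simp del: upt_Suc)
  show "conjugate [n, n - m] = replicate (n - m) 2 @ replicate m 1" if "0 < m" "m < n"
    using that by (intro nth_equalityI) (auto simp: conjugate_def width_def height_def nth_append)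
  have w: "width (replicate k x) = x" if "0 < k" for k x :: nat
    using that by (cases k) (auto simp: width_def)
  show "conjugate (replicate k 1) = [k]" if "0 < k"
    using that by (simp add: conjugate_def w height_def filter_replicate)
  show "conjugate (replicate k n) = replicate n k" if "0 < k"
    using that by (intro nth_equalityI) (auto simp: conjugate_def w height_def filter_replicate)
  show "conjugate (2 # replicate (k - 1) 1) = [k, 1]" if "0 < k"
    using that by (simp add: conjugate_def width_def height_def filter_replicate numeral_2_eq_2)
  show "conjugate [3, 2, 1] = [3, 2, 1]"
    by (simp add: conjugate_def width_def height_def numeral_3_eq_3 numeral_2_eq_2)
qed

text \<open>For \<open>k = 1\<close> the last part \<open>k - 1\<close> vanishes; the filter removes
  it, and a single column of height \<open>n - 1\<close> remains.\<close>

lemma conjugate_almost_rectangle: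
  assumes "0 < k" "2 \<le> n"
  shows "conjugate (replicate (k - 1) n @ [n - 1]) = filter ((<) 0) (replicate (n - 1) k @ [k - 1])"
proof (cases "k = 1")
  case True
  then show ?thesis using assms by (auto simp: conjugate_def width_def height_def intro!: nth_equalityI)
next
  case False
  then have "width (replicate (k - 1) n @ [n - 1]) = n" using assms by (cases "k - 1") (auto simp: width_def)
  then show ?thesis
    using assms False
    by (intro nth_equalityI) (auto simp: conjugate_def height_def filter_replicate nth_append)
qed

section \<open>Classification by column heights\<close>

lemma dual_heights_append: "dual_heights n (mu @ nu) = dual_heights n nu @ dual_heights n mu"
  by (simp add: dual_heights_def)

lemma dual_heights_simps [simp]:
  "dual_heights n [] = []" "dual_heights n (replicate l h) = replicate l (Suc n - h)"
  "dual_heights n [h] = [Suc n - h]"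
  by (simp_all add: dual_heights_def)

text \<open>Everything comes from the two families \<open>[m, 1]\<close> and
  \<open>2 # replicate (k - 1) 1\<close>: windows give single columns, the empty list and lists of
  ones, and duality turns the heights \<open>m + 1, 1\<close> into \<open>n, n - m\<close>,
  \<open>1\<close> into \<open>n\<close>, and \<open>2\<close> into \<open>n - 1\<close>.\<close>

lemma column_lattice_shapes:
  assumes "1 \<le> n"
  shows "column_lattice [] n"
    and "1 \<le> m \<Longrightarrow> m \<le> n \<Longrightarrow> column_lattice [m] n"
    and "1 \<le> m \<Longrightarrow> m \<le> n \<Longrightarrow> column_lattice [Suc m, 1] n"
    and "1 \<le> m \<Longrightarrow> m \<le> n \<Longrightarrow> column_lattice [n, n - m] n"
    and "column_lattice (replicate k 1) n"
    and "column_lattice (replicate k n) n"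
    and "1 \<le> k \<Longrightarrow> column_lattice (2 # replicate (k - 1) 1) n"
    and "1 \<le> k \<Longrightarrow> column_lattice (replicate (k - 1) n @ [n - 1]) n"
proof -
  show single: "column_lattice [m] n" if "1 \<le> m" "m \<le> n" for m
    using column_lattice_window[of "[]" "[m]" "[1]" n] column_lattice_box[of m n] that by auto
  show "column_lattice [] n"
    using column_lattice_window[of "[]" "[]" "[1]" n] single[of 1] assms by auto
  show box: "column_lattice [Suc m, 1] n" if "1 \<le> m" "m \<le> n" for m
    using column_lattice_box[of "Suc m" n] that by simp
  show "column_lattice [n, n - m] n" if "1 \<le> m" "m \<le> n"
  proof (rule column_lattice_dual)
    show "column_lattice (dual_heights n [n, n - m]) n" using box[OF that] that by (simp add: dual_heights_def)
  qed auto
  show ones: "column_lattice (replicate k 1) n" for k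
    using column_lattice_window[of "[2]" "replicate k 1" "[]" n] column_lattice_hook[of "Suc k" n] assms
    by (auto simp: sorted_wrt_replicate)
  show "column_lattice (replicate k n) n"
    by (rule column_lattice_dual) (use ones[of k] in auto)
  show hook: "column_lattice (2 # replicate (k - 1) 1) n" if "1 \<le> k" for k
    using column_lattice_hook[of k n] that assms by simp
  show "column_lattice (replicate (k - 1) n @ [n - 1]) n" if "1 \<le> k"
    by (rule column_lattice_dual) (use hook[OF that] assms in \<open>auto simp: dual_heights_append numeral_2_eq_2\<close>)
qed

text \<open>The duality \<open>h \<mapsto> n + 1 - h\<close> exchanges the block of heights
  \<open>n\<close> with the block of heights 1 and maps the middle range to itself, so each
  exclusion has a mirror image.\<close>

lemma sorted_three_parts:
  assumes "sorted_wrt (\<ge>) mu" "\<forall>h\<in>set mu. 1 \<le> h \<and> h \<le> n" "2 \<le> n"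
  shows "\<exists>l mid k. mu = replicate l n @ mid @ replicate k 1 \<and> (\<forall>h\<in>set mid. 2 \<le> h \<and> Suc h \<le> n)"
  using assms(1,2)
proof (induction mu)
  case Nil
  show ?case by (intro exI[of _ 0] exI[of _ "[]"]) simp
next
  case (Cons h mu)
  then obtain l mid k where e: "mu = replicate l n @ mid @ replicate k 1" "\<forall>h\<in>set mid. 2 \<le> h \<and> Suc h \<le> n"
    by auto
  have h: "1 \<le> h" "h \<le> n" "\<forall>x\<in>set mu. x \<le> h" using Cons.prems by auto
  consider "h = n" | "h < n" "2 \<le> h" | "h < n" "h = 1" using h by linarith
  then show ?case
  proof cases
    case 1
    then show ?thesis using e by (intro exI[of _ "Suc l"] exI[of _ mid] exI[of _ k]) simp
  next
    case 2
    then have "l = 0" using h(3) e(1) by (cases l) auto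
    then show ?thesis using e 2 by (intro exI[of _ 0] exI[of _ "h # mid"] exI[of _ k]) auto
  next
    case 3
    then have "l = 0" using h(3) e(1) by (cases l) auto
    moreover have "mid = []" using h(3) e 3 by (cases mid) auto
    ultimately show ?thesis using e 3 by (intro exI[of _ 0] exI[of _ "[]"] exI[of _ "Suc k"]) simp
  qed
qed

text \<open>The windows used are two middle heights, \<open>[j, 1, 1]\<close>,
  \<open>[n, j, 1]\<close> and \<open>[3, 2, 1, 1]\<close>; the remaining columns only have to keep
  the list sorted.\<close>

lemma obstructed_shapes:
  assumes "3 \<le> n"
  shows "sorted_wrt (\<ge>) mid \<Longrightarrow> \<forall>h\<in>set mid. 2 \<le> h \<and> Suc h \<le> n \<Longrightarrow> 2 \<le> length mid \<Longrightarrow>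
      obstructed (replicate l n @ mid @ replicate k 1) n"
    and "3 \<le> j \<Longrightarrow> j \<le> n \<Longrightarrow> obstructed (replicate l n @ [j] @ replicate (Suc (Suc k)) 1) n"
    and "1 \<le> j \<Longrightarrow> j + 2 \<le> n \<Longrightarrow> obstructed (replicate (Suc l) n @ [j] @ replicate (Suc k) 1) n"
    and "n = 3 \<Longrightarrow> obstructed (replicate (Suc l) n @ [2] @ replicate (Suc (Suc k)) 1) n"
proof -
  note srt = sorted_wrt_append sorted_wrt_replicate
  show "obstructed (replicate l n @ mid @ replicate k 1) n"
    if mid: "sorted_wrt (\<ge>) mid" "\<forall>h\<in>set mid. 2 \<le> h \<and> Suc h \<le> n" "2 \<le> length mid"
  proof -
    obtain a b rest where ab: "mid = a # b # rest"
      using mid(3) by (cases mid; cases "tl mid") auto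
    have "obstructed (replicate l n @ [a, b] @ (rest @ replicate k 1)) n"
    proof (rule obstructed_window)
      show "obstructed [a, b] n" using mid ab by (intro obstructed_two_middle) auto
    qed (use mid ab in \<open>auto simp: srt\<close>)
    then show ?thesis using ab by simp
  qed
  show "obstructed (replicate l n @ [j] @ replicate (Suc (Suc k)) 1) n" if "3 \<le> j" "j \<le> n"
  proof -
    have "obstructed (replicate l n @ [j, 1, 1] @ replicate k 1) n"
      by (rule obstructed_window) (use that obstructed_middle_single[of 1 j n] in \<open>auto simp: srt\<close>)
    then show ?thesis by simp
  qed
  show "obstructed (replicate (Suc l) n @ [j] @ replicate (Suc k) 1) n" if "1 \<le> j" "j + 2 \<le> n"
  proof -
    have "obstructed (replicate l n @ [n, j, 1] @ replicate k 1) n"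
      by (rule obstructed_window) (use that obstructed_middle_single[of j n n] in \<open>auto simp: srt\<close>)
    then show ?thesis by (simp add: replicate_app_Cons_same)
  qed
  show "obstructed (replicate (Suc l) n @ [2] @ replicate (Suc (Suc k)) 1) n" if "n = 3"
  proof -
    have "obstructed (replicate l 3 @ [3, 2, 1, 1] @ replicate k 1) 3"
      by (rule obstructed_window) (use obstructed_3211 in \<open>auto simp: srt\<close>)
    then show ?thesis using that by (simp add: replicate_app_Cons_same)
  qed
qed

text \<open>At most one middle height survives. The numbers \<open>l\<close> and \<open>k\<close> of
  outer columns are then bounded by the obstructions and by their duals, which are applied to
  \<open>dual_heights n mu\<close> because the lattice property passes to the dual.\<close>

lemma column_lattice_cases:
  assumes n: "3 \<le> n" and mu: "sorted_wrt (\<ge>) mu" "\<forall>h\<in>set mu. 1 \<le> h \<and> h \<le> n" and lat: "column_lattice mu n"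
  shows "mu = [] \<or> (\<exists>m. 1 \<le> m \<and> m \<le> n \<and> mu = [m]) \<or> (\<exists>m. 1 \<le> m \<and> m \<le> n - 1 \<and> mu = [Suc m, 1]) \<or>
    (\<exists>m. 1 \<le> m \<and> m \<le> n - 1 \<and> mu = [n, n - m]) \<or> (\<exists>k\<ge>1. mu = replicate k 1) \<or> (\<exists>k\<ge>1. mu = replicate k n) \<or>
    (\<exists>k\<ge>1. mu = 2 # replicate (k - 1) 1) \<or> (\<exists>k\<ge>1. mu = replicate (k - 1) n @ [n - 1]) \<or> (mu = [3, 2, 1] \<and> n = 3)"
proof -
  have b: "\<forall>h\<in>set mu. h \<le> Suc n" using mu(2) by auto
  have not: "\<not> obstructed mu n" using obstructed_not_lattice lat by blast
  have not_dual: "\<not> obstructed (dual_heights n mu) n"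
  proof
    assume "obstructed (dual_heights n mu) n"
    moreover have "column_lattice (dual_heights n mu) n"
      by (rule column_lattice_dual) (use lat dual_heights_dual_heights[OF b] in \<open>auto simp: dual_heights_def\<close>)
    ultimately show False using obstructed_not_lattice by blast
  qed
  obtain l mid k where e: "mu = replicate l n @ mid @ replicate k 1" and mid: "\<forall>h\<in>set mid. 2 \<le> h \<and> Suc h \<le> n"
    using sorted_three_parts[OF mu] n by auto
  have "sorted_wrt (\<ge>) mid" using mu(1) e by (simp add: sorted_wrt_append)
  then have "\<not> 2 \<le> length mid" using obstructed_shapes(1)[OF n] mid not e by blast
  then consider "mid = []" | j where "mid = [j]" by (cases mid; cases "tl mid") auto
  then show ?thesis
  proof cases
    case 1
    have dual: "dual_heights n mu = replicate k n @ replicate l 1" using e 1 by (simp add: dual_heights_append)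
    \<comment> \<open>One column of height \<open>n\<close> takes the role of \<open>j\<close>, so
      the window is \<open>[n, 1, 1]\<close>; the case of two columns of height \<open>n\<close>
      before a single box is its dual.\<close>
    have long: "obstructed (replicate p n @ replicate q 1) n" if pq: "1 \<le> p" "2 \<le> q" for p q
    proof -
      obtain p' q' where "p = Suc p'" "q = Suc (Suc q')" using pq by (intro that[of "p - 1" "q - 2"]) arith+
      then show ?thesis using obstructed_shapes(2)[OF n, of n p' q'] n by (simp add: replicate_app_Cons_same)
    qed
    consider "l = 0" "k = 0" | "l = 0" "1 \<le> k" | "1 \<le> l" "k = 0" | "l = 1" "k = 1" | "1 \<le> l" "2 \<le> k" | "2 \<le> l" "1 \<le> k"
      by linarith
    then show ?thesis
    proof cases
      case 4
      then have "mu = [Suc (n - 1), 1]" using e 1 n by simp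
      moreover have "1 \<le> n - 1" using n by simp
      ultimately show ?thesis by blast
    next
      case 5
      then show ?thesis using long[of l k] not e 1 by simp
    next
      case 6
      then show ?thesis using long[of k l] not_dual dual by simp
    qed (use e 1 in auto)
  next
    case (2 j)
    have j: "2 \<le> j" "Suc j \<le> n" using mid 2 by auto
    have mu': "mu = replicate l n @ [j] @ replicate k 1" using e 2 by simp
    have dual: "dual_heights n mu = replicate k n @ [Suc n - j] @ replicate l 1"
      unfolding mu' dual_heights_append by simp
    have no2: "\<not> (3 \<le> j \<and> 2 \<le> k)"
    proof
      assume a: "3 \<le> j \<and> 2 \<le> k"
      then obtain k' where "k = Suc (Suc k')" by (intro that[of "k - 2"]) arith
      then show False using obstructed_shapes(2)[OF n, of j l k'] a j not mu' by simp
    qed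
    have no2': "\<not> (j + 2 \<le> n \<and> 2 \<le> l)"
    proof
      assume a: "j + 2 \<le> n \<and> 2 \<le> l"
      then obtain l' where "l = Suc (Suc l')" by (intro that[of "l - 2"]) arith
      then show False using obstructed_shapes(2)[OF n, of "Suc n - j" k l'] a j not_dual dual by simp
    qed
    have no3: "\<not> (1 \<le> l \<and> 1 \<le> k \<and> j + 2 \<le> n)"
    proof
      assume a: "1 \<le> l \<and> 1 \<le> k \<and> j + 2 \<le> n"
      then obtain l' k' where "l = Suc l'" "k = Suc k'" by (intro that[of "l - 1" "k - 1"]) arith+
      then show False using obstructed_shapes(3)[OF n, of j l' k'] a j not mu' by simp
    qed
    have no3': "\<not> (1 \<le> l \<and> 1 \<le> k \<and> 3 \<le> j)"
    proof
      assume a: "1 \<le> l \<and> 1 \<le> k \<and> 3 \<le> j"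
      then obtain l' k' where "l = Suc l'" "k = Suc k'" by (intro that[of "l - 1" "k - 1"]) arith+
      then show False using obstructed_shapes(3)[OF n, of "Suc n - j" k' l'] a j not_dual dual by simp
    qed
    have no4: "\<not> (n = 3 \<and> j = 2 \<and> 1 \<le> l \<and> 2 \<le> k)"
    proof
      assume a: "n = 3 \<and> j = 2 \<and> 1 \<le> l \<and> 2 \<le> k"
      then obtain l' k' where "l = Suc l'" "k = Suc (Suc k')" by (intro that[of "l - 1" "k - 2"]) arith+
      then show False using obstructed_shapes(4)[OF n, of l' k'] a not mu' by simp
    qed
    have no4': "\<not> (n = 3 \<and> j = 2 \<and> 2 \<le> l \<and> 1 \<le> k)"
    proof
      assume a: "n = 3 \<and> j = 2 \<and> 2 \<le> l \<and> 1 \<le> k"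
      then obtain l' k' where "l = Suc (Suc l')" "k = Suc k'" by (intro that[of "l - 2" "k - 1"]) arith+
      then show False using obstructed_shapes(4)[OF n, of k' l'] a not_dual dual by simp
    qed
    consider (a) "l = 0" "k = 0" | (b) "l = 0" "k = 1" | (c) "l = 0" "2 \<le> k" | (d) "l = 1" "k = 0" | (e) "2 \<le> l" "k = 0"
      | (f) "l = 1" "k = 1" | (g) "1 \<le> l" "2 \<le> k" | (h) "2 \<le> l" "1 \<le> k" by linarith
    then show ?thesis
    proof cases
      case a
      then have "mu = [j]" using mu' by simp
      then show ?thesis using j by auto
    next
      case b
      then have "mu = [Suc (j - 1), 1]" "1 \<le> j - 1" "j - 1 \<le> n - 1" using mu' j by auto
      then show ?thesis by blast
    next
      case c
      then have "mu = 2 # replicate (Suc k - 1) 1" using no2 j mu' by simp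
      then show ?thesis by (metis le_add1 plus_1_eq_Suc)
    next
      case d
      then have "mu = [n, n - (n - j)]" "1 \<le> n - j" "n - j \<le> n - 1" using mu' j by auto
      then show ?thesis by blast
    next
      case e
      then have "j = n - 1" using no2' j by auto
      then have "mu = replicate (Suc l - 1) n @ [n - 1]" using mu' e by simp
      then show ?thesis by (metis le_add1 plus_1_eq_Suc)
    next
      case f
      \<comment> \<open>With outer columns on both sides, \<open>no3\<close> gives
        \<open>n - 1 \<le> j\<close> and its dual gives \<open>j \<le> 2\<close>; together with
        \<open>3 \<le> n\<close> this leaves only rank three.\<close>
      then have "j = 2" "n = 3" using no3 no3' j n by auto
      then show ?thesis using mu' f by simp
    next
      case g
      then have "j = 2" "n = 3" using no3 no3' j n by auto
      then show ?thesis using no4 g by simp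
    next
      case h
      then have "j = 2" "n = 3" using no3 no3' j n by auto
      then show ?thesis using no4' h by simp
    qed
  qed
qed

theorem theorem1p2:
  fixes n :: nat and lam :: "nat list"
  assumes "is_partition lam" and "length lam \<le> n"
  shows "(n \<in> {1, 2} \<longrightarrow> crystal_is_lattice lam n) \<and>
         (3 \<le> n \<longrightarrow>
           (crystal_is_lattice lam n \<longleftrightarrow>
              (\<exists>m. m \<le> n \<and> lam = replicate m 1) \<or>
              (\<exists>m. 1 \<le> m \<and> m \<le> n - 1 \<and> lam = 2 # replicate m 1) \<or>
              (\<exists>m. 1 \<le> m \<and> m \<le> n - 1 \<and> lam = replicate (n - m) 2 @ replicate m 1) \<or>
              (\<exists>k. 1 \<le> k \<and> lam = [k]) \<or>
              (\<exists>k. 1 \<le> k \<and> lam = replicate n k) \<or>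
              (\<exists>k. 1 \<le> k \<and> lam = [k, 1]) \<or>
              (\<exists>k. 1 \<le> k \<and> lam = filter (\<lambda>x. 0 < x) (replicate (n - 1) k @ [k - 1])) \<or>
              (lam = [3, 2, 1] \<and> n = 3)))"
proof -
  define mu where "mu = conjugate lam"
  have iff: "crystal_is_lattice lam n \<longleftrightarrow> column_lattice mu n"
    using crystal_is_lattice_iff assms(1) by (simp add: is_partition_def mu_def)
  have mu: "sorted_wrt (\<ge>) mu" "\<forall>h\<in>set mu. 1 \<le> h \<and> h \<le> n"
    using conjugate_props[OF assms(1)] assms(2) by (auto simp: mu_def)
  have small: "column_lattice mu n" if "n \<in> {1, 2}"
  proof (cases "n = 1")
    case True
    then have "mu = replicate (length mu) 1" using mu(2) by (metis le_antisym replicate_eqI)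
    then show ?thesis using column_lattice_shapes(5)[of 1 "length mu"] True by simp
  next
    case False
    then have n: "n = 2" using that by simp
    then obtain l mid k where e: "mu = replicate l n @ mid @ replicate k 1" "\<forall>h\<in>set mid. 2 \<le> h \<and> Suc h \<le> n"
      using sorted_three_parts[OF mu] by auto
    \<comment> \<open>For \<open>n = 2\<close> there is no height \<open>h\<close> with
      \<open>2 \<le> h\<close> and \<open>h + 1 \<le> n\<close>, so only heights 2 and 1
      occur.\<close>
    then have "mid = []" using n by (cases mid) auto
    then show ?thesis using e n column_lattice_rank_two by simp
  qed
  have part: "is_partition (replicate k x)" if "0 < x" for k x
    using that by (auto simp: is_partition_def sorted_wrt_replicate)
  have shape: "lam = nu \<longleftrightarrow> mu = ka" if "is_partition ka" "conjugate ka = nu" for ka nu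
    using conjugate_eq_iff[OF assms(1) that] by (simp add: mu_def)
  have main: "column_lattice mu n \<longleftrightarrow>
      mu = [] \<or> (\<exists>m. 1 \<le> m \<and> m \<le> n \<and> mu = [m]) \<or> (\<exists>m. 1 \<le> m \<and> m \<le> n - 1 \<and> mu = [Suc m, 1]) \<or>
      (\<exists>m. 1 \<le> m \<and> m \<le> n - 1 \<and> mu = [n, n - m]) \<or> (\<exists>k\<ge>1. mu = replicate k 1) \<or> (\<exists>k\<ge>1. mu = replicate k n) \<or>
      (\<exists>k\<ge>1. mu = 2 # replicate (k - 1) 1) \<or> (\<exists>k\<ge>1. mu = replicate (k - 1) n @ [n - 1]) \<or> (mu = [3, 2, 1] \<and> n = 3)"
    (is "_ \<longleftrightarrow> ?shapes") if n: "3 \<le> n"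
  proof
    assume "column_lattice mu n"
    then show ?shapes using column_lattice_cases[OF n mu] by blast
  next
    have "1 \<le> n" using n by simp
    note L = column_lattice_shapes[OF this] and L8 = column_lattice_321
    assume ?shapes
    then show "column_lattice mu n"
    proof (elim disjE exE conjE)
      assume "mu = []"
      then show ?thesis using L(1) by (simp only:)
    next
      fix m assume "1 \<le> m" "m \<le> n" "mu = [m]"
      then show ?thesis using L(2)[of m] by (simp only:)
    next
      fix m assume "1 \<le> m" "m \<le> n - 1" "mu = [Suc m, 1]"
      moreover from this have "m \<le> n" by simp
      ultimately show ?thesis using L(3)[of m] by (simp only:)
    next
      fix m assume "1 \<le> m" "m \<le> n - 1" "mu = [n, n - m]"
      moreover from this have "m \<le> n" by simp
      ultimately show ?thesis using L(4)[of m] by (simp only:)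
    next
      fix k assume "mu = replicate k 1"
      then show ?thesis using L(5)[of k] by (simp only:)
    next
      fix k assume "mu = replicate k n"
      then show ?thesis using L(6)[of k] by (simp only:)
    next
      fix k assume "1 \<le> k" "mu = 2 # replicate (k - 1) 1"
      then show ?thesis using L(7)[of k] by (simp only:)
    next
      fix k assume "1 \<le> k" "mu = replicate (k - 1) n @ [n - 1]"
      then show ?thesis using L(8)[of k] by (simp only:)
    next
      assume "mu = [3, 2, 1]" "n = 3"
      then show ?thesis using L8 by (simp only:)
    qed
  qed
  \<comment> \<open>The empty partition is the case \<open>m = 0\<close> on the side of
    \<open>lam\<close>, but on the side of column heights it is a separate shape, since
    \<open>[0]\<close> is not the conjugate of a partition.\<close>
  have e1: "(mu = [] \<or> (\<exists>m. 1 \<le> m \<and> m \<le> n \<and> mu = [m])) \<longleftrightarrow> (\<exists>m. m \<le> n \<and> lam = replicate m 1)"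
  proof -
    have "mu = [] \<longleftrightarrow> lam = []" using shape[of "[]"] conjugate_shapes(1) by (simp add: is_partition_def)
    moreover have "mu = [m] \<longleftrightarrow> lam = replicate m 1" if "1 \<le> m" for m
      using shape[of "[m]"] conjugate_shapes(2)[of m] that by (simp add: is_partition_def)
    ultimately show ?thesis by (metis le0 less_one not_le replicate_0)
  qed
  show ?thesis
  proof (intro conjI impI)
    assume "n \<in> {1, 2}"
    then show "crystal_is_lattice lam n" using small iff by simp
  next
    assume n: "3 \<le> n"
    have e2: "mu = [Suc m, 1] \<longleftrightarrow> lam = 2 # replicate m 1" for m
      using shape[OF _ conjugate_shapes(3)[of m]] by (simp add: is_partition_def)
    have e3: "(\<exists>m. 1 \<le> m \<and> m \<le> n - 1 \<and> mu = [n, n - m]) \<longleftrightarrow>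
        (\<exists>m. 1 \<le> m \<and> m \<le> n - 1 \<and> lam = replicate (n - m) 2 @ replicate m 1)"
    proof (intro ex_cong1 conj_cong refl)
      fix m assume "1 \<le> m" "m \<le> n - 1"
      then show "mu = [n, n - m] \<longleftrightarrow> lam = replicate (n - m) 2 @ replicate m 1"
        using shape[OF _ conjugate_shapes(4)[of m n]] n by (auto simp: is_partition_def)
    qed
    have e4: "(\<exists>k\<ge>1. mu = replicate k 1) \<longleftrightarrow> (\<exists>k. 1 \<le> k \<and> lam = [k])"
    proof (intro ex_cong1 conj_cong refl)
      fix k :: nat assume "1 \<le> k"
      then show "mu = replicate k 1 \<longleftrightarrow> lam = [k]"
        using shape[OF part conjugate_shapes(5)[of k]] by simp
    qed
    have e5: "(\<exists>k\<ge>1. mu = replicate k n) \<longleftrightarrow> (\<exists>k. 1 \<le> k \<and> lam = replicate n k)"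
    proof (intro ex_cong1 conj_cong refl)
      fix k :: nat assume "1 \<le> k"
      then show "mu = replicate k n \<longleftrightarrow> lam = replicate n k"
        using shape[OF part conjugate_shapes(6)[of k n]] n by simp
    qed
    have e6: "(\<exists>k\<ge>1. mu = 2 # replicate (k - 1) 1) \<longleftrightarrow> (\<exists>k. 1 \<le> k \<and> lam = [k, 1])"
    proof (intro ex_cong1 conj_cong refl)
      fix k :: nat assume "1 \<le> k"
      then show "mu = 2 # replicate (k - 1) 1 \<longleftrightarrow> lam = [k, 1]"
        using shape[OF _ conjugate_shapes(7)[of k]] by (auto simp: is_partition_def sorted_wrt_replicate)
    qed
    have e7: "(\<exists>k\<ge>1. mu = replicate (k - 1) n @ [n - 1]) \<longleftrightarrow>
        (\<exists>k. 1 \<le> k \<and> lam = filter (\<lambda>x. 0 < x) (replicate (n - 1) k @ [k - 1]))"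
    proof (intro ex_cong1 conj_cong refl)
      fix k :: nat assume "1 \<le> k"
      then show "mu = replicate (k - 1) n @ [n - 1] \<longleftrightarrow> lam = filter (\<lambda>x. 0 < x) (replicate (n - 1) k @ [k - 1])"
        using shape[OF _ conjugate_almost_rectangle[of k n]] n
        by (auto simp: is_partition_def sorted_wrt_append sorted_wrt_replicate)
    qed
    have e8: "mu = [3, 2, 1] \<longleftrightarrow> lam = [3, 2, 1]"
      using shape[OF _ conjugate_shapes(8)] by (simp add: is_partition_def)
    show "crystal_is_lattice lam n \<longleftrightarrow>
        (\<exists>m. m \<le> n \<and> lam = replicate m 1) \<or>
        (\<exists>m. 1 \<le> m \<and> m \<le> n - 1 \<and> lam = 2 # replicate m 1) \<or>
        (\<exists>m. 1 \<le> m \<and> m \<le> n - 1 \<and> lam = replicate (n - m) 2 @ replicate m 1) \<or>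
        (\<exists>k. 1 \<le> k \<and> lam = [k]) \<or>
        (\<exists>k. 1 \<le> k \<and> lam = replicate n k) \<or>
        (\<exists>k. 1 \<le> k \<and> lam = [k, 1]) \<or>
        (\<exists>k. 1 \<le> k \<and> lam = filter (\<lambda>x. 0 < x) (replicate (n - 1) k @ [k - 1])) \<or>
        (lam = [3, 2, 1] \<and> n = 3)"
      by (simp only: iff main[OF n] e1[symmetric] e2[symmetric] e3[symmetric] e4[symmetric] e5[symmetric]
          e6[symmetric] e7[symmetric] e8[symmetric] disj_assoc)
  qed
qed

end
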